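(* Let $L$ be a totally real triquadratic field, i.e. $L=\mathbb{Q}(\sqrt{m},\sqrt{n},\sqrt{d})$ with positive integers $m,n,d$ and $\mathrm{Gal}(L/\mathbb{Q})\cong(\mathbb{Z}/2\mathbb{Z})^3$. If the class number of $L$ is odd, then every unit $u\in\mathcal{O}_L^\times$ satisfies $N_{L/\mathbb{Q}}(u)=+1$. *)

theory Defs
  imports Complex_Main "HOL-Algebra.Algebra" "HOL-Algebra.Algebraic_Closure_Type"
begin

text \<open>
  Number fields are subfields of the complex numbers, given by their sets of elements.
\<close>

abbreviation complex_ring :: "complex ring"  (\<open>\<C>\<close>)
  where "\<C> \<equiv> ring_of_type_algebra"

definition rat_adjoin :: "complex set \<Rightarrow> complex set"
  where "rat_adjoin S = generate_field \<C> (\<rat> \<union> S)"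

definition ring_on :: "complex set \<Rightarrow> complex ring"
  where "ring_on A = \<C>\<lparr>carrier := A\<rparr>"

text \<open>
  Automorphisms and embeddings are taken extensional (undefined outside the field), so that
  they correspond one-to-one to the mathematical maps.
\<close>

definition galois_group :: "complex set \<Rightarrow> (complex \<Rightarrow> complex) monoid"
  where "galois_group K = BijGroup K
    \<lparr>carrier := {\<sigma> \<in> ring_iso (ring_on K) (ring_on K) \<inter> extensional K. \<forall>q\<in>\<rat>. \<sigma> q = q}\<rparr>"

definition embeddings :: "complex set \<Rightarrow> (complex \<Rightarrow> complex) set"
  where "embeddings K = ring_hom (ring_on K) \<C> \<inter> extensional K"

text \<open>
  A number field has only finitely many embeddings; for an infinite extension of the rationals
  the product below may degenerate to \<open>1\<close>.
\<close>

definition field_norm :: "complex set \<Rightarrow> complex \<Rightarrow> complex"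
  where "field_norm K x = (\<Prod>\<sigma>\<in>embeddings K. \<sigma> x)"

definition ring_of_integers :: "complex set \<Rightarrow> complex ring"
  where "ring_of_integers K = ring_on {x \<in> K. algebraic_int x}"

definition fractional_ideals :: "complex set \<Rightarrow> complex set set"
  where "fractional_ideals K =
    {I. I \<subseteq> K \<and> I \<noteq> {0} \<and>
        (\<exists>c \<in> carrier (ring_of_integers K). c \<noteq> 0 \<and> ideal ((*) c ` I) (ring_of_integers K))}"

definition principal_fractional_ideals :: "complex set \<Rightarrow> complex set set"
  where "principal_fractional_ideals K =
    {(*) a ` carrier (ring_of_integers K) | a. a \<in> K \<and> a \<noteq> 0}"

text \<open>
  For fractional ideals \<open>I\<close> and \<open>J\<close>, the set \<open>ideal_prod \<C> I J\<close> consists of the finite sums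
  of products \<open>i * j\<close>; the ambient ring enters only through its operations.
\<close>

definition ideal_group :: "complex set \<Rightarrow> complex set monoid"
  where "ideal_group K =
    \<lparr>carrier = fractional_ideals K,
     monoid.mult = ideal_prod \<C>,
     one = carrier (ring_of_integers K)\<rparr>"

definition class_group :: "complex set \<Rightarrow> complex set set monoid"
  where "class_group K = ideal_group K Mod principal_fractional_ideals K"

text \<open>\<open>Coset.order\<close> is \<open>0\<close> on infinite groups, but class groups of number fields are finite.\<close>

definition class_number :: "complex set \<Rightarrow> nat"
  where "class_number K = Coset.order (class_group K)"

end

theory Submission
  imports
    Defs
    "HOL-Number_Theory.Number_Theory"
    "HOL-Library.Z2"
    "HOL-Library.Product_Plus"
    "Jordan_Normal_Form.Char_Poly"
begin

text \<open>
  Suppose some unit \<open>u\<close> has norm \<open>-1\<close>. Its signature is a unit of the group ring of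
  \<open>(\<int>/2)\<^sup>3\<close> over the field with two elements, so the conjugates of \<open>u\<close> realise all signatures;
  as the unit group has rank at most \<open>7\<close>, every totally definite unit is a square up to sign. With
  odd class number, it follows that any totally definite \<open>\<alpha>\<close> whose ideal is a square is itself
  \<open>\<plusminus>\<close> a square in \<open>L\<close>.

  For \<open>\<alpha> = p\<close> a prime dividing \<open>m\<close>, \<open>n\<close> or \<open>d\<close> exactly once this shows \<open>\<surd>p \<in> L\<close>, so
  \<open>L = \<rat>(\<surd>p, \<surd>q, \<surd>r)\<close> for three primes. The norms of \<open>u\<close> to the quadratic subfields force each of
  them to be \<open>2\<close> or \<open>1\<close> modulo \<open>4\<close>. By quadratic reciprocity, one of the equations
  \<open>x\<^sup>2 = p y\<^sup>2 + q z\<^sup>2\<close> (if two of the primes are residues of each other) or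
  \<open>q x\<^sup>2 = p y\<^sup>2 + r z\<^sup>2\<close> (if no two are) satisfies Legendre's conditions. A primitive solution yields
  \<open>\<alpha> = x + y \<surd>p\<close>, or \<open>\<alpha> = (x \<surd>q + y \<surd>p) w\<close> with \<open>w\<close> the norm of \<open>u\<close> to \<open>\<rat>(\<surd>q)\<close>; up to a factor
  \<open>2\<close> it is totally definite with square ideal, but \<open>L(\<surd>\<alpha>)\<close> has non-commuting automorphisms over
  \<open>\<rat>\<close>, so \<open>\<alpha>\<close> is not \<open>\<plusminus>\<close> a square.
\<close>

text \<open>The obstacle is to exploit an odd class number without factoring ideals. Only ideals
  with two generators occur, and (\<alpha>, \<beta>)^2 = (\<kappa>) is certified by ring equations:
  \<alpha>^2, \<alpha>\<beta> and \<beta>^2 are \<kappa> times elements that generate the unit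
  ideal. Multiplication by (\<alpha>, \<beta>) is then an involution on an odd set of classes, and a
  fixed class gives \<kappa> = e a^2 with a unit e. If \<kappa> is definite, so is e, and e is a
  square up to sign. Definite means that all conjugates have the same sign, not that they are
  positive. The ternary equations produce such elements: (x + y sqrt p)(x - y sqrt p) = q z^2 is
  positive, so negating sqrt p preserves the sign. For x sqrt q + y sqrt p the sign still changes
  together with sqrt q; the factor w changes sign at the same moment, because its norm from Q(sqrt
  q) is -1. The contradiction uses \<alpha> \<alpha>' = \<beta>^2, where \<beta> contains the root
  of the third coefficient: it forces a square root of w \<alpha> to behave as no element of a field
  with commuting conjugations can.\<close>

hide_const (open) Divisibility.prime

section \<open>Algebraic integers\<close>

text \<open>Multiplication by \<open>x\<close> maps the Z-span of the family \<open>w\<close> into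
  itself. For a fixed \<open>w\<close> such elements are closed under sums and products, which is
  how sums and products of algebraic integers are shown to be integral.\<close>

definition acts_integrally :: "'i set \<Rightarrow> ('i \<Rightarrow> 'a::field_char_0) \<Rightarrow> 'a \<Rightarrow> bool"
  where "acts_integrally I w x \<longleftrightarrow>
    (\<exists>A :: 'i \<Rightarrow> 'i \<Rightarrow> int. \<forall>i\<in>I. x * w i = (\<Sum>j\<in>I. of_int (A i j) * w j))"

lemma acts_integrally_span:
  assumes "finite I" "acts_integrally I w x"
  shows "\<exists>b :: 'i \<Rightarrow> int. x * (\<Sum>i\<in>I. of_int (a i) * w i) = (\<Sum>j\<in>I. of_int (b j) * w j)"
proof -
  obtain A :: "'i \<Rightarrow> 'i \<Rightarrow> int" where A: "\<forall>i\<in>I. x * w i = (\<Sum>j\<in>I. of_int (A i j) * w j)"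
    using assms unfolding acts_integrally_def by blast
  have "x * (\<Sum>i\<in>I. of_int (a i) * w i) = (\<Sum>i\<in>I. of_int (a i) * (x * w i))"
    unfolding sum_distrib_left by (intro sum.cong refl mult.left_commute)
  also have "\<dots> = (\<Sum>i\<in>I. \<Sum>j\<in>I. of_int (a i) * (of_int (A i j) * w j))"
    using A by (intro sum.cong) (auto simp: sum_distrib_left)
  also have "\<dots> = (\<Sum>j\<in>I. \<Sum>i\<in>I. of_int (a i) * (of_int (A i j) * w j))"
    by (rule sum.swap)
  also have "\<dots> = (\<Sum>j\<in>I. of_int (\<Sum>i\<in>I. a i * A i j) * w j)"
    by (simp add: sum_distrib_right mult.assoc)
  finally show ?thesis by (intro exI[of _ "\<lambda>j. \<Sum>i\<in>I. a i * A i j"])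
qed

lemma acts_integrally_iff_span:
  "acts_integrally I w x \<longleftrightarrow>
    (\<forall>i\<in>I. \<exists>b :: 'i \<Rightarrow> int. x * w i = (\<Sum>j\<in>I. of_int (b j) * w j))"
  unfolding acts_integrally_def by (rule bchoice_iff[symmetric])

lemma acts_integrally_add:
  assumes "acts_integrally I w x" "acts_integrally I w y"
  shows "acts_integrally I w (x + y)"
proof -
  obtain A B :: "'a \<Rightarrow> 'a \<Rightarrow> int" where "\<forall>i\<in>I. x * w i = (\<Sum>j\<in>I. of_int (A i j) * w j)"
     "\<forall>i\<in>I. y * w i = (\<Sum>j\<in>I. of_int (B i j) * w j)"
    using assms unfolding acts_integrally_def by blast
  then have "\<forall>i\<in>I. (x + y) * w i = (\<Sum>j\<in>I. of_int (A i j + B i j) * w j)"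
    by (simp add: distrib_right sum.distrib)
  then show ?thesis unfolding acts_integrally_def by (intro exI[of _ "\<lambda>i j. A i j + B i j"])
qed

lemma acts_integrally_mult:
  assumes "finite I" "acts_integrally I w x" "acts_integrally I w y"
  shows "acts_integrally I w (x * y)"
  unfolding acts_integrally_iff_span
proof
  fix i assume "i \<in> I"
  then obtain b :: "'a \<Rightarrow> int" where "y * w i = (\<Sum>j\<in>I. of_int (b j) * w j)"
    using assms(3) unfolding acts_integrally_iff_span by blast
  with acts_integrally_span[OF assms(1,2), of b]
  show "\<exists>b :: 'a \<Rightarrow> int. x * y * w i = (\<Sum>j\<in>I. of_int (b j) * w j)"
    by (simp add: mult.assoc)
qed

lemma acts_integrally_of_int:
  assumes "finite I"
  shows "acts_integrally I w (of_int c)"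
proof -
  have "of_int c * w i = (\<Sum>j\<in>I. of_int (if j = i then c else 0) * w j)" if "i \<in> I" for i
  proof -
    have "(\<Sum>j\<in>I. of_int (if j = i then c else 0) * w j) = (\<Sum>j\<in>I. if j = i then of_int c * w j else 0)"
      by (intro sum.cong) auto
    then show ?thesis using that assms by simp
  qed
  then show ?thesis unfolding acts_integrally_def
    by (intro exI[of _ "\<lambda>i j. if j = i then c else 0"]) auto
qed

text \<open>The family is enlarged by the powers of \<open>x\<close> below \<open>k\<close>.
  Multiplication by \<open>x\<close> raises the exponent, and at the top the relation rewrites
  \<open>x ^ k\<close> with coefficients that stabilise the span of \<open>w\<close>; the old
  elements act on each power separately.\<close>

lemma acts_integrally_adjoin:
  fixes w :: "'i \<Rightarrow> 'a::field_char_0"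
  assumes fin: "finite I" and x: "x ^ k = (\<Sum>l<k. c l * x ^ l)" 
    and c: "\<And>l. l < k \<Longrightarrow> acts_integrally I w (c l)"
  defines "v \<equiv> \<lambda>(i, e). w i * x ^ e"
  shows "acts_integrally (I \<times> {..<k}) v x"
    and "acts_integrally I w y \<Longrightarrow> acts_integrally (I \<times> {..<k}) v y"
proof -
  show old: "acts_integrally (I \<times> {..<k}) v y" if "acts_integrally I w y" for y
    unfolding acts_integrally_iff_span
  proof
    fix t assume "t \<in> I \<times> {..<k}"
    then obtain i e where t: "t = (i, e)" and i: "i \<in> I" "e \<in> {..<k}" by blast
    obtain b :: "'i \<Rightarrow> int" where b: "y * w i = (\<Sum>j\<in>I. of_int (b j) * w j)"
      using \<open>acts_integrally I w y\<close> i unfolding acts_integrally_iff_span by blast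
    have "y * v (i, e) = (\<Sum>j\<in>I. of_int (b j) * w j) * x ^ e"
      unfolding b[symmetric] by (simp add: v_def mult.assoc)
    also have "\<dots> = (\<Sum>j\<in>I. \<Sum>f<k. of_int (if f = e then b j else 0) * v (j, f))"
      unfolding sum_distrib_right
    proof (intro sum.cong refl)
      fix j
      have "(\<Sum>f<k. of_int (if f = e then b j else 0) * v (j, f)) = (\<Sum>f<k. if f = e then of_int (b j) * v (j, f) else 0)"
        by (intro sum.cong) auto
      then show "of_int (b j) * w j * x ^ e = (\<Sum>f<k. of_int (if f = e then b j else 0) * v (j, f))"
        using i by (simp add: v_def mult.assoc)
    qed
    also have "\<dots> = (\<Sum>(j, f)\<in>I \<times> {..<k}. of_int (if f = e then b j else 0) * v (j, f))"
      by (rule sum.cartesian_product)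
    finally show "\<exists>b :: _ \<Rightarrow> int. y * v t = (\<Sum>j\<in>I \<times> {..<k}. of_int (b j) * v j)"
      by (intro exI[of _ "\<lambda>(j, f). if f = e then b j else 0"]) (simp add: case_prod_unfold t)
  qed
  let ?J = "I \<times> {..<k}"
  have finJ: "finite ?J" using fin by simp
  define span where "span = {z. \<exists>b :: 'i \<times> nat \<Rightarrow> int. z = (\<Sum>j\<in>?J. of_int (b j) * v j)}"
  have span_v: "v j \<in> span" if "j \<in> ?J" for j
  proof -
    have "1 * v j = (\<Sum>i\<in>?J. of_int (if i = j then 1 else 0) * v i)"
    proof -
      have "(\<Sum>i\<in>?J. of_int (if i = j then 1 else 0) * v i) = (\<Sum>i\<in>?J. if i = j then v i else 0)"
        by (intro sum.cong) auto
      then show ?thesis using that finJ by simp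
    qed
    then show ?thesis unfolding span_def by (auto intro!: exI[of _ "\<lambda>i. if i = j then 1 else 0"])
  qed
  have span_mult: "y * z \<in> span" if "acts_integrally I w y" "z \<in> span" for y z
    using acts_integrally_span[OF finJ old[OF that(1)]] that(2) unfolding span_def by auto
  have span_add: "y + z \<in> span" if yz: "y \<in> span" "z \<in> span" for y z
  proof -
    obtain b b' :: "'i \<times> nat \<Rightarrow> int" where
      "y = (\<Sum>j\<in>?J. of_int (b j) * v j)" "z = (\<Sum>j\<in>?J. of_int (b' j) * v j)"
      using yz unfolding span_def by blast
    then have "y + z = (\<Sum>j\<in>?J. of_int (b j + b' j) * v j)"
      by (simp add: sum.distrib distrib_right)
    then show ?thesis unfolding span_def by (auto intro!: exI[of _ "\<lambda>j. b j + b' j"])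
  qed
  have span_0: "0 \<in> span" unfolding span_def by (auto intro!: exI[of _ "\<lambda>_. 0"])
  have span_sum: "(\<Sum>l\<in>S. f l) \<in> span" if "\<And>l. l \<in> S \<Longrightarrow> f l \<in> span" for S :: "nat set" and f
    using that by (induction S rule: infinite_finite_induct) (auto intro: span_0 span_add)
  have "x * v j \<in> span" if "j \<in> ?J" for j
  proof -
    obtain i e where j: "j = (i, e)" "i \<in> I" "e < k"
      using \<open>j \<in> I \<times> {..<k}\<close> by blast
    show ?thesis
    proof (cases "Suc e < k")
      case True
      have "x * v j = v (i, Suc e)" by (simp add: v_def j algebra_simps)
      then show ?thesis using span_v[of "(i, Suc e)"] True j by simp
    next
      case False
      then have "Suc e = k" using j by simp
      then have "x * v j = w i * x ^ k" by (auto simp: v_def j algebra_simps)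
      also have "\<dots> = (\<Sum>l<k. c l * v (i, l))"
        by (simp add: x sum_distrib_left v_def algebra_simps)
      also have "\<dots> \<in> span" using j by (intro span_sum span_mult c span_v) auto
      finally show ?thesis .
    qed
  qed
  then show "acts_integrally ?J v x" unfolding acts_integrally_iff_span span_def by blast
qed

text \<open>The family \<open>w\<close> is a nonzero eigenvector of an integer matrix with
  eigenvalue \<open>x\<close>, so \<open>x\<close> is a root of the characteristic polynomial, which
  is monic with integer coefficients.\<close>

lemma acts_integrally_imp_algebraic_int:
  fixes w :: "'i \<Rightarrow> 'a::field_char_0"
  assumes fin: "finite I" and x: "acts_integrally I w x" and nz: "i\<^sub>0 \<in> I" "w i\<^sub>0 \<noteq> 0"
  shows "algebraic_int x"
proof -
  obtain A :: "'i \<Rightarrow> 'i \<Rightarrow> int" where A: "\<forall>i\<in>I. x * w i = (\<Sum>j\<in>I. of_int (A i j) * w j)"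
    using x unfolding acts_integrally_def by blast
  define n where "n = card I"
  obtain h where h: "bij_betw h {0..<n} I" using fin unfolding n_def
    using ex_bij_betw_nat_finite by blast
  define M where "M = mat n n (\<lambda>(i, j). A (h i) (h j))"
  define M' :: "'a mat" where "M' = map_mat of_int M"
  define v where "v = vec n (\<lambda>i. w (h i))"
  have M': "M' \<in> carrier_mat n n" unfolding M'_def M_def by simp
  have "M' *\<^sub>v v = x \<cdot>\<^sub>v v"
  proof (rule eq_vecI)
    fix i assume "i < dim_vec (x \<cdot>\<^sub>v v)"
    then have i: "i < n" by (simp add: v_def)
    then have "h i \<in> I" using h by (auto simp: bij_betw_def)
    then have "x * w (h i) = (\<Sum>j\<in>I. of_int (A (h i) j) * w j)" using A by blast
    also have "\<dots> = (\<Sum>j\<in>{0..<n}. of_int (A (h i) (h j)) * w (h j))"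
      using h by (rule sum.reindex_bij_betw[symmetric])
    finally show "(M' *\<^sub>v v) $ i = (x \<cdot>\<^sub>v v) $ i"
      using i by (simp add: v_def M'_def M_def scalar_prod_def)
  qed (simp add: v_def M'_def M_def)
  moreover have "v \<noteq> 0\<^sub>v n"
  proof
    assume v0: "v = 0\<^sub>v n"
    obtain i where i: "i < n" "h i = i\<^sub>0" using h nz(1)
      by (auto simp: bij_betw_def)
    have "v $ i = 0" using v0 i by simp
    then show False using i nz(2) by (simp add: v_def)
  qed
  ultimately have "eigenvector M' v x" unfolding eigenvector_def using M' by (simp add: v_def)
  then have "eigenvalue M' x" unfolding eigenvalue_def by blast
  then have root: "poly (char_poly M') x = 0" using eigenvalue_root_char_poly[OF M'] by blast
  have "char_poly M' = map_poly of_int (char_poly M)"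
    unfolding M'_def by (rule of_int_hom.char_poly_hom[of _ n]) (simp add: M_def)
  then have "\<forall>i. coeff (char_poly M') i \<in> \<int>" by simp
  moreover have "lead_coeff (char_poly M') = 1" using degree_monic_char_poly[OF M'] by simp
  ultimately show ?thesis using root by (intro algebraic_int.intros) auto
qed

lemma algebraic_int_monic_relation:
  fixes x :: "'a::field_char_0"
  assumes "algebraic_int x"
  obtains k :: nat and c :: "nat \<Rightarrow> int" where "k > 0" "x ^ k = (\<Sum>l<k. of_int (c l) * x ^ l)"
proof -
  obtain p where p: "lead_coeff p = 1" "\<forall>i. coeff p i \<in> \<int>" "poly p x = 0"
    using assms by (auto elim: algebraic_int.cases)
  let ?k = "degree p"
  have "?k > 0"
  proof (rule ccontr)
    assume "\<not> ?k > 0"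
    then obtain a where "p = [:a:]" using degree_eq_zeroE by blast
    then show False using p by simp
  qed
  have "\<exists>d :: int. coeff p i = of_int d" for i
    using Ints_cases[OF p(2)[rule_format, of i]] by blast
  then obtain d :: "nat \<Rightarrow> int" where d: "\<And>i. coeff p i = of_int (d i)"
    using choice[of "\<lambda>i d. coeff p i = of_int d"] by blast
  have "poly p x = (\<Sum>l<?k. coeff p l * x ^ l) + x ^ ?k"
    unfolding poly_altdef using p(1) by (simp add: lessThan_Suc_atMost[symmetric])
  then have "x ^ ?k = - (\<Sum>l<?k. of_int (d l) * x ^ l)"
    using p(3) by (simp add: d eq_neg_iff_add_eq_0 add.commute)
  also have "\<dots> = (\<Sum>l<?k. of_int (- d l) * x ^ l)"
    by (simp add: sum_negf)
  finally show thesis by (rule that[OF \<open>?k > 0\<close>])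
qed

text \<open>Monomials of bounded degree in \<open>y\<close>, \<open>z\<close> and \<open>x\<close>
  span a module stable under all three, so sum and product come along with \<open>x\<close>. The
  quadratic case is the one needed later for pairs of conjugates.\<close>

lemma algebraic_int_root_monic_quadratic:
  fixes x y z :: "'a::field_char_0"
  assumes y: "algebraic_int y" and z: "algebraic_int z" and x: "x\<^sup>2 = y * x + z"
  shows "algebraic_int x" "algebraic_int (y + z)" "algebraic_int (y * z)"
proof -
  obtain k c where y': "k > 0" "y ^ k = (\<Sum>l<k. of_int (c l :: int) * y ^ l)"
    using algebraic_int_monic_relation[OF y] by blast
  obtain m d where z': "m > 0" "z ^ m = (\<Sum>l<m. of_int (d l :: int) * z ^ l)"
    using algebraic_int_monic_relation[OF z] by blast
  define I1 where "I1 = {()} \<times> {..<k}"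
  define w1 where "w1 = (\<lambda>(i :: unit, e). 1 * y ^ e)"
  define I2 where "I2 = I1 \<times> {..<m}"
  define w2 where "w2 = (\<lambda>(i, e). w1 i * z ^ e)"
  define I3 where "I3 = I2 \<times> {..<2::nat}"
  define w3 where "w3 = (\<lambda>(i, e). w2 i * x ^ e)"
  have fin: "finite I1" "finite I2" "finite I3" by (auto simp: I1_def I2_def I3_def)
  have y1: "acts_integrally I1 w1 y" unfolding I1_def w1_def
    by (rule acts_integrally_adjoin(1)[OF _ y'(2)]) (auto intro: acts_integrally_of_int)
  have z2: "acts_integrally I2 w2 z" unfolding I2_def w2_def
    by (rule acts_integrally_adjoin(1)[OF fin(1) z'(2)]) (auto intro: acts_integrally_of_int fin)
  have y2: "acts_integrally I2 w2 y" unfolding I2_def w2_def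
    by (rule acts_integrally_adjoin(2)[OF fin(1) z'(2)]) (auto intro: acts_integrally_of_int fin y1)
  have "x ^ 2 = (\<Sum>l<2. (if l = 0 then z else y) * x ^ l)"
    unfolding x by (simp add: numeral_2_eq_2)
  then have x3: "acts_integrally I3 w3 x" unfolding I3_def w3_def
    by (rule acts_integrally_adjoin(1)[OF fin(2)]) (simp add: y2 z2)
  have nz2: "(((),0),0) \<in> I2" "w2 (((),0),0) \<noteq> 0"
    using y' z' by (auto simp: I1_def I2_def w1_def w2_def)
  have nz3: "((((),0),0),0) \<in> I3" "w3 ((((),0),0),0) \<noteq> 0"
    using nz2 by (auto simp: I3_def w3_def)
  show "algebraic_int x" using acts_integrally_imp_algebraic_int[OF fin(3) x3 nz3] .
  show "algebraic_int (y + z)"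
    using acts_integrally_imp_algebraic_int[OF fin(2) acts_integrally_add[OF y2 z2] nz2] .
  show "algebraic_int (y * z)"
    using acts_integrally_imp_algebraic_int[OF fin(2) acts_integrally_mult[OF fin(2) y2 z2] nz2] .
qed

lemma algebraic_int_add_mult:
  fixes y z :: complex
  assumes "algebraic_int y" "algebraic_int z"
  shows "algebraic_int (y + z)" "algebraic_int (y * z)"
proof -
  \<comment> \<open>The root is auxiliary: over the complex numbers it exists, and it only serves to
    meet the hypothesis of the preceding lemma.\<close>
  obtain x where x: "x\<^sup>2 = y * x + z"
  proof -
    define s where "s = csqrt (y\<^sup>2 / 4 + z)"
    have "(y / 2 + s)\<^sup>2 = y * (y / 2 + s) + z"
    proof -
      have s: "s\<^sup>2 = y\<^sup>2 / 4 + z" by (simp add: s_def)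
      show ?thesis unfolding power2_sum s by (simp add: power2_eq_square algebra_simps)
    qed
    then show thesis using that by blast
  qed
  show "algebraic_int (y + z)" "algebraic_int (y * z)"
    using algebraic_int_root_monic_quadratic(2,3)[OF assms x] .
qed

section \<open>Legendre's equation\<close>

lemma nonsquare_between_squares:
  fixes N :: int
  assumes "N > 0" "\<And>k. k\<^sup>2 \<noteq> N"
  obtains f where "f \<ge> 0" "f\<^sup>2 < N" "N < (f + 1)\<^sup>2"
proof -
  define f where "f = \<lfloor>sqrt (of_int N)\<rfloor>"
  have f0: "f \<ge> 0" using assms by (simp add: f_def)
  define r where "r = sqrt (of_int N)"
  have r: "r\<^sup>2 = of_int N" "r \<ge> 0" using assms(1) by (simp_all add: r_def)
  have fr: "of_int f \<le> r" "r < of_int f + 1" unfolding f_def r_def by linarith+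
  have "(of_int f)\<^sup>2 \<le> r\<^sup>2" "r\<^sup>2 < (of_int f + 1)\<^sup>2"
    using f0 fr r(2) by (auto intro: power_mono power_strict_mono)
  then have "of_int (f\<^sup>2) \<le> (of_int N :: real)" "(of_int N :: real) < of_int ((f + 1)\<^sup>2)"
    unfolding r(1) by simp_all
  then have "f\<^sup>2 \<le> N" "N < (f + 1)\<^sup>2" by (simp_all only: of_int_le_iff of_int_less_iff)
  with assms(2)[of f] f0 that show thesis by force
qed

lemma nonsquare_mult_square:
  fixes N y k :: int
  assumes "\<And>k. k\<^sup>2 \<noteq> N" "k\<^sup>2 = N * y\<^sup>2"
  shows "y = 0"
proof (rule ccontr)
  assume y: "y \<noteq> 0"
  have "y\<^sup>2 dvd k\<^sup>2" using assms(2) by simp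
  then have "y dvd k" by simp
  then obtain m where "k = y * m" by blast
  then have "y\<^sup>2 * m\<^sup>2 = y\<^sup>2 * N" using assms(2) by (simp add: power_mult_distrib mult.commute)
  then show False using assms(1)[of m] y by simp
qed

text \<open>Pigeonhole: the box bounded by the integer square roots of bc, ac and ab contains more
  than abc points, so two of them share all three residues and their difference is a short vector.
  Nonsquareness makes the bounds strict.\<close>

lemma legendre_congruence_vector:
  fixes a b c s t w :: int
  assumes pos: "a > 0" "b > 0" "c > 0"
    and ns: "\<And>k. k\<^sup>2 \<noteq> b * c" "\<And>k. k\<^sup>2 \<noteq> a * c" "\<And>k. k\<^sup>2 \<noteq> a * b"
  obtains x y z where "(x, y, z) \<noteq> (0, 0, 0)" "x\<^sup>2 < b * c" "y\<^sup>2 < a * c" "z\<^sup>2 < a * b"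
    "a dvd y - s * z" "b dvd x - t * z" "c dvd x - w * y"
proof -
  obtain f where f: "f \<ge> 0" "f\<^sup>2 < b * c" "b * c < (f + 1)\<^sup>2"
    using nonsquare_between_squares[of "b * c"] ns(1) pos by auto
  obtain g where g: "g \<ge> 0" "g\<^sup>2 < a * c" "a * c < (g + 1)\<^sup>2"
    using nonsquare_between_squares[of "a * c"] ns(2) pos by auto
  obtain h where h: "h \<ge> 0" "h\<^sup>2 < a * b" "a * b < (h + 1)\<^sup>2"
    using nonsquare_between_squares[of "a * b"] ns(3) pos by auto
  have big: "a * b * c < (f + 1) * (g + 1) * (h + 1)"
  proof (rule power_less_imp_less_base[of _ 2])
    have "(a * b * c)\<^sup>2 = (b * c) * (a * c) * (a * b)" by (simp add: power2_eq_square)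
    also have "\<dots> < (f + 1)\<^sup>2 * (g + 1)\<^sup>2 * (h + 1)\<^sup>2"
      using f g h pos by (intro mult_strict_mono) auto
    finally show "(a * b * c)\<^sup>2 < ((f + 1) * (g + 1) * (h + 1))\<^sup>2"
      by (simp add: power_mult_distrib)
    show "0 \<le> (f + 1) * (g + 1) * (h + 1)" using f g h by simp
  qed
  define S where "S = {0..f} \<times> {0..g} \<times> {0..h}"
  define T where "T = {0..<a} \<times> {0..<b} \<times> {0..<c}"
  define \<phi> where "\<phi> = (\<lambda>(x, y, z). ((y - s * z) mod a, (x - t * z) mod b, (x - w * y) mod c))"
  have "int (card T) = a * b * c" using pos by (simp add: T_def)
  moreover have "int (card S) = (f + 1) * (g + 1) * (h + 1)" using f g h by (simp add: S_def)
  ultimately have "card T < card S" using big by linarith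
  moreover have "\<phi> ` S \<subseteq> T" using pos by (auto simp: \<phi>_def S_def T_def)
  moreover have "finite T" by (simp add: T_def)
  ultimately have "\<not> inj_on \<phi> S" using card_inj_on_le[of \<phi> S T] by auto
  then obtain P Q where PQ: "P \<noteq> Q" "\<phi> P = \<phi> Q" "P \<in> S" "Q \<in> S"
    unfolding inj_on_def by blast
  obtain x y z where P: "P = (x, y, z)" by (rule prod_cases3)
  obtain x' y' z' where Q: "Q = (x', y', z')" by (rule prod_cases3)
  note ne = PQ(1)[unfolded P Q] and eq = PQ(2)[unfolded P Q] and S = PQ(3,4)[unfolded P Q]
  show thesis
  proof
    show "(x - x', y - y', z - z') \<noteq> (0, 0, 0)" using ne by auto
    have sq: "u\<^sup>2 \<le> v\<^sup>2" if "\<bar>u\<bar> \<le> v" for u v :: int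
      using that by (metis abs_ge_zero power2_abs power_mono)
    have "\<bar>x - x'\<bar> \<le> f" using S by (simp add: S_def abs_le_iff)
    then show "(x - x')\<^sup>2 < b * c" using sq f(2) by (meson le_less_trans)
    have "\<bar>y - y'\<bar> \<le> g" using S by (simp add: S_def abs_le_iff)
    then show "(y - y')\<^sup>2 < a * c" using sq g(2) by (meson le_less_trans)
    have "\<bar>z - z'\<bar> \<le> h" using S by (simp add: S_def abs_le_iff)
    then show "(z - z')\<^sup>2 < a * b" using sq h(2) by (meson le_less_trans)
    have eqs: "a dvd (y - s * z) - (y' - s * z')" "b dvd (x - t * z) - (x' - t * z')"
        "c dvd (x - w * y) - (x' - w * y')"
      using eq by (simp_all add: \<phi>_def mod_eq_dvd_iff)
    have "(y - y') - s * (z - z') = (y - s * z) - (y' - s * z')" by (simp add: algebra_simps)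
    with eqs(1) show "a dvd (y - y') - s * (z - z')" by (simp only:)
    have "(x - x') - t * (z - z') = (x - t * z) - (x' - t * z')" by (simp add: algebra_simps)
    with eqs(2) show "b dvd (x - x') - t * (z - z')" by (simp only:)
    have "(x - x') - w * (y - y') = (x - w * y) - (x' - w * y')" by (simp add: algebra_simps)
    with eqs(3) show "c dvd (x - x') - w * (y - y')" by (simp only:)
  qed
qed

text \<open>The residue conditions make the form b y^2 + c z^2 - a x^2 divisible by abc on the
  vectors of \<open>legendre_congruence_vector\<close>, and the size bounds leave only the values 0
  and abc.\<close>

lemma legendre_solvable:
  fixes a b c s t w :: int
  assumes pos: "a > 0" "b > 0" "c > 0"
    and ns: "\<And>k. k\<^sup>2 \<noteq> b * c" "\<And>k. k\<^sup>2 \<noteq> a * c" "\<And>k. k\<^sup>2 \<noteq> a * b"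
    and cop: "coprime a b" "coprime a c" "coprime b c"
    and res: "a dvd b * s\<^sup>2 + c" "b dvd a * t\<^sup>2 - c" "c dvd a * w\<^sup>2 - b"
  obtains x y z where "(x, y, z) \<noteq> (0, 0, 0)" "a * x\<^sup>2 = b * y\<^sup>2 + c * z\<^sup>2"
proof -
  obtain x y z where nz: "(x, y, z) \<noteq> (0, 0, 0)" and small: "x\<^sup>2 < b * c" "y\<^sup>2 < a * c" "z\<^sup>2 < a * b"
    and dv: "a dvd y - s * z" "b dvd x - t * z" "c dvd x - w * y"
    using legendre_congruence_vector[OF pos ns] by metis
  define g where "g = b * y\<^sup>2 + c * z\<^sup>2 - a * x\<^sup>2"
  have g1: "g = b * ((y - s * z) * (y + s * z)) + (b * s\<^sup>2 + c) * z\<^sup>2 - a * x\<^sup>2"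
    by (simp add: g_def power2_eq_square algebra_simps)
  have 1: "a dvd g" unfolding g1
    by (intro dvd_diff[OF dvd_add dvd_triv_left] dvd_mult2[OF res(1)] dvd_mult[OF dvd_mult2[OF dv(1)]])
  have g2: "g = b * y\<^sup>2 - a * ((x - t * z) * (x + t * z)) - (a * t\<^sup>2 - c) * z\<^sup>2"
    by (simp add: g_def power2_eq_square algebra_simps)
  have 2: "b dvd g" unfolding g2
    by (intro dvd_diff[OF dvd_diff[OF dvd_triv_left]] dvd_mult2[OF res(2)] dvd_mult[OF dvd_mult2[OF dv(2)]])
  have g3: "g = c * z\<^sup>2 - a * ((x - w * y) * (x + w * y)) - (a * w\<^sup>2 - b) * y\<^sup>2"
    by (simp add: g_def power2_eq_square algebra_simps)
  have 3: "c dvd g" unfolding g3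
    by (intro dvd_diff[OF dvd_diff[OF dvd_triv_left]] dvd_mult2[OF res(3)] dvd_mult[OF dvd_mult2[OF dv(3)]])
  have "a * b * c dvd g" using 1 2 3 cop by (simp add: divides_mult)
  then obtain k where k: "g = a * b * c * k" by blast
  have "b * y\<^sup>2 < b * (a * c)" "c * z\<^sup>2 < c * (a * b)" "a * x\<^sup>2 < a * (b * c)"
    using small pos by (simp_all add: mult_strict_left_mono)
  moreover have "b * y\<^sup>2 \<ge> 0" "c * z\<^sup>2 \<ge> 0" "a * x\<^sup>2 \<ge> 0" using pos by simp_all
  ultimately have "- (a * b * c) < g" "g < 2 * (a * b * c)" unfolding g_def by (simp_all add: algebra_simps)
  then have "(a * b * c) * (- 1) < (a * b * c) * k" "(a * b * c) * k < (a * b * c) * 2" unfolding k by simp_all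
  moreover have "a * b * c > 0" using pos by simp
  ultimately have "- 1 < k" "k < 2" using mult_less_cancel_left_pos by blast+
  then consider "k = 0" | "k = 1" by linarith
  then show thesis
  proof cases
    case 1
    then show thesis using that[OF nz] k by (simp add: g_def)
  next
    case 2
    then have *: "b * y\<^sup>2 + c * z\<^sup>2 = a * (x\<^sup>2 + b * c)" using k by (simp add: g_def algebra_simps)
    \<comment> \<open>Composition of forms: multiplying by \<open>x\<^sup>2 + b * c\<close> keeps
      the shape b Y^2 + c Z^2, and the value abc of the form means that b y^2 + c z^2 is
      \<open>a\<close> times this same factor.\<close>
    have "b * (y * x - c * z)\<^sup>2 + c * (z * x + b * y)\<^sup>2 = (b * y\<^sup>2 + c * z\<^sup>2) * (x\<^sup>2 + b * c)"
      by (simp add: power2_eq_square algebra_simps)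
    also have "\<dots> = a * (x\<^sup>2 + b * c)\<^sup>2" unfolding * by (simp add: power2_eq_square)
    finally have "a * (x\<^sup>2 + b * c)\<^sup>2 = b * (y * x - c * z)\<^sup>2 + c * (z * x + b * y)\<^sup>2" by simp
    moreover have "x\<^sup>2 + b * c > 0" using pos by (simp add: add_nonneg_pos)
    ultimately show thesis
      using that[of "x\<^sup>2 + b * c" "y * x - c * z" "z * x + b * y"] by (simp add: algebra_simps)
  qed
qed

text \<open>The extra conclusions prepare the ideal generated by x sqrt a + y sqrt b and z sqrt c:
  coprimality supplies a Bezout relation, and the parity alternative decides whether the generators
  have to be halved.\<close>

lemma legendre_primitive:
  fixes a b c s t w :: int
  assumes pos: "a > 0" "b > 0" "c > 0"
    and ns: "\<And>k. k\<^sup>2 \<noteq> b * c" "\<And>k. k\<^sup>2 \<noteq> a * c" "\<And>k. k\<^sup>2 \<noteq> a * b"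
    and cop: "coprime a b" "coprime a c" "coprime b c"
    and sqf: "squarefree a" "squarefree b" "squarefree c"
    and res: "a dvd b * s\<^sup>2 + c" "b dvd a * t\<^sup>2 - c" "c dvd a * w\<^sup>2 - b"
    and mod4: "odd a \<Longrightarrow> a mod 4 = 1" "odd b \<Longrightarrow> b mod 4 = 1"
  obtains x y z where "z \<noteq> 0" "a * x\<^sup>2 = b * y\<^sup>2 + c * z\<^sup>2" "coprime (a * x) (b * y)"
    "odd (c * z) \<or> (even z \<and> odd (a * x) \<and> odd (b * y))"
proof -
  obtain x' y' z' where nz: "(x', y', z') \<noteq> (0, 0, 0)" and eq': "a * x'\<^sup>2 = b * y'\<^sup>2 + c * z'\<^sup>2"
    using legendre_solvable[OF pos ns cop res] by metis
  define g where "g = gcd x' (gcd y' z')"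
  have g: "g \<noteq> 0" using nz by (auto simp: g_def)
  have "g dvd x'" "g dvd y'" "g dvd z'" by (simp_all add: g_def gcd_dvdI1 gcd_dvdI2)
  then obtain x y z where xyz: "x' = g * x" "y' = g * y" "z' = g * z" by (elim dvdE)
  have abs_g: "\<bar>g\<bar> = g" by (simp add: g_def)
  have gd: "g * gcd u v = gcd (g * u) (g * v)" for u v
    using gcd_mult_distrib_int[of g u v] by (simp only: abs_g)
  have "g * gcd x (gcd y z) = g * 1"
    unfolding gd xyz[symmetric] by (simp add: g_def)
  then have prim: "gcd x (gcd y z) = 1" using g by (simp only: mult_cancel_left) simp
  have "g\<^sup>2 * (a * x\<^sup>2) = g\<^sup>2 * (b * y\<^sup>2 + c * z\<^sup>2)"
    using eq' unfolding xyz by (simp add: power_mult_distrib algebra_simps)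
  then have eq: "a * x\<^sup>2 = b * y\<^sup>2 + c * z\<^sup>2" using g by simp
  have z: "z \<noteq> 0"
  proof
    assume "z = 0"
    then have *: "a * x\<^sup>2 = b * y\<^sup>2" using eq by simp
    have "(a * x)\<^sup>2 = a * (a * x\<^sup>2)" by (simp add: power2_eq_square)
    also have "\<dots> = (a * b) * y\<^sup>2" by (simp add: *)
    finally have "y = 0" using nonsquare_mult_square[OF ns(3)] by blast
    then show False using * \<open>z = 0\<close> pos prim by simp
  qed
  have noprime: False if l: "prime l" "l dvd x" "l dvd y" "l dvd z" for l
  proof -
    have "l dvd gcd x (gcd y z)" using l by simp
    then show False using prim l(1) by (simp add: prime_int_iff)
  qed
  have sq_dvd: "l dvd v" if "prime l" "squarefree u" "l\<^sup>2 dvd u * v\<^sup>2" for l u v :: int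
  proof (rule ccontr)
    assume "\<not> l dvd v"
    then have "coprime (l\<^sup>2) (v\<^sup>2)" using that(1) by (simp add: prime_imp_coprime)
    then have "l\<^sup>2 dvd u" using that(3) by (simp add: coprime_dvd_mult_left_iff)
    then have "is_unit l" using that(2) by (auto simp: squarefree_def)
    then show False using that(1) by auto
  qed
  have sqd: "l\<^sup>2 dvd u * v\<^sup>2" if "l dvd v" for l u v :: int using that by simp
  have cop': "coprime (a * x) (b * y)"
  proof (rule ccontr)
    assume "\<not> coprime (a * x) (b * y)"
    then obtain e where e: "e dvd a * x" "e dvd b * y" "\<not> is_unit e" by (rule not_coprimeE)
    then obtain l where l: "prime l" "l dvd e" using prime_factor_int[of e] by auto
    then have l: "prime l" "l dvd a * x" "l dvd b * y" using e dvd_trans by blast+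
    have c3: "c * z\<^sup>2 = a * x\<^sup>2 - b * y\<^sup>2" using eq by simp
    have lx: "l dvd a * x\<^sup>2" "l dvd b * y\<^sup>2" using l by (auto simp: power2_eq_square mult.assoc[symmetric])
    then have lz: "l dvd c * z\<^sup>2" unfolding c3 by (rule dvd_diff)
    have pm: "l dvd u \<or> l dvd v" if "l dvd u * v" for u v using prime_dvd_mult_iff[OF l(1)] that by blast
    have nc: False if "coprime u v" "l dvd u" "l dvd v" for u v
      using that l(1) by (meson coprime_common_divisor not_prime_unit)
    consider "l dvd x" "l dvd y" | "l dvd a" "l dvd b" | "l dvd a" "l dvd y" | "l dvd x" "l dvd b"
      using pm[OF l(2)] pm[OF l(3)] by blast
    then show False
    proof cases
      case 1
      have "l\<^sup>2 dvd c * z\<^sup>2" unfolding c3 by (intro dvd_diff sqd 1)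
      then show False using sq_dvd[OF l(1) sqf(3)] noprime[OF l(1)] 1 by blast
    next
      case 2 then show False using nc cop(1) by blast
    next
      case 3
      then have "l dvd z" using pm[OF lz] nc[OF cop(2)] prime_dvd_power[OF l(1)] by blast
      then have "l\<^sup>2 dvd a * x\<^sup>2" unfolding eq using 3 by (intro dvd_add sqd)
      then show False using sq_dvd[OF l(1) sqf(1)] noprime[OF l(1)] 3 \<open>l dvd z\<close> by blast
    next
      case 4
      then have "l dvd z" using pm[OF lz] nc[OF cop(3)] prime_dvd_power[OF l(1)] by blast
      have "b * y\<^sup>2 = a * x\<^sup>2 - c * z\<^sup>2" using eq by simp
      then have "l\<^sup>2 dvd b * y\<^sup>2" using 4 \<open>l dvd z\<close> by (metis dvd_diff sqd)
      then show False using sq_dvd[OF l(1) sqf(2)] noprime[OF l(1)] 4 \<open>l dvd z\<close> by blast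
    qed
  qed
  \<comment> \<open>If \<open>c * z\<close> is even, coprimality makes \<open>a * x\<close> and
    \<open>b * y\<close> odd. Both terms \<open>a * x\<^sup>2\<close> and
    \<open>b * y\<^sup>2\<close> are then 1 modulo 4, so 4 divides \<open>c * z\<^sup>2\<close>, and
    a squarefree \<open>c\<close> forces \<open>z\<close> to be even.\<close>
  have "odd (c * z) \<or> (even z \<and> odd (a * x) \<and> odd (b * y))"
  proof (cases "odd (c * z)")
    case False
    then have "even (a * x) \<longleftrightarrow> even (b * y)" using arg_cong[OF eq, of even] by auto
    moreover have "\<not> (even (a * x) \<and> even (b * y))" using cop' coprime_common_divisor[of _ _ 2] by fastforce
    ultimately have o: "odd a" "odd b" "odd x" "odd y" by auto
    have odd_sq: "v\<^sup>2 mod 4 = 1" if "odd v" for v :: int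
    proof -
      from that obtain j where "v = 2 * j + 1" by (rule oddE)
      then have "v\<^sup>2 = 1 + 4 * (j\<^sup>2 + j)" by (simp add: power2_eq_square algebra_simps)
      then show ?thesis by presburger
    qed
    have "(a * x\<^sup>2) mod 4 = 1" "(b * y\<^sup>2) mod 4 = 1"
      using mod4 o odd_sq by (simp_all add: mod_mult_eq[symmetric, of _ "_\<^sup>2"])
    then have "4 dvd c * z\<^sup>2" using eq by presburger
    then have "2\<^sup>2 dvd c * z\<^sup>2" by simp
    then have "even z" using sq_dvd[of 2 c z] sqf(3) by simp
    then show ?thesis using o by simp
  qed simp
  then show thesis using that z eq cop' by blast
qed

section \<open>Integer linear relations\<close>

lemma integer_homogeneous_system:
  fixes A :: "'e \<Rightarrow> 'v \<Rightarrow> int"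
  assumes "finite E" "finite V" "card E < card V"
  shows "\<exists>n. (\<exists>v\<in>V. n v \<noteq> 0) \<and> (\<forall>e\<in>E. (\<Sum>v\<in>V. A e v * n v) = 0)"
  using assms
proof (induction E arbitrary: V A rule: finite_induct)
  case empty
  then have "V \<noteq> {}" by auto
  then show ?case by (intro exI[of _ "\<lambda>_. 1"]) auto
next
  case (insert e E)
  show ?case
  proof (cases "\<forall>v\<in>V. A e v = 0")
    case True
    have "card E < card V" using insert by simp
    then obtain n where n: "\<exists>v\<in>V. n v \<noteq> 0" "\<forall>e\<in>E. (\<Sum>v\<in>V. A e v * n v) = 0"
      using insert.IH[OF insert.prems(1), of A] by blast
    then have "\<forall>e'\<in>insert e E. (\<Sum>v\<in>V. A e' v * n v) = 0" using True by simp
    with n(1) show ?thesis by blast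
  next
    case False
    then obtain v\<^sub>0 where v0: "v\<^sub>0 \<in> V" "A e v\<^sub>0 \<noteq> 0" by blast
    define a where "a = A e v\<^sub>0"
    define V' where "V' = V - {v\<^sub>0}"
    have V': "finite V'" "V = insert v\<^sub>0 V'" "v\<^sub>0 \<notin> V'" using insert.prems v0 by (auto simp: V'_def)
    have "card E < card V'" using insert V' by simp
    then obtain m where m: "\<exists>v\<in>V'. m v \<noteq> 0"
      "\<forall>e'\<in>E. (\<Sum>v\<in>V'. (a * A e' v - A e' v\<^sub>0 * A e v) * m v) = 0"
      using insert.IH[OF V'(1), of "\<lambda>e' v. a * A e' v - A e' v\<^sub>0 * A e v"] by blast
    \<comment> \<open>The entry at \<open>v\<^sub>0\<close> is dictated by the equation
      \<open>e\<close>; scaling the others by the pivot \<open>a\<close> keeps everything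
      integral.\<close>
    define n where "n = (\<lambda>v. if v = v\<^sub>0 then - (\<Sum>v\<in>V'. A e v * m v) else a * m v)"
    have sum_n: "(\<Sum>v\<in>V. A e' v * n v) = (\<Sum>v\<in>V'. (a * A e' v - A e' v\<^sub>0 * A e v) * m v)" for e'
    proof -
      have "(\<Sum>v\<in>V. A e' v * n v) = A e' v\<^sub>0 * n v\<^sub>0 + (\<Sum>v\<in>V'. A e' v * n v)"
        using V' by simp
      also have "(\<Sum>v\<in>V'. A e' v * n v) = (\<Sum>v\<in>V'. a * A e' v * m v)"
        using V'(3) by (intro sum.cong) (auto simp: n_def)
      also have "A e' v\<^sub>0 * n v\<^sub>0 = - (\<Sum>v\<in>V'. A e' v\<^sub>0 * A e v * m v)"
        by (simp add: n_def sum_distrib_left mult.assoc)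
      finally show ?thesis by (simp add: left_diff_distrib sum_subtractf)
    qed
    have "(\<Sum>v\<in>V. A e v * n v) = 0" unfolding sum_n by (simp add: a_def)
    then have "\<forall>e'\<in>insert e E. (\<Sum>v\<in>V. A e' v * n v) = 0" using m(2) sum_n by simp
    moreover have "\<exists>v\<in>V. n v \<noteq> 0"
    proof -
      obtain v where "v \<in> V'" "m v \<noteq> 0" using m(1) by blast
      then have "v \<in> V" "n v \<noteq> 0" using V' v0(2) by (auto simp: n_def a_def)
      then show ?thesis by blast
    qed
    ultimately show ?thesis by blast
  qed
qed

text \<open>A nonzero solution is halved as long as all its entries are even. The odd entry makes a
  multiplicative relation between units nontrivial modulo squares.\<close>

lemma integer_homogeneous_system_odd:
  fixes A :: "'e \<Rightarrow> 'v \<Rightarrow> int"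
  assumes "finite E" "finite V" "card E < card V"
  obtains n where "\<exists>v\<in>V. odd (n v)" "\<And>e. e \<in> E \<Longrightarrow> (\<Sum>v\<in>V. A e v * n v) = 0"
proof -
  define sol where "sol n \<longleftrightarrow> (\<forall>e\<in>E. (\<Sum>v\<in>V. A e v * n v) = 0)" for n
  have "\<exists>m. (\<exists>v\<in>V. odd (m v)) \<and> sol m" if "\<exists>v\<in>V. n v \<noteq> 0" "sol n" for n
    using that
  proof (induction "\<Sum>v\<in>V. nat \<bar>n v\<bar>" arbitrary: n rule: less_induct)
    case less
    show ?case
    proof (cases "\<exists>v\<in>V. odd (n v)")
      case False
      define m where "m v = n v div 2" for v
      have m: "n v = 2 * m v" if "v \<in> V" for v using False that by (simp add: m_def)
      obtain v where v: "v \<in> V" "n v \<noteq> 0" using less.prems by blast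
      have "(\<Sum>v\<in>V. nat \<bar>m v\<bar>) < (\<Sum>v\<in>V. nat \<bar>n v\<bar>)"
        using assms(2) v m by (intro sum_strict_mono_ex1) force+
      moreover have "(\<Sum>v\<in>V. A e v * n v) = 2 * (\<Sum>v\<in>V. A e v * m v)" for e
        unfolding sum_distrib_left by (intro sum.cong) (auto simp: m)
      then have "sol m" using less.prems(2) by (auto simp: sol_def)
      moreover have "\<exists>v\<in>V. m v \<noteq> 0" using v m by force
      ultimately show ?thesis using less.hyps by blast
    qed (use less.prems in blast)
  qed
  then show thesis
    using integer_homogeneous_system[OF assms, of A] that unfolding sol_def by blast
qed

section \<open>The elementary abelian group of order eight\<close>

lemma bit_exhaust: "x = 0 \<or> x = (1 :: bit)"
  by (cases "x = 0") simp_all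

lemma UNIV_bit: "(UNIV :: bit set) = {0, 1}"
  using bit_exhaust by blast

instance bit :: finite
  by standard (simp add: UNIV_bit)

lemma bit_add_self [simp]: "x + x = (0 :: bit)"
  by (cases "x = 0") auto

type_synonym bit3 = "bit \<times> bit \<times> bit"

lemma bit3_add_self [simp]: "g + g = (0 :: bit3)"
  by (cases g) (simp add: zero_prod_def del: add_bit_eq_xor)

lemma bit3_add_self_left [simp]: "g + (g + h) = (h :: bit3)"
  by (simp only: add.assoc[symmetric] bit3_add_self add_0)

lemma bit3_minus [simp]: "- g = (g :: bit3)"
  by (rule minus_unique) simp

lemma bij_bit3_add: "bij ((+) (h :: bit3))"
  by (rule involuntory_imp_bij) simp

text \<open>This pairing identifies the nonzero \<open>a\<close> with the subgroups of index two.\<close>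

definition orth :: "bit3 \<Rightarrow> bit3 \<Rightarrow> bool"
  where "orth = (\<lambda>(a, b, c) (x, y, z). a * x + b * y + c * z = 0)"

lemma orth_0 [simp]: "orth a 0" "orth 0 g"
  by (auto simp: orth_def zero_prod_def split: prod.splits)

lemma bit_add_eq_0_iff: "x + y = 0 \<longleftrightarrow> x = (y :: bit)"
  by (metis add.right_neutral add_left_cancel bit_add_self)

lemma orth_add: "orth a (g + h) \<longleftrightarrow> (orth a g \<longleftrightarrow> orth a h)"
proof -
  obtain x y z x' y' z' a1 a2 a3 where gha: "g = (x, y, z)" "h = (x', y', z')" "a = (a1, a2, a3)"
    by (metis prod_cases3)
  have *: "a1 * (x + x') + a2 * (y + y') + a3 * (z + z')
    = (a1 * x + a2 * y + a3 * z) + (a1 * x' + a2 * y' + a3 * z')"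
    by (simp only: distrib_left ac_simps)
  have **: "p + q = 0 \<longleftrightarrow> (p = 0 \<longleftrightarrow> q = 0)" for p q :: bit
    using bit_add_eq_0_iff[of p q] using bit_exhaust[of p] bit_exhaust[of q] by auto
  show ?thesis unfolding gha orth_def add_Pair prod.case * by (rule **)
qed

lemma sum_UNIV_bit3:
  fixes f :: "bit3 \<Rightarrow> 'a::comm_monoid_add"
  shows "(\<Sum>a\<in>UNIV. f a) = (\<Sum>x\<in>{0, 1}. \<Sum>y\<in>{0, 1}. \<Sum>z\<in>{0, 1}. f (x, y, z))"
proof -
  have U: "(UNIV :: bit3 set) = {0, 1} \<times> {0, 1} \<times> {0, 1}"
    by (simp only: UNIV_Times_UNIV flip: UNIV_bit)
  show ?thesis unfolding U sum.cartesian_product' ..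
qed

text \<open>For nonzero \<open>g\<close>, half of the eight \<open>a\<close> are orthogonal to
  \<open>g\<close>, among them \<open>0\<close>: so \<open>g\<close> lies in three of the seven
  subgroups of index two.\<close>

lemma count_orth: "card {a. a \<noteq> 0 \<and> orth a g} = (if g = 0 then 7 else 3)"
proof -
  obtain x y z where g: "g = (x, y, z)" by (rule prod_cases3)
  have "card {a. orth a g} = (\<Sum>a\<in>UNIV. of_bool (orth a g))"
    by (simp add: of_bool_def sum.If_cases)
  also have "\<dots> = (if g = 0 then 8 else 4)"
    unfolding sum_UNIV_bit3 g zero_prod_def orth_def 
    using bit_exhaust[of x] bit_exhaust[of y] bit_exhaust[of z] by (elim disjE) simp_all
  finally have "card {a. orth a g} = (if g = 0 then 8 else 4)" .
  moreover have "{a. orth a g} = insert 0 {a. a \<noteq> 0 \<and> orth a g}" by auto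
  ultimately show ?thesis by (simp split: if_splits)
qed

lemma ex_not_orth:
  assumes "a \<noteq> 0"
  obtains g where "\<not> orth a g"
proof -
  obtain x y z where a: "a = (x, y, z)" by (rule prod_cases3)
  consider "x = 1" | "y = 1" | "z = 1"
    using assms unfolding a zero_prod_def using bit_exhaust by blast
  then show thesis
  proof cases
    case 1 then show ?thesis using that[of "(1, 0, 0)"] by (simp add: orth_def a)
  next
    case 2 then show ?thesis using that[of "(0, 1, 0)"] by (simp add: orth_def a)
  next
    case 3 then show ?thesis using that[of "(0, 0, 1)"] by (simp add: orth_def a)
  qed
qed

section \<open>Conjugates, integers and units\<close>

text \<open>The conjugations act inside a real field, so that signs of conjugates make sense. What
  Galois theory has to provide is condensed in \<open>fixed_rational\<close>.\<close>

locale elementary_abelian_field =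
  fixes F :: "real set" and cj :: "bit3 \<Rightarrow> real \<Rightarrow> real"
  assumes zero_mem [simp]: "0 \<in> F" and one_mem [simp]: "1 \<in> F"
    and add_mem: "x \<in> F \<Longrightarrow> y \<in> F \<Longrightarrow> x + y \<in> F"
    and uminus_mem: "x \<in> F \<Longrightarrow> - x \<in> F"
    and mult_mem: "x \<in> F \<Longrightarrow> y \<in> F \<Longrightarrow> x * y \<in> F"
    and inverse_mem: "x \<in> F \<Longrightarrow> inverse x \<in> F"
    and cj_mem: "x \<in> F \<Longrightarrow> cj g x \<in> F"
    and cj_add: "x \<in> F \<Longrightarrow> y \<in> F \<Longrightarrow> cj g (x + y) = cj g x + cj g y"
    and cj_mult: "x \<in> F \<Longrightarrow> y \<in> F \<Longrightarrow> cj g (x * y) = cj g x * cj g y"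
    and cj_cj: "x \<in> F \<Longrightarrow> cj g (cj h x) = cj (g + h) x"
    and cj_id: "x \<in> F \<Longrightarrow> cj 0 x = x"
    and fixed_rational: "x \<in> F \<Longrightarrow> (\<And>g. cj g x = x) \<Longrightarrow> x \<in> \<rat>"
begin

lemma cj_0 [simp]: "cj g 0 = 0"
  using cj_add[of 0 0 g] by simp

lemma cj_inj:
  assumes "x \<in> F" "y \<in> F" "cj g x = cj g y"
  shows "x = y"
proof -
  have "cj g (cj g x) = cj g (cj g y)" using assms(3) by simp
  then show ?thesis using assms(1,2) by (simp add: cj_cj cj_id)
qed

lemma cj_eq_0_iff [simp]: "x \<in> F \<Longrightarrow> cj g x = 0 \<longleftrightarrow> x = 0"
  using cj_inj[of x 0 g] by auto

lemma cj_1 [simp]: "cj g 1 = 1"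
  using cj_mult[of 1 1 g] by simp

lemma cj_uminus: "x \<in> F \<Longrightarrow> cj g (- x) = - cj g x"
  using cj_add[of x "- x" g] by (simp add: uminus_mem)

lemma diff_mem: "x \<in> F \<Longrightarrow> y \<in> F \<Longrightarrow> x - y \<in> F"
  using add_mem[of x "- y"] uminus_mem by simp

lemma cj_diff: "x \<in> F \<Longrightarrow> y \<in> F \<Longrightarrow> cj g (x - y) = cj g x - cj g y"
  using cj_add[of x "- y" g] by (simp add: uminus_mem cj_uminus)

lemma cj_inverse:
  assumes "x \<in> F"
  shows "cj g (inverse x) = inverse (cj g x)"
proof (cases "x = 0")
  case False
  then have "cj g x * cj g (inverse x) = 1"
    using assms cj_mult[of x "inverse x" g] by (simp add: inverse_mem)
  then show ?thesis by (simp add: inverse_unique)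
qed simp

lemma divide_mem: "x \<in> F \<Longrightarrow> y \<in> F \<Longrightarrow> x / y \<in> F"
  by (simp add: divide_inverse mult_mem inverse_mem)

lemma cj_divide: "x \<in> F \<Longrightarrow> y \<in> F \<Longrightarrow> cj g (x / y) = cj g x / cj g y"
  by (simp add: divide_inverse cj_mult inverse_mem cj_inverse)

lemma power_mem: "x \<in> F \<Longrightarrow> x ^ n \<in> F"
  by (induction n) (auto intro: mult_mem)

lemma cj_power: "x \<in> F \<Longrightarrow> cj g (x ^ n) = cj g x ^ n"
  by (induction n) (auto simp: cj_mult power_mem)

lemma power_int_mem: "x \<in> F \<Longrightarrow> x powi n \<in> F"
  by (simp add: power_int_def power_mem inverse_mem)

lemma cj_power_int: "x \<in> F \<Longrightarrow> cj g (x powi n) = cj g x powi n"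
  by (simp add: power_int_def cj_power inverse_mem cj_inverse)

lemma prod_mem: "(\<And>i. i \<in> A \<Longrightarrow> f i \<in> F) \<Longrightarrow> (\<Prod>i\<in>A. f i) \<in> F"
  by (induction A rule: infinite_finite_induct) (auto intro: mult_mem)

lemma cj_prod: "(\<And>i. i \<in> A \<Longrightarrow> f i \<in> F) \<Longrightarrow> cj g (\<Prod>i\<in>A. f i) = (\<Prod>i\<in>A. cj g (f i))"
  by (induction A rule: infinite_finite_induct) (auto simp: cj_mult prod_mem)

lemma of_nat_mem [simp]: "of_nat n \<in> F"
  by (induction n) (auto intro: add_mem)

lemma of_int_mem [simp]: "of_int n \<in> F"
  by (cases n rule: int_cases2) (auto intro: uminus_mem)

lemma cj_of_nat [simp]: "cj g (of_nat n) = of_nat n"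
  by (induction n) (auto simp: cj_add)

lemma cj_of_int [simp]: "cj g (of_int n) = of_int n"
  by (cases n rule: int_cases2) (auto simp: cj_uminus)

lemma cj_rat: "x \<in> \<rat> \<Longrightarrow> cj g x = x"
  by (elim Rats_cases') (simp add: cj_divide)

lemma algebraic_int_cj:
  assumes "x \<in> F" "algebraic_int x"
  shows "algebraic_int (cj g x)"
proof -
  obtain k and c :: "nat \<Rightarrow> int" where k: "k > 0" "x ^ k = (\<Sum>l<k. of_int (c l) * x ^ l)"
    using algebraic_int_monic_relation[OF assms(2)] by metis
  have cj_sum: "cj g (\<Sum>l<n. of_int (c l) * x ^ l) = (\<Sum>l<n. of_int (c l) * cj g x ^ l)
      \<and> (\<Sum>l<n. of_int (c l) * x ^ l) \<in> F" for n
    by (induction n) (auto simp: cj_add cj_mult cj_power mult_mem power_mem add_mem assms(1))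
  define p where "p = monom 1 k - (\<Sum>l<k. monom (of_int (c l) :: real) l)"
  have co: "coeff p i = (if i = k then 1 else 0) - (if i < k then of_int (c i) else 0)" for i
    by (simp add: p_def coeff_sum)
  have deg: "degree p = k"
    by (rule antisym[OF degree_le le_degree]) (auto simp: co)
  have "poly p (cj g x) = cj g x ^ k - (\<Sum>l<k. of_int (c l) * cj g x ^ l)"
    by (simp add: p_def poly_sum poly_monom)
  also have "\<dots> = 0"
    using arg_cong[OF k(2), of "cj g"] cj_sum[of k] by (simp add: cj_power assms(1))
  finally have root: "poly p (cj g x) = 0" .
  have "lead_coeff p = 1" "\<forall>i. coeff p i \<in> \<int>" by (auto simp: co deg)
  then show ?thesis using root by (auto intro: algebraic_int.intros)
qed

definition ints :: "real set"
  where "ints = {x \<in> F. algebraic_int x}"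

definition unit_grp :: "real set"
  where "unit_grp = {x \<in> F. x \<noteq> 0 \<and> algebraic_int x \<and> algebraic_int (inverse x)}"

end

lemma algebraic_int_add_mult_real:
  fixes x y :: real
  assumes "algebraic_int x" "algebraic_int y"
  shows "algebraic_int (x + y)" "algebraic_int (x * y)"
  using algebraic_int_add_mult[of "of_real x" "of_real y"] assms
  by (simp_all flip: of_real_add of_real_mult)

context elementary_abelian_field
begin

lemma ints_rat_int: "x \<in> ints \<Longrightarrow> x \<in> \<rat> \<Longrightarrow> x \<in> \<int>"
  using rational_algebraic_int_is_int by (auto simp: ints_def)

lemma ints_add: "x \<in> ints \<Longrightarrow> y \<in> ints \<Longrightarrow> x + y \<in> ints"
  and ints_mult: "x \<in> ints \<Longrightarrow> y \<in> ints \<Longrightarrow> x * y \<in> ints"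
  by (auto simp: ints_def add_mem mult_mem algebraic_int_add_mult_real)

lemma ints_uminus: "x \<in> ints \<Longrightarrow> - x \<in> ints"
  by (auto simp: ints_def uminus_mem)

lemma ints_diff: "x \<in> ints \<Longrightarrow> y \<in> ints \<Longrightarrow> x - y \<in> ints"
  using ints_add[of x "- y"] ints_uminus by simp

lemma ints_cj: "x \<in> ints \<Longrightarrow> cj g x \<in> ints"
  by (auto simp: ints_def cj_mem algebraic_int_cj)

lemma ints_of_int [simp]: "of_int n \<in> ints"
  by (auto simp: ints_def intro: int_imp_algebraic_int)

lemma ints_1 [simp]: "1 \<in> ints"
  using ints_of_int[of 1] by simp

lemma ints_0 [simp]: "0 \<in> ints"
  using ints_of_int[of 0] by simp

lemma ints_sum: "(\<And>i. i \<in> A \<Longrightarrow> f i \<in> ints) \<Longrightarrow> (\<Sum>i\<in>A. f i) \<in> ints"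
  by (induction A rule: infinite_finite_induct) (auto intro: ints_add)

lemma unit_grpD: "x \<in> unit_grp \<Longrightarrow> x \<in> F" "x \<in> unit_grp \<Longrightarrow> x \<noteq> 0" "x \<in> unit_grp \<Longrightarrow> x \<in> ints"
    "x \<in> unit_grp \<Longrightarrow> inverse x \<in> ints"
  by (auto simp: unit_grp_def ints_def inverse_mem)

lemma unit_grp_mult: "x \<in> unit_grp \<Longrightarrow> y \<in> unit_grp \<Longrightarrow> x * y \<in> unit_grp"
  by (auto simp: unit_grp_def mult_mem algebraic_int_add_mult_real inverse_mult_distrib)

lemma unit_grp_inverse: "x \<in> unit_grp \<Longrightarrow> inverse x \<in> unit_grp"
  by (auto simp: unit_grp_def inverse_mem)

lemma unit_grp_1 [simp]: "1 \<in> unit_grp"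
  by (auto simp: unit_grp_def)

lemma unit_grp_uminus: "x \<in> unit_grp \<Longrightarrow> - x \<in> unit_grp"
  by (auto simp: unit_grp_def uminus_mem)

lemma unit_grp_abs: "x \<in> unit_grp \<Longrightarrow> \<bar>x\<bar> \<in> unit_grp"
  by (cases "x \<ge> 0") (auto simp: unit_grp_uminus)

lemma unit_grp_power: "x \<in> unit_grp \<Longrightarrow> x ^ n \<in> unit_grp"
  by (induction n) (auto intro: unit_grp_mult)

lemma unit_grp_power_int: "x \<in> unit_grp \<Longrightarrow> x powi n \<in> unit_grp"
  by (simp add: power_int_def unit_grp_power unit_grp_inverse)

lemma unit_grp_prod: "(\<And>i. i \<in> A \<Longrightarrow> f i \<in> unit_grp) \<Longrightarrow> (\<Prod>i\<in>A. f i) \<in> unit_grp"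
  by (induction A rule: infinite_finite_induct) (auto intro: unit_grp_mult)

lemma unit_grp_cj: "x \<in> unit_grp \<Longrightarrow> cj g x \<in> unit_grp"
  by (auto simp: unit_grp_def cj_mem algebraic_int_cj inverse_mem simp flip: cj_inverse)

lemma fixed_unit_abs:
  assumes "x \<in> unit_grp" "\<And>g. cj g x = x"
  shows "\<bar>x\<bar> = 1"
proof -
  have x: "x \<in> \<rat>" "inverse x \<in> \<rat>" using fixed_rational[OF unit_grpD(1)] assms by auto
  then have "x \<in> \<int>" "inverse x \<in> \<int>" using ints_rat_int unit_grpD assms(1) by blast+
  then obtain a b :: int where ab: "x = of_int a" "inverse x = of_int b" by (elim Ints_cases)
  have "of_int (a * b) = (1 :: real)" using unit_grpD(2)[OF assms(1)] by (simp flip: ab)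
  then have "a * b = 1" by (simp only: of_int_eq_1_iff)
  then have "\<bar>a\<bar> = 1" using zmult_eq_1_iff by force
  then show ?thesis using ab by simp
qed

definition nrm :: "real \<Rightarrow> real"
  where "nrm x = (\<Prod>g\<in>UNIV. cj g x)"

lemma prod_cj_shift: "(\<Prod>g\<in>UNIV. f (h + g)) = (\<Prod>g\<in>UNIV. f (g :: bit3))"
  by (rule prod.reindex_bij_betw[OF bij_bit3_add])

lemma cj_nrm: "x \<in> F \<Longrightarrow> cj h (nrm x) = nrm x"
  unfolding nrm_def by (subst cj_prod) (auto simp: cj_mem cj_cj prod_cj_shift[of "\<lambda>g. cj g x"])

lemma nrm_mem: "x \<in> F \<Longrightarrow> nrm x \<in> F"
  unfolding nrm_def by (intro prod_mem cj_mem)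

lemma nrm_rat: "x \<in> F \<Longrightarrow> nrm x \<in> \<rat>"
  by (rule fixed_rational) (auto simp: nrm_mem cj_nrm)

lemma nrm_unit: "x \<in> unit_grp \<Longrightarrow> \<bar>nrm x\<bar> = 1"
  by (rule fixed_unit_abs) (auto simp: cj_nrm unit_grpD, auto simp: nrm_def intro: unit_grp_prod unit_grp_cj)

end

declare split_paired_All [simp del] split_paired_Ex [simp del]

lemma abs_power_int_power:
  fixes x :: real
  shows "\<bar>x powi k\<bar> ^ m = (\<bar>x\<bar> ^ m) powi k"
  by (simp add: power_int_def power_abs power_inverse flip: power_mult) (simp add: mult.commute)

lemma prod_power_int:
  fixes f :: "'i \<Rightarrow> real"
  shows "(\<Prod>i\<in>A. f i) powi k = (\<Prod>i\<in>A. f i powi k)"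
  by (induction A rule: infinite_finite_induct) (simp_all add: power_int_mult_distrib)

section \<open>Norms to quadratic subfields and the rank of the unit group\<close>

context elementary_abelian_field
begin

text \<open>For nonzero \<open>a\<close> this is the norm to the fixed field of the index-two
  subgroup that belongs to \<open>a\<close>.\<close>

definition relnorm :: "bit3 \<Rightarrow> real \<Rightarrow> real"
  where "relnorm a x = (\<Prod>g | orth a g. cj g x)"

lemma relnorm_unit: "x \<in> unit_grp \<Longrightarrow> relnorm a x \<in> unit_grp"
  unfolding relnorm_def by (intro unit_grp_prod unit_grp_cj)

lemma cj_relnorm:
  assumes "x \<in> F" "orth a h"
  shows "cj h (relnorm a x) = relnorm a x"
proof -
  have "cj h (relnorm a x) = (\<Prod>g | orth a g. cj (h + g) x)"
    unfolding relnorm_def by (subst cj_prod) (simp_all add: cj_mem cj_cj assms(1))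
  also have "\<dots> = relnorm a x"
    unfolding relnorm_def
    by (rule prod.reindex_bij_witness[of _ "\<lambda>g. h + g" "\<lambda>g. h + g"]) (use assms(2) in \<open>auto simp: orth_add\<close>)
  finally show ?thesis .
qed

text \<open>By \<open>count_orth\<close> the trivial conjugate occurs in all seven relative norms
  and every other conjugate in three, and 7 = 4 + 3. For a unit, \<open>nrm x ^ 3\<close> is only a
  sign.\<close>

lemma prod_relnorm:
  assumes "x \<in> F"
  shows "(\<Prod>a | a \<noteq> 0. relnorm a x) = x ^ 4 * nrm x ^ 3"
proof -
  have "(\<Prod>a | a \<noteq> 0. relnorm a x) = (\<Prod>a | a \<noteq> 0. \<Prod>g\<in>UNIV. if orth a g then cj g x else 1)"
    unfolding relnorm_def
    by (rule prod.cong[OF refl]) (use prod.inter_filter[of UNIV "\<lambda>g. cj g x"] in simp)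
  also have "\<dots> = (\<Prod>g\<in>UNIV. \<Prod>a | a \<noteq> 0. if orth a g then cj g x else 1)"
    by (rule prod.swap)
  also have "\<dots> = (\<Prod>g\<in>UNIV. cj g x ^ card {a. a \<noteq> 0 \<and> orth a g})"
    by (rule prod.cong[OF refl]) (simp add: prod.inter_filter[symmetric])
  also have "\<dots> = (\<Prod>g\<in>UNIV. (if g = 0 then cj g x ^ 4 else 1) * cj g x ^ 3)"
    unfolding count_orth by (intro prod.cong refl) (simp add: power_add[symmetric])
  also have "\<dots> = x ^ 4 * nrm x ^ 3"
    by (simp add: prod.distrib prod_power_distrib nrm_def cj_id assms)
  finally show ?thesis .
qed

text \<open>These are trace and norm from the fixed field of the subgroup: every conjugation acts on
  \<open>w\<close> either trivially or like \<open>t\<close>, so both expressions are fixed, hence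
  rational.\<close>

lemma fixed_trace_norm:
  assumes w: "w \<in> unit_grp" "\<And>h. orth a h \<Longrightarrow> cj h w = w" and t: "\<not> orth a t"
  shows "w + cj t w \<in> \<int>" "\<bar>w * cj t w\<bar> = 1"
proof -
  have wF: "w \<in> F" using w unit_grpD by blast
  have sw: "cj g w = w" "cj g (cj t w) = cj t w" if "orth a g" for g
    using that w(2) cj_cj[OF wF, of g t] cj_cj[OF wF, of t g] by (auto simp: add.commute)
  have sw': "cj g w = cj t w" "cj g (cj t w) = w" if "\<not> orth a g" for g
  proof -
    have o: "orth a (g + t)" using that t by (simp add: orth_add)
    then show "cj g (cj t w) = w" using w(2) cj_cj[OF wF] by simp
    have "cj t (cj (g + t) w) = cj t w" using w(2) o by simp
    then show "cj g w = cj t w" by (simp add: cj_cj[OF wF] add.commute[of g])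
  qed
  have fix_add: "cj g (w + cj t w) = w + cj t w" for g
    using sw[of g] sw'[of g] by (cases "orth a g") (simp_all add: cj_add cj_mem wF)
  then have "w + cj t w \<in> \<rat>" by (intro fixed_rational add_mem cj_mem wF) 
  then show "w + cj t w \<in> \<int>" using w(1) by (intro ints_rat_int ints_add ints_cj unit_grpD)
  have "cj g (w * cj t w) = w * cj t w" for g
    using sw[of g] sw'[of g] by (cases "orth a g") (simp_all add: cj_mult cj_mem wF)
  then show "\<bar>w * cj t w\<bar> = 1" using w(1) by (intro fixed_unit_abs unit_grp_mult unit_grp_cj)
qed

text \<open>The conjugate of \<open>w\<close> has absolute value below 1 because the product of the
  two is 1 or -1. This bounds the trace by \<open>M + 1\<close>, and \<open>w\<close> is a root of
  one of finitely many polynomials X^2 - T X + N.\<close>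

lemma finite_fixed_units_le:
  assumes "a \<noteq> 0"
  shows "finite {w \<in> unit_grp. (\<forall>h. orth a h \<longrightarrow> cj h w = w) \<and> 1 < w \<and> w \<le> M}" (is "finite ?S")
proof -
  obtain t where t: "\<not> orth a t" using ex_not_orth[OF assms] by blast
  define R where "R = (\<lambda>(T :: int, N :: int). {w :: real. poly [:of_int N, - of_int T, 1:] w = 0})"
  have "?S \<subseteq> (\<Union>p\<in>{- \<lceil>M + 1\<rceil>..\<lceil>M + 1\<rceil>} \<times> {-1, 1}. R p)"
  proof
    fix w assume w: "w \<in> ?S"
    define w' where "w' = cj t w"
    have *: "w + w' \<in> \<int>" "\<bar>w * w'\<bar> = 1"
      using fixed_trace_norm[of w a t] w t unfolding w'_def by auto
    obtain T where T: "w + w' = of_int T" using *(1) by (elim Ints_cases)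
    have "w * w' = 1 \<or> w * w' = - 1" using *(2) by linarith
    then obtain N :: int where N: "w * w' = of_int N" "N \<in> {-1, 1}"
      by (metis insertI1 insertI2 of_int_1 of_int_minus)
    have "\<bar>w\<bar> * \<bar>w'\<bar> = 1" using *(2) by (simp add: abs_mult)
    moreover have "\<bar>w\<bar> * 1 \<le> \<bar>w\<bar> * \<bar>w'\<bar>" if "1 \<le> \<bar>w'\<bar>"
      using that by (rule mult_left_mono) simp
    ultimately have "\<bar>w'\<bar> < 1" using w by force
    then have "\<bar>of_int T :: real\<bar> \<le> M + 1" using w unfolding T[symmetric] by auto
    then have "T \<in> {- \<lceil>M + 1\<rceil>..\<lceil>M + 1\<rceil>}" by (simp add: abs_le_iff) linarith
    moreover have "w \<in> R (T, N)" by (simp add: R_def T[symmetric] N(1)[symmetric] algebra_simps)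
    ultimately show "w \<in> (\<Union>p\<in>{- \<lceil>M + 1\<rceil>..\<lceil>M + 1\<rceil>} \<times> {-1, 1}. R p)" using N(2) by blast
  qed
  moreover have "finite (R p)" for p
    unfolding R_def by (cases p) (simp only: prod.case, rule poly_roots_finite, simp)
  ultimately show ?thesis by (meson finite_UN_I finite_SigmaI finite_atLeastAtMost_int finite.intros finite_subset)
qed

text \<open>The least unit above 1 generates up to sign; it exists by
  \<open>finite_fixed_units_le\<close>. One generator for each of seven quadratic fields is the
  source of the rank bound.\<close>

lemma fundamental_unit:
  assumes "a \<noteq> 0"
  obtains e where "e > 0"
    "\<And>w. w \<in> unit_grp \<Longrightarrow> (\<And>h. orth a h \<Longrightarrow> cj h w = w) \<Longrightarrow> \<exists>j :: int. \<bar>w\<bar> = e powi j"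
proof -
  define S where "S = {w \<in> unit_grp. (\<forall>h. orth a h \<longrightarrow> cj h w = w) \<and> 1 < w}"
  have abs_S: "cj h \<bar>w\<bar> = \<bar>w\<bar>" if "w \<in> unit_grp" "\<And>h. orth a h \<Longrightarrow> cj h w = w" "orth a h" for w h
    using that by (cases "w \<ge> 0") (auto simp: cj_uminus unit_grpD)
  show thesis
  proof (cases "S = {}")
    case True
    have *: "\<exists>j :: int. \<bar>w\<bar> = 1 powi j" if w: "w \<in> unit_grp" "\<And>h. orth a h \<Longrightarrow> cj h w = w" for w
    proof -
      have "\<bar>w\<bar> \<notin> S" "inverse \<bar>w\<bar> \<notin> S" using True by auto
      then have "\<not> 1 < \<bar>w\<bar>" "\<not> 1 < inverse \<bar>w\<bar>"
        using abs_S[OF w] unit_grp_abs[OF w(1)]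
        by (auto simp: S_def unit_grp_inverse cj_inverse unit_grpD)
      moreover have "\<bar>w\<bar> > 0" using unit_grpD(2)[OF w(1)] by simp
      ultimately have "\<bar>w\<bar> = 1" by (simp add: one_less_inverse_iff)
      then show ?thesis by simp
    qed
    \<comment> \<open>Without a unit above 1 every unit of the quadratic field is 1 or -1, and
      \<open>e = 1\<close> serves.\<close>
    have "(1 :: real) > 0" by simp
    then show thesis by (rule that) (rule *)
  next
    case False
    then obtain w\<^sub>0 where w0: "w\<^sub>0 \<in> S" by blast
    define T where "T = {w \<in> S. w \<le> w\<^sub>0}"
    have "T = {w \<in> unit_grp. (\<forall>h. orth a h \<longrightarrow> cj h w = w) \<and> 1 < w \<and> w \<le> w\<^sub>0}"
      by (auto simp: T_def S_def)
    then have T: "finite T" "T \<noteq> {}" using finite_fixed_units_le[OF assms, of w\<^sub>0] w0 by (auto simp: T_def)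
    define e where "e = Min T"
    have eT: "e \<in> T" using T by (simp add: e_def)
    have e_le: "e \<le> w" if "w \<in> S" for w
    proof (cases "w \<le> w\<^sub>0")
      case True then show ?thesis using T that by (simp add: e_def T_def)
    next
      case False then show ?thesis using eT by (simp add: T_def)
    qed
    have e: "e \<in> unit_grp" "\<And>h. orth a h \<Longrightarrow> cj h e = e" "1 < e" using eT by (auto simp: T_def S_def)
    have *: "\<exists>j :: int. \<bar>w\<bar> = e powi j" if w: "w \<in> unit_grp" "\<And>h. orth a h \<Longrightarrow> cj h w = w" for w
    proof -
      \<comment> \<open>This exponent puts \<open>r\<close> into the interval from 1 to
        \<open>e\<close>, with \<open>e\<close> excluded; minimality of \<open>e\<close> leaves only
        \<open>r = 1\<close>.\<close>
      define j where "j = \<lfloor>log e \<bar>w\<bar>\<rfloor>"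
      define r where "r = \<bar>w\<bar> * e powi (- j)"
      have w_pos: "\<bar>w\<bar> > 0" using unit_grpD(2)[OF w(1)] by simp
      have pj: "e powi i = e powr of_int i" for i using e(3) by (simp add: powr_real_of_int')
      have "of_int j \<le> log e \<bar>w\<bar>" "log e \<bar>w\<bar> < of_int j + 1" unfolding j_def by linarith+
      then have "e powr of_int j \<le> \<bar>w\<bar>" "\<bar>w\<bar> < e powr (of_int j + 1)"
        using e(3) w_pos by (simp_all add: le_log_iff log_less_iff)
      then have "e powr of_int j * e powr (- of_int j) \<le> r" "r < e powr (of_int j + 1) * e powr (- of_int j)"
        using e(3) unfolding r_def pj by (simp_all add: mult_right_mono)
      then have r: "1 \<le> r" "r < e" using e(3) by (simp_all flip: powr_add)
      have "r \<in> unit_grp" unfolding r_def using unit_grp_abs[OF w(1)] e by (intro unit_grp_mult unit_grp_power_int) auto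
      moreover have "cj h r = r" if "orth a h" for h
        unfolding r_def using abs_S[OF w that] unit_grp_abs[OF w(1)] e that
        by (simp add: cj_mult cj_power_int power_int_mem unit_grpD)
      ultimately have "r \<notin> S" using e_le r by force
      then have "r = 1" using r \<open>r \<in> unit_grp\<close> \<open>\<And>h. orth a h \<Longrightarrow> cj h r = r\<close> by (auto simp: S_def)
      then have "\<bar>w\<bar> = e powi j" using e(3) by (simp add: r_def power_int_minus field_simps)
      then show ?thesis by blast
    qed
    have "e > 0" using e(3) by simp
    then show thesis by (rule that) (rule *)
  qed
qed

text \<open>Each fourth power of a unit is, up to sign, a product of seven units from real quadratic fields.\<close>

lemma unit_relation:
  assumes I: "finite I" "card I = 8" and v: "\<And>i. i \<in> I \<Longrightarrow> v i \<in> unit_grp"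
  obtains n :: "'i \<Rightarrow> int" where "\<exists>i\<in>I. odd (n i)" "\<bar>\<Prod>i\<in>I. v i powi n i\<bar> = 1"
proof -
  let ?A = "{a :: bit3. a \<noteq> 0}"
  have "\<forall>a\<in>?A. \<exists>e > 0. \<forall>w\<in>unit_grp. (\<forall>h. orth a h \<longrightarrow> cj h w = w) \<longrightarrow> (\<exists>j :: int. \<bar>w\<bar> = e powi j)"
  proof
    fix a assume "a \<in> ?A"
    then obtain e where "e > 0"
      "\<And>w. w \<in> unit_grp \<Longrightarrow> (\<And>h. orth a h \<Longrightarrow> cj h w = w) \<Longrightarrow> \<exists>j :: int. \<bar>w\<bar> = e powi j"
      using fundamental_unit[of a] by blast
    then show "\<exists>e > 0. \<forall>w\<in>unit_grp. (\<forall>h. orth a h \<longrightarrow> cj h w = w) \<longrightarrow> (\<exists>j :: int. \<bar>w\<bar> = e powi j)"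
      by (intro exI[of _ e]) simp
  qed
  from bchoice[OF this] obtain e where e: "\<forall>a\<in>?A. e a > 0 \<and>
      (\<forall>w\<in>unit_grp. (\<forall>h. orth a h \<longrightarrow> cj h w = w) \<longrightarrow> (\<exists>j :: int. \<bar>w\<bar> = e a powi j))"
    by blast
  have "\<forall>p\<in>?A \<times> I. \<exists>j :: int. \<bar>relnorm (fst p) (v (snd p))\<bar> = e (fst p) powi j"
  proof
    fix p assume "p \<in> ?A \<times> I"
    then have "fst p \<in> ?A" "snd p \<in> I" by auto
    then show "\<exists>j :: int. \<bar>relnorm (fst p) (v (snd p))\<bar> = e (fst p) powi j"
      using e v by (simp add: relnorm_unit cj_relnorm unit_grpD)
  qed
  from bchoice[OF this] obtain J' where
    "\<forall>p\<in>?A \<times> I. \<bar>relnorm (fst p) (v (snd p))\<bar> = e (fst p) powi (J' p :: int)" by blast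
  then have J: "\<bar>relnorm a (v i)\<bar> = e a powi J' (a, i)" if "a \<in> ?A" "i \<in> I" for a i
    using that by force
  define J where "J a i = J' (a, i)" for a i
  note J = J[folded J_def]
  have "card ?A = 7" using count_orth[of 0] by simp
  \<comment> \<open>There are seven equations, one for each nonzero \<open>a\<close>, and eight
    unknown exponents.\<close>
  then obtain n where n: "\<exists>i\<in>I. odd (n i)" "\<And>a. a \<in> ?A \<Longrightarrow> (\<Sum>i\<in>I. J a i * n i) = 0"
    using integer_homogeneous_system_odd[of ?A I J] I by auto
  have v4: "\<bar>v i\<bar> ^ 4 = (\<Prod>a\<in>?A. e a powi J a i)" if "i \<in> I" for i
  proof -
    have "\<bar>\<Prod>a\<in>?A. relnorm a (v i)\<bar> = \<bar>v i\<bar> ^ 4"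
      using prod_relnorm[of "v i"] nrm_unit[OF v[OF that]] v[OF that]
      by (simp add: unit_grpD abs_mult power_abs[symmetric] del: abs_prod power_abs)
        (simp add: power_abs)
    then show ?thesis using that J by (simp add: abs_prod)
  qed
  have "\<bar>\<Prod>i\<in>I. v i powi n i\<bar> ^ 4 = (\<Prod>i\<in>I. (\<bar>v i\<bar> ^ 4) powi n i)"
    by (simp only: abs_prod prod_power_distrib abs_power_int_power)
  also have "\<dots> = (\<Prod>i\<in>I. \<Prod>a\<in>?A. e a powi (J a i * n i))"
    by (rule prod.cong[OF refl]) (simp only: v4 prod_power_int power_int_mult)
  also have "\<dots> = (\<Prod>a\<in>?A. \<Prod>i\<in>I. e a powi (J a i * n i))"
    by (rule prod.swap)
  also have "\<dots> = (\<Prod>a\<in>?A. e a powi (\<Sum>i\<in>I. J a i * n i))"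
  proof (intro prod.cong refl)
    fix a assume "a \<in> ?A"
    then have "e a \<noteq> 0" using e by force
    then show "(\<Prod>i\<in>I. e a powi (J a i * n i)) = e a powi (\<Sum>i\<in>I. J a i * n i)"
      by (induction I rule: infinite_finite_induct) (simp_all add: power_int_add)
  qed
  also have "\<dots> = 1" using n(2) by simp
  finally have "\<bar>\<Prod>i\<in>I. v i powi n i\<bar> = 1"
    using power_eq_1_iff[of "\<bar>\<Prod>i\<in>I. v i powi n i\<bar>" 4] by simp
  with n(1) that show thesis by blast
qed

end

section \<open>Signatures of units\<close>

lemma power_int_less_0_iff:
  fixes y :: real
  assumes "y \<noteq> 0"
  shows "y powi k < 0 \<longleftrightarrow> y < 0 \<and> odd k"
proof (cases "y < 0")
  case True
  have "y powi k = (- 1) powi k * (- y) powi k" by (simp flip: power_int_mult_distrib)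
  moreover have "(- y) powi k > 0" using True by simp
  ultimately show ?thesis using True by (cases "even k") (auto simp: power_int_minus_one_minus power_int_minus_left)
next
  case False
  then have "y powi k > 0" using assms by simp
  then show ?thesis using False by simp
qed

lemma prod_less_0_iff:
  fixes f :: "'i \<Rightarrow> real"
  assumes "finite A" "\<And>i. i \<in> A \<Longrightarrow> f i \<noteq> 0"
  shows "(\<Prod>i\<in>A. f i) < 0 \<longleftrightarrow> odd (\<Sum>i\<in>A. of_bool (f i < 0) :: int)"
  using assms
proof (induction A rule: finite_induct)
  case (insert i A)
  have nz: "f i \<noteq> 0" "(\<Prod>i\<in>A. f i) \<noteq> 0"
    using insert.hyps(1) insert.prems by (simp_all add: prod_zero_iff)
  have IH: "(\<Prod>i\<in>A. f i) < 0 \<longleftrightarrow> odd (\<Sum>i\<in>A. of_bool (f i < 0) :: int)"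
    by (rule insert.IH) (simp add: insert.prems)
  have step: "a * p < 0 \<longleftrightarrow> odd (of_bool (a < 0) + s)"
    if "a \<noteq> 0" "p \<noteq> 0" "p < 0 \<longleftrightarrow> odd s" for a p :: real and s :: int
    using that by (cases "a < 0") (auto simp: mult_less_0_iff)
  show ?case
    unfolding prod.insert[OF insert.hyps] sum.insert[OF insert.hyps] by (rule step[OF nz IH])
qed simp

lemma even_sum_cong:
  fixes f g :: "'i \<Rightarrow> int"
  assumes "\<And>i. i \<in> A \<Longrightarrow> even (f i) \<longleftrightarrow> even (g i)"
  shows "even (\<Sum>i\<in>A. f i) \<longleftrightarrow> even (\<Sum>i\<in>A. g i)"
  using assms by (induction A rule: infinite_finite_induct) auto

lemma orth_commute: "orth a g \<longleftrightarrow> orth g a"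
  by (auto simp only: orth_def mult.commute split: prod.splits)

lemma sum_bit3_shift: "(\<Sum>h\<in>UNIV. f (h + k)) = (\<Sum>h\<in>UNIV. f (h :: bit3))"
  using sum.reindex_bij_betw[OF bij_bit3_add, of f k] by (simp add: add.commute)

text \<open>Translation by \<open>d\<close> pairs arguments with equal values; an \<open>a\<close>
  not orthogonal to \<open>d\<close> separates the two members of every pair.\<close>

lemma even_sum_translation_invariant:
  fixes f :: "bit3 \<Rightarrow> int"
  assumes "d \<noteq> 0" "\<And>h. f (h + d) = f h"
  shows "even (\<Sum>h\<in>UNIV. f h)"
proof -
  obtain a where a: "\<not> orth a d" using ex_not_orth[OF assms(1)] orth_commute by blast
  have "(\<Sum>h\<in>{h. orth a h}. f h) = (\<Sum>h\<in>{h. \<not> orth a h}. f h)"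
    by (rule sum.reindex_bij_witness[of _ "\<lambda>h. h + d" "\<lambda>h. h + d"])
      (use a assms(2) in \<open>auto simp: orth_add add.assoc\<close>)
  moreover have "(\<Sum>h\<in>UNIV. f h) = (\<Sum>h\<in>{h. orth a h}. f h) + (\<Sum>h\<in>{h. \<not> orth a h}. f h)"
    by (subst sum.union_disjoint[symmetric]) (auto intro!: sum.cong)
  ultimately show ?thesis by simp
qed

context elementary_abelian_field
begin

text \<open>In the group ring of the Galois group over the field with two elements, an element of
  augmentation one is its own inverse; this is applied to the signature of a unit of norm
  \<open>-1\<close>.\<close>

lemma exponents_same_parity:
  fixes n :: "bit3 \<Rightarrow> int"
  assumes u: "u \<in> F" "nrm u < 0"
    and x: "x = (\<Prod>g\<in>UNIV. cj g u powi n g)" "\<And>g. cj g x * x > 0"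
  shows "odd (n k) \<longleftrightarrow> x < 0"
proof -
  have u0: "u \<noteq> 0" using u(2) by (auto simp: nrm_def)
  have nz: "cj g u \<noteq> 0" for g using u0 u(1) by simp
  define b :: "bit3 \<Rightarrow> int" where "b g = of_bool (cj g u < 0)" for g
  have odd_b: "odd (\<Sum>g\<in>UNIV. b g)"
    using u(2) prod_less_0_iff[of UNIV "\<lambda>g. cj g u"] nz by (simp add: nrm_def b_def)
  have odd_b': "odd (\<Sum>g\<in>UNIV. b (g + k))" using odd_b sum_bit3_shift[of b k] by simp
  \<comment> \<open>The left side is the sign bit of \<open>cj h x\<close>, computed as a
    convolution of \<open>n\<close> and \<open>b\<close>; as \<open>x\<close> is definite it does
    not depend on \<open>h\<close>.\<close>
  have T: "odd (\<Sum>g\<in>UNIV. n g * b (h + g)) \<longleftrightarrow> x < 0" for h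
  proof -
    have "cj h x = (\<Prod>g\<in>UNIV. cj (h + g) u powi n g)"
      unfolding x(1) by (subst cj_prod) (simp_all add: power_int_mem cj_mem cj_power_int cj_cj u)
    then have "cj h x < 0 \<longleftrightarrow> odd (\<Sum>g\<in>UNIV. of_bool (cj (h + g) u powi n g < 0) :: int)"
      using prod_less_0_iff[of UNIV "\<lambda>g. cj (h + g) u powi n g"] nz by simp
    also have "\<dots> \<longleftrightarrow> odd (\<Sum>g\<in>UNIV. n g * b (h + g))"
      by (intro arg_cong[of _ _ Not] even_sum_cong) (auto simp: power_int_less_0_iff nz b_def)
    finally show ?thesis using x(2)[of h] by (auto simp: zero_less_mult_iff)
  qed
  \<comment> \<open>Modulo 2 this is the coefficient at \<open>k\<close> of b b n in the group ring.
    The constant parities \<open>T\<close> and the odd sum of \<open>b\<close> evaluate it to the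
    sign bit of \<open>x\<close>; exchanging the sums evaluates it to \<open>n k\<close>.\<close>
  define S where "S = (\<Sum>h\<in>UNIV. b (h + k) * (\<Sum>g\<in>UNIV. n g * b (h + g)))"
  have "even S \<longleftrightarrow> even (\<Sum>h\<in>UNIV. if x < 0 then b (h + k) else 0)"
    unfolding S_def by (rule even_sum_cong) (use T in auto)
  then have 1: "odd S \<longleftrightarrow> x < 0" using odd_b' by (cases "x < 0") auto
  have "S = (\<Sum>h\<in>UNIV. \<Sum>g\<in>UNIV. n g * (b (h + k) * b (h + g)))"
    unfolding S_def sum_distrib_left by (simp add: ac_simps)
  also have "\<dots> = (\<Sum>g\<in>UNIV. \<Sum>h\<in>UNIV. n g * (b (h + k) * b (h + g)))"
    by (rule sum.swap)
  also have "\<dots> = (\<Sum>g\<in>UNIV. n g * (\<Sum>h\<in>UNIV. b (h + k) * b (h + g)))"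
    by (simp add: sum_distrib_left)
  finally have S: "S = (\<Sum>g\<in>UNIV. n g * (\<Sum>h\<in>UNIV. b (h + k) * b (h + g)))" .
  \<comment> \<open>Translation by \<open>k + g\<close> exchanges the two factors, so the product is
    invariant and, modulo 2, only \<open>g = k\<close> contributes to \<open>S\<close>.\<close>
  have C: "even (\<Sum>h\<in>UNIV. b (h + k) * b (h + g))" if "g \<noteq> k" for g
  proof (rule even_sum_translation_invariant)
    show "k + g \<noteq> 0"
      using that by (metis bit3_minus add.commute eq_neg_iff_add_eq_0)
    show "b (h + (k + g) + k) * b (h + (k + g) + g) = b (h + k) * b (h + g)" for h
    proof -
      have "h + (k + g) + k = (h + g) + (k + k)" "h + (k + g) + g = (h + k) + (g + g)"
        by (simp_all only: ac_simps)
      then have e: "h + (k + g) + k = h + g" "h + (k + g) + g = h + k"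
        by (simp_all only: bit3_add_self add_0_right)
      show ?thesis unfolding e by (rule mult.commute)
    qed
  qed
  have "(\<Sum>h\<in>UNIV. b (h + k) * b (h + k)) = (\<Sum>h\<in>UNIV. b (h + k))"
    by (rule sum.cong) (auto simp: b_def)
  then have "even S \<longleftrightarrow> even (\<Sum>g\<in>UNIV. if g = k then n g else 0)"
    unfolding S by (intro even_sum_cong) (use C odd_b' in auto)
  then have "odd S \<longleftrightarrow> odd (n k)" by simp
  with 1 show ?thesis by blast
qed

text \<open>\<open>e\<close> and the seven nontrivial conjugates of \<open>u\<close> are eight
  units, hence satisfy a relation with an odd exponent. The part formed from the conjugates is
  definite because \<open>e\<close> is, so its exponents share one parity. As \<open>u\<close>
  itself is left out, with exponent 0, they are all even, and the odd exponent belongs to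
  \<open>e\<close>.\<close>

lemma definite_unit_square:
  assumes u: "u \<in> unit_grp" "nrm u < 0"
    and e: "e \<in> unit_grp" "\<And>g. cj g e * e > 0"
  obtains y where "y \<in> F" "\<bar>e\<bar> = y\<^sup>2"
proof -
  define v where "v g = (if g = 0 then e else cj g u)" for g :: bit3
  have v: "v g \<in> unit_grp" for g using u e by (auto simp: v_def unit_grp_cj)
  have "card (UNIV :: bit3 set) = 8"
    using sum_UNIV_bit3[of "\<lambda>_. 1 :: nat"] by simp
  then obtain n where n: "\<exists>g. odd (n g)" "\<bar>\<Prod>g\<in>UNIV. v g powi n g\<bar> = 1"
    using unit_relation[of UNIV v] v by auto
  define m where "m g = (if g = 0 then 0 else n g)" for g
  define x where "x = (\<Prod>g\<in>UNIV. cj g u powi m g)"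
  have eF: "e \<in> F" "e \<noteq> 0" using e unit_grpD by auto
  have uF: "u \<in> F" using u unit_grpD by auto
  have "(\<Prod>g\<in>UNIV. v g powi n g) = (\<Prod>g\<in>UNIV. (if g = 0 then e powi n g else 1) * cj g u powi m g)"
    by (rule prod.cong) (auto simp: v_def m_def)
  also have "\<dots> = e powi n 0 * x" by (simp add: prod.distrib x_def)
  finally have ex: "\<bar>e powi n 0 * x\<bar> = 1" using n(2) by simp
  define c where "c = e powi n 0 * x"
  have c: "c = 1 \<or> c = - 1" using ex unfolding c_def by linarith
  have x: "x = c * e powi (- n 0)" using eF by (simp add: c_def power_int_minus)
  have cj_c: "cj g c = c" for g using c by (auto simp: cj_uminus)
  have cF: "c \<in> F" using c by (auto intro: uminus_mem)
  have pos: "cj g x * x > 0" for g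
  proof -
    have "cj g x * x = (c * c) * (cj g e * e) powi (- n 0)"
      unfolding x by (simp add: cj_mult cF power_int_mem eF cj_power_int cj_c power_int_mult_distrib)
    also have "\<dots> > 0" using c e(2)[of g] by auto
    finally show ?thesis .
  qed
  have par: "odd (m g) \<longleftrightarrow> odd (m h)" for g h
    using exponents_same_parity[OF uF u(2) x_def pos] by simp
  have ev: "even (m g)" for g using par[of g 0] by (simp add: m_def)
  have "odd (n 0)"
  proof (rule ccontr)
    assume "\<not> odd (n 0)"
    then have "even (n g)" for g using ev[of g] by (cases "g = 0") (auto simp: m_def)
    then show False using n(1) by blast
  qed
  then obtain k where k: "n 0 = 2 * k + 1" by (rule oddE)
  define z where "z = (\<Prod>g\<in>UNIV. cj g u powi (m g div 2))"
  have zF: "z \<in> F" unfolding z_def by (intro prod_mem power_int_mem cj_mem uF)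
  have "cj g u powi m g = (cj g u powi (m g div 2))\<^sup>2" for g
  proof -
    have "m g = (m g div 2) * int 2" using ev[of g] by simp
    then have "cj g u powi m g = (cj g u powi (m g div 2)) powi int 2" by (metis power_int_mult)
    then show ?thesis by simp
  qed
  then have xz: "x = z\<^sup>2" by (simp add: x_def z_def prod_power_distrib)
  have e_n0: "e powi n 0 = e * (e powi k)\<^sup>2"
  proof -
    have "e powi n 0 = e powi (k * int 2) * e powi 1"
      unfolding k by (subst power_int_add[symmetric]) (simp_all add: eF mult.commute)
    then show ?thesis by (simp add: power_int_mult mult.commute)
  qed
  have "e powi n 0 * x = e * (e powi k * z)\<^sup>2"
    unfolding xz e_n0 power_mult_distrib by (simp only: mult.assoc)
  then have "\<bar>e\<bar> * (e powi k * z)\<^sup>2 = 1"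
    using ex by (simp only: abs_mult) simp
  then have "\<bar>e\<bar> = inverse ((e powi k * z)\<^sup>2)" by (metis inverse_unique mult.commute)
  then have "\<bar>e\<bar> = (inverse (e powi k * z))\<^sup>2" by (simp only: power_inverse)
  moreover have "inverse (e powi k * z) \<in> F" by (intro inverse_mem mult_mem power_int_mem eF zF)
  ultimately show thesis by (rule that[rotated])
qed

end

text \<open>The equations between \<open>\<alpha>\<close>, \<open>\<beta>\<close> and \<open>\<kappa>\<close> say that the ideal \<open>(\<alpha>, \<beta>)\<close> has square \<open>(\<kappa>)\<close>.\<close>

locale odd_class_field = elementary_abelian_field +
  fixes u :: real
  assumes u_unit: "u \<in> unit_grp" and nrm_u: "nrm u = - 1"
    and square_ideal_principal:
      "\<lbrakk>\<alpha> \<in> ints; \<beta> \<in> ints; \<kappa> \<in> ints; \<kappa> \<noteq> 0;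
        r\<^sub>1 \<in> ints; r\<^sub>2 \<in> ints; r\<^sub>3 \<in> ints; s\<^sub>1 \<in> ints; s\<^sub>2 \<in> ints; s\<^sub>3 \<in> ints;
        \<alpha> * \<alpha> = \<kappa> * r\<^sub>1; \<alpha> * \<beta> = \<kappa> * r\<^sub>2; \<beta> * \<beta> = \<kappa> * r\<^sub>3;
        r\<^sub>1 * s\<^sub>1 + r\<^sub>2 * s\<^sub>2 + r\<^sub>3 * s\<^sub>3 = 1\<rbrakk> \<Longrightarrow> \<exists>a\<in>F. \<exists>e\<in>unit_grp. \<kappa> = e * a\<^sup>2"
begin

text \<open>\<kappa> is a unit times a square, so definiteness passes from
  \<open>w * \<kappa>\<close> to a unit. The factor \<open>w\<close> allows the signs of the
  conjugates of \<kappa> to be corrected.\<close>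

lemma definite_square:
  assumes ints: "\<alpha> \<in> ints" "\<beta> \<in> ints" "\<kappa> \<in> ints" "\<kappa> \<noteq> 0"
      "r\<^sub>1 \<in> ints" "r\<^sub>2 \<in> ints" "r\<^sub>3 \<in> ints" "s\<^sub>1 \<in> ints" "s\<^sub>2 \<in> ints" "s\<^sub>3 \<in> ints"
    and eqs: "\<alpha> * \<alpha> = \<kappa> * r\<^sub>1" "\<alpha> * \<beta> = \<kappa> * r\<^sub>2" "\<beta> * \<beta> = \<kappa> * r\<^sub>3"
      "r\<^sub>1 * s\<^sub>1 + r\<^sub>2 * s\<^sub>2 + r\<^sub>3 * s\<^sub>3 = 1"
    and w: "w \<in> unit_grp" and definite: "\<And>g. cj g (w * \<kappa>) * (w * \<kappa>) > 0"
  obtains y where "y \<in> F" "\<bar>w * \<kappa>\<bar> = y\<^sup>2"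
proof -
  obtain a e where a: "a \<in> F" and e: "e \<in> unit_grp" and \<kappa>: "\<kappa> = e * a\<^sup>2"
    using square_ideal_principal[OF ints eqs] by blast
  have a0: "a \<noteq> 0" using \<kappa> ints(4) by auto
  have we: "w * e \<in> unit_grp" using w e by (rule unit_grp_mult)
  have pos: "cj g (w * e) * (w * e) > 0" for g
  proof -
    have "cj g (w * \<kappa>) * (w * \<kappa>) = (cj g (w * e) * (w * e)) * (cj g a * a)\<^sup>2"
      unfolding \<kappa> using a w e unit_grpD
      by (simp add: cj_mult cj_power mult_mem power_mem power_mult_distrib algebra_simps)
    then have "(cj g (w * e) * (w * e)) * (cj g a * a)\<^sup>2 > 0" using definite[of g] by (simp only:)
    then show ?thesis by (auto simp: zero_less_mult_iff not_less)
  qed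
  obtain y where "y \<in> F" "\<bar>w * e\<bar> = y\<^sup>2"
    using definite_unit_square[OF u_unit _ we pos] nrm_u by auto
  then have "\<bar>w * \<kappa>\<bar> = (y * a)\<^sup>2"
    unfolding \<kappa> by (simp add: abs_mult power_mult_distrib mult.assoc[symmetric])
  moreover have "y * a \<in> F" using \<open>y \<in> F\<close> a by (rule mult_mem)
  ultimately show thesis using that by blast
qed

end

section \<open>The class group\<close>

lemma even_card_involution:
  assumes "finite S" "\<And>x. x \<in> S \<Longrightarrow> f x \<in> S" "\<And>x. x \<in> S \<Longrightarrow> f (f x) = x" "\<And>x. x \<in> S \<Longrightarrow> f x \<noteq> x"
  shows "even (card S)"
  using assms
proof (induction "card S" arbitrary: S rule: less_induct)
  case less
  show ?case
  proof (cases "S = {}")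
    case False
    then obtain x where x: "x \<in> S" by blast
    define Y where "Y = S - {x, f x}"
    have fx: "f x \<in> S" "f x \<noteq> x" "f (f x) = x" using less.prems x by auto
    have cX: "card S = card Y + 2"
    proof -
      have eq: "S = insert x (insert (f x) Y)" using x fx by (auto simp: Y_def)
      have "finite Y" "x \<notin> Y" "f x \<notin> Y" using less.prems(1) by (simp_all add: Y_def)
      then show ?thesis using fx(2) by (subst eq) simp
    qed
    have "f y \<in> Y" if "y \<in> Y" for y
    proof -
      have y: "y \<in> S" "y \<noteq> x" "y \<noteq> f x" using that by (auto simp: Y_def)
      have "f y \<noteq> x" using less.prems(3)[OF y(1)] y(3) by auto
      moreover have "f y \<noteq> f x" using less.prems(3)[OF y(1)] fx(3) y(2) by auto
      ultimately show ?thesis using less.prems(2)[OF y(1)] by (simp add: Y_def)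
    qed
    then have "even (card Y)"
      using less.prems by (intro less.hyps) (auto simp: cX Y_def)
    then show ?thesis using cX by simp
  qed simp
qed

section \<open>Products of sets of complex numbers\<close>

lemma complex_ring_simps [simp]:
  "carrier \<C> = UNIV" "monoid.mult \<C> x y = x * y" "ring.add \<C> x y = x + y" "ring.zero \<C> = 0" "monoid.one \<C> = 1"
  by (simp_all add: ring_of_type_algebra_def)

lemma ring_on_simps [simp]:
  "carrier (ring_on A) = A" "monoid.mult (ring_on A) x y = x * y" "ring.add (ring_on A) x y = x + y"
  "ring.zero (ring_on A) = 0" "monoid.one (ring_on A) = 1"
  by (simp_all add: ring_on_def ring_of_type_algebra_def)

lemma ring_ring_on:
  assumes "0 \<in> A" "1 \<in> A" "\<And>x y. x \<in> A \<Longrightarrow> y \<in> A \<Longrightarrow> x + y \<in> A"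
    "\<And>x. x \<in> A \<Longrightarrow> - x \<in> A" "\<And>x y. x \<in> A \<Longrightarrow> y \<in> A \<Longrightarrow> x * y \<in> A"
  shows "ring (ring_on A)"
proof (rule ringI)
  show "abelian_group (ring_on A)"
  proof (rule abelian_groupI)
    fix x assume "x \<in> carrier (ring_on A)"
    then show "\<exists>y\<in>carrier (ring_on A). y \<oplus>\<^bsub>ring_on A\<^esub> x = \<zero>\<^bsub>ring_on A\<^esub>"
      using assms(4)[of x] by (auto intro!: bexI[of _ "- x"])
  qed (use assms in \<open>auto simp: algebra_simps\<close>)
  show "monoid (ring_on A)" by (rule monoidI) (use assms in \<open>auto simp: algebra_simps\<close>)
qed (auto simp: algebra_simps)

abbreviation setprod :: "complex set \<Rightarrow> complex set \<Rightarrow> complex set" (infixl \<open>\<star>\<close> 70)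
  where "A \<star> B \<equiv> ideal_prod \<C> A B"

lemma setprod_mult: "a \<in> A \<Longrightarrow> b \<in> B \<Longrightarrow> a * b \<in> A \<star> B"
  using ideal_prod.prod[of a A b B \<C>] by simp

lemma setprod_add: "x \<in> A \<star> B \<Longrightarrow> y \<in> A \<star> B \<Longrightarrow> x + y \<in> A \<star> B"
  using ideal_prod.sum[of x \<C> A B y] by simp

lemma setprod_induct [consumes 1, case_names mult add]:
  assumes "x \<in> A \<star> B" "\<And>a b. a \<in> A \<Longrightarrow> b \<in> B \<Longrightarrow> P (a * b)" "\<And>x y. P x \<Longrightarrow> P y \<Longrightarrow> P (x + y)"
  shows "P x"
  using assms(1) by (induction rule: ideal_prod.induct) (use assms in auto)

lemma setprod_commute: "A \<star> B = B \<star> A"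
proof -
  have "A \<star> B \<subseteq> B \<star> A" for A B
  proof
    fix x assume "x \<in> A \<star> B"
    then show "x \<in> B \<star> A"
    proof (induction rule: setprod_induct)
      case (mult a b) then show ?case using setprod_mult[of b B a A] by (simp add: mult.commute)
    next
      case (add x y) then show ?case by (rule setprod_add)
    qed
  qed
  then show ?thesis by blast
qed

lemma setprod_assoc: "A \<star> B \<star> C = A \<star> (B \<star> C)"
proof -
  have 1: "A \<star> B \<star> C \<subseteq> A \<star> (B \<star> C)" for A B C
  proof
    fix x assume "x \<in> A \<star> B \<star> C"
    then show "x \<in> A \<star> (B \<star> C)"
    proof (induction rule: setprod_induct)
      case (mult y c)
      from mult(1) show ?case
      proof (induction rule: setprod_induct)
        case (mult a b)
        then show ?case using setprod_mult[OF _ setprod_mult[OF _ \<open>c \<in> C\<close>], of a A b B] by (simp add: mult.assoc)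
      next
        case (add x y) then show ?case by (simp add: distrib_right setprod_add)
      qed
    next
      case (add x y) then show ?case by (rule setprod_add)
    qed
  qed
  have "A \<star> (B \<star> C) = C \<star> B \<star> A" by (simp only: setprod_commute)
  also have "\<dots> \<subseteq> C \<star> (B \<star> A)" by (rule 1)
  also have "\<dots> = A \<star> B \<star> C" by (simp only: setprod_commute)
  finally show ?thesis using 1 by blast
qed

section \<open>Fractional ideals and their classes\<close>

locale number_field =
  fixes L :: "complex set"
  assumes zero_L: "0 \<in> L" and one_L: "1 \<in> L"
    and add_L: "x \<in> L \<Longrightarrow> y \<in> L \<Longrightarrow> x + y \<in> L"
    and uminus_L: "x \<in> L \<Longrightarrow> - x \<in> L"
    and mult_L: "x \<in> L \<Longrightarrow> y \<in> L \<Longrightarrow> x * y \<in> L"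
    and inverse_L: "x \<in> L \<Longrightarrow> inverse x \<in> L"
begin

definition \<O> :: "complex set"
  where "\<O> = {x \<in> L. algebraic_int x}"

lemma \<O>_closed:
  "0 \<in> \<O>" "1 \<in> \<O>" "x \<in> \<O> \<Longrightarrow> y \<in> \<O> \<Longrightarrow> x + y \<in> \<O>" "x \<in> \<O> \<Longrightarrow> - x \<in> \<O>"
  "x \<in> \<O> \<Longrightarrow> y \<in> \<O> \<Longrightarrow> x * y \<in> \<O>" "x \<in> \<O> \<Longrightarrow> x \<in> L"
  by (auto simp: \<O>_def zero_L one_L add_L uminus_L mult_L algebraic_int_add_mult)

lemma ring_of_integers_eq: "ring_of_integers L = ring_on \<O>"
  by (simp add: ring_of_integers_def \<O>_def)

lemma ring_\<O>: "ring (ring_on \<O>)"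
  by (rule ring_ring_on) (auto intro: \<O>_closed)

text \<open>The condition that \<open>fractional_ideals\<close> puts on a scaled copy of
  \<open>J\<close>, restated as closure properties of \<open>J\<close> itself.\<close>

definition frac :: "complex set \<Rightarrow> bool"
  where "frac J \<longleftrightarrow> J \<subseteq> L \<and> 0 \<in> J \<and> (\<forall>x\<in>J. \<forall>y\<in>J. x + y \<in> J) \<and> (\<forall>a\<in>\<O>. \<forall>x\<in>J. a * x \<in> J) \<and>
    (\<exists>x\<in>J. x \<noteq> 0) \<and> (\<exists>c\<in>\<O>. c \<noteq> 0 \<and> (\<forall>x\<in>J. c * x \<in> \<O>))"

lemma fracD:
  assumes "frac J"
  shows "J \<subseteq> L" "0 \<in> J" "\<And>x y. x \<in> J \<Longrightarrow> y \<in> J \<Longrightarrow> x + y \<in> J"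
    "\<And>a x. a \<in> \<O> \<Longrightarrow> x \<in> J \<Longrightarrow> a * x \<in> J" "\<exists>x\<in>J. x \<noteq> 0"
    "\<exists>c\<in>\<O>. c \<noteq> 0 \<and> (\<forall>x\<in>J. c * x \<in> \<O>)"
  using assms unfolding frac_def by (elim conjE, simp)+

lemma fractional_ideals_eq: "fractional_ideals L = {J. frac J}"
proof (intro equalityI subsetI CollectI)
  fix J assume "J \<in> fractional_ideals L"
  then obtain c where J: "J \<subseteq> L" "J \<noteq> {0}" and c: "c \<in> \<O>" "c \<noteq> 0" "ideal ((*) c ` J) (ring_on \<O>)"
    unfolding fractional_ideals_def ring_of_integers_eq by auto
  note sg = ideal.axioms(1)[OF c(3)]
  have 0: "0 \<in> J"
    using additive_subgroup.zero_closed[OF sg] c(2) by auto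
  have "x + y \<in> J" if "x \<in> J" "y \<in> J" for x y
  proof -
    have "c * x + c * y \<in> (*) c ` J" using additive_subgroup.a_closed[OF sg imageI imageI, OF that] by simp
    then show ?thesis using c(2) by (auto simp flip: distrib_left)
  qed
  moreover have "a * x \<in> J" if "a \<in> \<O>" "x \<in> J" for a x
  proof -
    have "a * (c * x) \<in> (*) c ` J" using ideal.I_l_closed[OF c(3) imageI[OF that(2)], of a] that(1) by simp
    then show ?thesis using c(2) by (auto simp: mult.left_commute)
  qed
  moreover have "c * x \<in> \<O>" if "x \<in> J" for x using additive_subgroup.a_subset[OF sg] that by auto
  moreover have "\<exists>x\<in>J. x \<noteq> 0" using J 0 by blast
  ultimately show "frac J" unfolding frac_def using J(1) 0 c by blast
next
  fix J assume "J \<in> {J. frac J}"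
  then have "frac J" by simp
  note J = fracD(1-5)[OF this]
  from fracD(6)[OF \<open>frac J\<close>] obtain c where c: "c \<in> \<O>" "c \<noteq> 0" "\<And>x. x \<in> J \<Longrightarrow> c * x \<in> \<O>"
    by blast
  have "ideal ((*) c ` J) (ring_on \<O>)"
  proof (rule idealI[OF ring_\<O>])
    interpret R: ring "ring_on \<O>" by (rule ring_\<O>)
    have "- 1 \<in> \<O>" using \<O>_closed(2,4) by blast
    then have neg: "- x \<in> J" if "x \<in> J" for x using J(4)[of "- 1" x] that by simp
    show "subgroup ((*) c ` J) (add_monoid (ring_on \<O>))"
    proof (rule R.add.subgroupI)
      show "(*) c ` J \<subseteq> carrier (ring_on \<O>)" using c(3) by auto
      show "(*) c ` J \<noteq> {}" using J(2) by blast
      fix x assume "x \<in> (*) c ` J"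
      then obtain y where y: "y \<in> J" "x = c * y" by blast
      have "\<ominus>\<^bsub>ring_on \<O>\<^esub> x = - x"
        using c(3)[OF y(1)] y by (intro R.minus_equality) (auto intro: \<O>_closed)
      then show "\<ominus>\<^bsub>ring_on \<O>\<^esub> x \<in> (*) c ` J" using neg[OF y(1)] y(2) by (auto intro!: image_eqI[of _ _ "- y"])
    next
      fix x y assume "x \<in> (*) c ` J" "y \<in> (*) c ` J"
      then show "x \<oplus>\<^bsub>ring_on \<O>\<^esub> y \<in> (*) c ` J" using J(3) by (auto simp flip: distrib_left)
    qed
    fix a x assume "a \<in> (*) c ` J" "x \<in> carrier (ring_on \<O>)"
    then obtain b where b: "a = c * b" "b \<in> J" "x \<in> \<O>" by auto
    then have "x * b \<in> J" using J(4) by blast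
    then show "x \<otimes>\<^bsub>ring_on \<O>\<^esub> a \<in> (*) c ` J" "a \<otimes>\<^bsub>ring_on \<O>\<^esub> x \<in> (*) c ` J"
      using b(1) by (auto simp: ac_simps intro!: image_eqI[of _ _ "x * b"])
  qed
  then show "J \<in> fractional_ideals L"
    unfolding fractional_ideals_def ring_of_integers_eq using J c by auto
qed

lemma frac_setprod:
  assumes A: "frac A" and B: "frac B"
  shows "frac (A \<star> B)"
proof -
  obtain c d where c: "c \<in> \<O>" "c \<noteq> 0" "\<And>x. x \<in> A \<Longrightarrow> c * x \<in> \<O>"
    and d: "d \<in> \<O>" "d \<noteq> 0" "\<And>x. x \<in> B \<Longrightarrow> d * x \<in> \<O>"
    using fracD(6)[OF A] fracD(6)[OF B] by blast
  obtain a b where ab: "a \<in> A" "a \<noteq> 0" "b \<in> B" "b \<noteq> 0"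
    using fracD(5)[OF A] fracD(5)[OF B] by blast
  have key: "x \<in> L \<and> (\<forall>e\<in>\<O>. e * x \<in> A \<star> B) \<and> (c * d) * x \<in> \<O>" if "x \<in> A \<star> B" for x
    using that
  proof (induction rule: setprod_induct)
    case (mult a b)
    have "a * b \<in> L" using mult fracD(1)[OF A] fracD(1)[OF B] by (auto intro: mult_L)
    moreover have "e * (a * b) \<in> A \<star> B" if "e \<in> \<O>" for e
      using setprod_mult[OF fracD(4)[OF A that mult(1)] mult(2)] by (simp add: mult.assoc)
    moreover have "(c * d) * (a * b) \<in> \<O>"
      using \<O>_closed(5)[OF c(3)[OF mult(1)] d(3)[OF mult(2)]] by (simp only: ac_simps)
    ultimately show ?case by blast
  next
    case (add x y)
    then show ?case by (auto simp: distrib_left intro: add_L setprod_add \<O>_closed)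
  qed
  show ?thesis
    unfolding frac_def
  proof (intro conjI ballI)
    show "A \<star> B \<subseteq> L" using key by blast
    show "0 \<in> A \<star> B" using setprod_mult[OF fracD(2)[OF A] fracD(2)[OF B]] by simp
    show "x + y \<in> A \<star> B" if "x \<in> A \<star> B" "y \<in> A \<star> B" for x y using that by (rule setprod_add)
    show "e * x \<in> A \<star> B" if "e \<in> \<O>" "x \<in> A \<star> B" for e x using key that by blast
    have "a * b \<in> A \<star> B" using setprod_mult[OF ab(1,3)] .
    moreover have "a * b \<noteq> 0" using ab by simp
    ultimately show "\<exists>x\<in>A \<star> B. x \<noteq> 0" by blast
    have "c * d \<in> \<O>" using c(1) d(1) by (rule \<O>_closed)
    moreover have "c * d \<noteq> 0" using c d by simp
    ultimately show "\<exists>e\<in>\<O>. e \<noteq> 0 \<and> (\<forall>x\<in>A \<star> B. e * x \<in> \<O>)" using key by blast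
  qed
qed

lemma principal_setprod:
  assumes J: "frac J"
  shows "(*) a ` \<O> \<star> J = (*) a ` J"
proof (intro equalityI subsetI)
  fix x assume "x \<in> (*) a ` \<O> \<star> J"
  then show "x \<in> (*) a ` J"
  proof (induction rule: setprod_induct)
    case (mult b j)
    then obtain c where c: "c \<in> \<O>" "b = a * c" by blast
    then have "c * j \<in> J" using fracD(4)[OF J] mult(2) by blast
    then show ?case using c by (auto simp: mult.assoc)
  next
    case (add x y)
    then show ?case using fracD(3)[OF J] by (auto simp flip: distrib_left)
  qed
next
  fix x assume "x \<in> (*) a ` J"
  then obtain j where j: "j \<in> J" "x = a * j" by blast
  have "a * 1 \<in> (*) a ` \<O>" using \<O>_closed(2) by blast
  then show "x \<in> (*) a ` \<O> \<star> J" using setprod_mult[of "a * 1" _ j J] j by simp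
qed

definition ideal_class :: "complex set \<Rightarrow> complex set set"
  where "ideal_class J = {(*) a ` \<O> \<star> J | a. a \<in> L \<and> a \<noteq> 0}"

text \<open>The quotient is unfolded to its set of cosets and no further, so parity can be used
  without establishing group laws for ideals.\<close>

lemma class_number_eq: "class_number L = card (ideal_class ` {J. frac J})"
proof -
  have "H #>\<^bsub>ideal_group L\<^esub> J = (\<lambda>h. h \<star> J) ` H" for H J
    by (auto simp: r_coset_def ideal_group_def)
  then have "principal_fractional_ideals L #>\<^bsub>ideal_group L\<^esub> J = ideal_class J" for J
    by (auto simp: principal_fractional_ideals_def ideal_class_def ring_of_integers_eq)
  then have "rcosets\<^bsub>ideal_group L\<^esub> principal_fractional_ideals L = ideal_class ` {J. frac J}"
    by (auto simp: RCOSETS_def ideal_group_def fractional_ideals_eq)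
  then show ?thesis by (simp add: class_number_def class_group_def FactGroup_def Coset.order_def)
qed

text \<open>
  Multiplication by \<open>I = (\<alpha>, \<beta>)\<close> is an involution of the odd set of ideal classes. A fixed class
  gives \<open>I J = a J\<close>, hence \<open>\<kappa> J = a\<^sup>2 J\<close>, and all powers of \<open>\<kappa> / a\<^sup>2\<close> have a common
  denominator.
\<close>

lemma odd_class_number_square:
  assumes odd: "odd (class_number L)"
    and almost: "\<And>D x. D \<in> \<O> \<Longrightarrow> D \<noteq> 0 \<Longrightarrow> x \<in> L \<Longrightarrow> (\<And>n. D * x ^ n \<in> \<O>) \<Longrightarrow> x \<in> \<O>"
    and ints: "\<alpha> \<in> \<O>" "\<beta> \<in> \<O>" "\<kappa> \<in> \<O>" "\<kappa> \<noteq> 0"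
      "r\<^sub>1 \<in> \<O>" "r\<^sub>2 \<in> \<O>" "r\<^sub>3 \<in> \<O>" "s\<^sub>1 \<in> \<O>" "s\<^sub>2 \<in> \<O>" "s\<^sub>3 \<in> \<O>"
    and eqs: "\<alpha> * \<alpha> = \<kappa> * r\<^sub>1" "\<alpha> * \<beta> = \<kappa> * r\<^sub>2" "\<beta> * \<beta> = \<kappa> * r\<^sub>3"
      "r\<^sub>1 * s\<^sub>1 + r\<^sub>2 * s\<^sub>2 + r\<^sub>3 * s\<^sub>3 = 1"
  obtains a e where "a \<in> L" "a \<noteq> 0" "e \<in> \<O>" "inverse e \<in> \<O>" "\<kappa> = e * a\<^sup>2"
proof -
  define I where "I = {\<alpha> * x + \<beta> * y | x y. x \<in> \<O> \<and> y \<in> \<O>}"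
  have I_mem: "\<alpha> * x + \<beta> * y \<in> I" if "x \<in> \<O>" "y \<in> \<O>" for x y using that by (auto simp: I_def)
  have I_mem': "\<alpha> * x \<in> I" "\<beta> * x \<in> I" if "x \<in> \<O>" for x
    using I_mem[OF that \<O>_closed(1)] I_mem[OF \<O>_closed(1) that] by simp_all
  have I_sub: "x \<in> \<O>" if "x \<in> I" for x
    using that unfolding I_def by (auto intro!: \<O>_closed(3,5) ints)
  have "frac I"
    unfolding frac_def
  proof (intro conjI ballI)
    show "I \<subseteq> L" using I_sub \<O>_closed(6) by blast
    show "0 \<in> I" using I_mem'(1)[OF \<O>_closed(1)] by simp
    show "x + y \<in> I" if xy: "x \<in> I" "y \<in> I" for x y
    proof -
      obtain a b c d where "x = \<alpha> * a + \<beta> * b" "y = \<alpha> * c + \<beta> * d" "a \<in> \<O>" "b \<in> \<O>" "c \<in> \<O>" "d \<in> \<O>"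
        using xy unfolding I_def by blast
      then show ?thesis using I_mem[OF \<O>_closed(3) \<O>_closed(3), of a c b d] by (simp add: algebra_simps)
    qed
    show "a * x \<in> I" if ax: "a \<in> \<O>" "x \<in> I" for a x
    proof -
      obtain b c where "x = \<alpha> * b + \<beta> * c" "b \<in> \<O>" "c \<in> \<O>" using ax(2) unfolding I_def by blast
      then show ?thesis using I_mem[OF \<O>_closed(5) \<O>_closed(5), of a b a c] ax(1) by (simp add: algebra_simps)
    qed
    show "\<exists>x\<in>I. x \<noteq> 0"
    proof (rule ccontr)
      assume no: "\<not> (\<exists>x\<in>I. x \<noteq> 0)"
      then have "\<alpha> = 0" "\<beta> = 0" using I_mem'[OF \<O>_closed(2)] by auto
      then have "r\<^sub>1 = 0" "r\<^sub>2 = 0" "r\<^sub>3 = 0" using eqs(1-3) ints(4) by auto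
      then show False using eqs(4) by simp
    qed
    show "\<exists>c\<in>\<O>. c \<noteq> 0 \<and> (\<forall>x\<in>I. c * x \<in> \<O>)"
      using I_sub \<O>_closed(2) by (intro bexI[of _ 1]) auto
  qed
  \<comment> \<open>The first three equations put all products into the ideal of \<kappa>; the last
    one writes \<kappa> itself as a combination of products of generators.\<close>
  have II: "I \<star> I = (*) \<kappa> ` \<O>"
  proof (intro equalityI subsetI)
    fix x assume "x \<in> I \<star> I"
    then show "x \<in> (*) \<kappa> ` \<O>"
    proof (induction rule: setprod_induct)
      case (mult x y)
      then obtain a b c d where xy: "x = \<alpha> * a + \<beta> * b" "y = \<alpha> * c + \<beta> * d"
        and abcd: "a \<in> \<O>" "b \<in> \<O>" "c \<in> \<O>" "d \<in> \<O>"
        unfolding I_def by blast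
      have "x * y = (\<alpha> * \<alpha>) * (a * c) + (\<alpha> * \<beta>) * (a * d + b * c) + (\<beta> * \<beta>) * (b * d)"
        by (simp add: xy algebra_simps)
      also have "\<dots> = \<kappa> * (r\<^sub>1 * (a * c) + r\<^sub>2 * (a * d + b * c) + r\<^sub>3 * (b * d))"
        unfolding eqs(1-3) by (simp add: algebra_simps)
      also have "\<dots> \<in> (*) \<kappa> ` \<O>"
        by (intro imageI \<O>_closed(3,5) ints abcd)
      finally show ?case .
    next
      case (add x y)
      then obtain a b where "x = \<kappa> * a" "y = \<kappa> * b" "a \<in> \<O>" "b \<in> \<O>" by blast
      then show ?case by (auto simp flip: distrib_left intro: \<O>_closed(3))
    qed
  next
    fix x assume "x \<in> (*) \<kappa> ` \<O>"
    then obtain y where y: "x = \<kappa> * y" "y \<in> \<O>" by blast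
    have "x = \<kappa> * (r\<^sub>1 * s\<^sub>1 + r\<^sub>2 * s\<^sub>2 + r\<^sub>3 * s\<^sub>3) * y" using y(1) eqs(4) by simp
    also have "\<dots> = (\<kappa> * r\<^sub>1) * (s\<^sub>1 * y) + (\<kappa> * r\<^sub>2) * (s\<^sub>2 * y) + (\<kappa> * r\<^sub>3) * (s\<^sub>3 * y)"
      by (simp add: algebra_simps)
    also have "\<dots> = (\<alpha> * 1) * (\<alpha> * (s\<^sub>1 * y)) + (\<alpha> * 1) * (\<beta> * (s\<^sub>2 * y)) + (\<beta> * 1) * (\<beta> * (s\<^sub>3 * y))"
      unfolding eqs(1-3)[symmetric] by (simp add: algebra_simps)
    also have "\<dots> \<in> I \<star> I"
      by (intro setprod_add setprod_mult I_mem' \<O>_closed(2,5) ints y(2))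
    finally show "x \<in> I \<star> I" .
  qed
  define S where "S = ideal_class ` {J. frac J}"
  define \<phi> where "\<phi> C = (\<lambda>J. I \<star> J) ` C" for C
  have \<phi>: "\<phi> (ideal_class J) = ideal_class (I \<star> J)" for J
  proof -
    have "I \<star> ((*) a ` \<O> \<star> J) = (*) a ` \<O> \<star> (I \<star> J)" for a
      by (metis setprod_assoc setprod_commute)
    then show ?thesis unfolding \<phi>_def ideal_class_def by auto
  qed
  have \<kappa>L: "\<kappa> \<in> L" using ints(3) \<O>_closed(6) by blast
  \<comment> \<open>Since I I is generated by \<kappa>, this makes \<phi> an involution on the set
    of classes.\<close>
  have class_scale: "ideal_class ((*) \<kappa> ` J) = ideal_class J" if J: "frac J" for J
  proof -
    have mem: "\<exists>b. b \<in> L \<and> b \<noteq> 0 \<and> a = b * \<kappa>" if "a \<in> L" "a \<noteq> 0" for a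
      using that \<kappa>L ints(4) by (intro exI[of _ "a * inverse \<kappa>"]) (auto intro: mult_L inverse_L)
    have "frac ((*) \<kappa> ` J)"
      using frac_setprod[OF \<open>frac I\<close> frac_setprod[OF \<open>frac I\<close> J]]
      by (simp only: setprod_assoc[symmetric] II principal_setprod[OF J])
    then have "ideal_class ((*) \<kappa> ` J) = {(*) (a * \<kappa>) ` J | a. a \<in> L \<and> a \<noteq> 0}"
      unfolding ideal_class_def by (simp add: principal_setprod image_image mult.assoc)
    also have "\<dots> = {(*) a ` J | a. a \<in> L \<and> a \<noteq> 0}"
    proof (intro equalityI subsetI)
      fix C assume "C \<in> {(*) (a * \<kappa>) ` J | a. a \<in> L \<and> a \<noteq> 0}"
      then obtain a where a: "C = (*) (a * \<kappa>) ` J" "a \<in> L" "a \<noteq> 0" by blast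
      then show "C \<in> {(*) a ` J | a. a \<in> L \<and> a \<noteq> 0}"
        using mult_L[OF a(2) \<kappa>L] ints(4) by (intro CollectI exI[of _ "a * \<kappa>"]) simp
    next
      fix C assume "C \<in> {(*) a ` J | a. a \<in> L \<and> a \<noteq> 0}"
      then obtain a where a: "C = (*) a ` J" "a \<in> L" "a \<noteq> 0" by blast
      obtain b where "b \<in> L" "b \<noteq> 0" "a = b * \<kappa>" using mem[OF a(2,3)] by blast
      then show "C \<in> {(*) (a * \<kappa>) ` J | a. a \<in> L \<and> a \<noteq> 0}"
        using a(1) by (intro CollectI exI[of _ b]) simp
    qed
    also have "\<dots> = ideal_class J"
      unfolding ideal_class_def by (simp add: principal_setprod J)
    finally show ?thesis .
  qed
  have \<phi>_mem: "\<phi> C \<in> S" if "C \<in> S" for C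
    using that frac_setprod[OF \<open>frac I\<close>] by (auto simp: S_def \<phi>)
  have \<phi>_\<phi>: "\<phi> (\<phi> C) = C" if "C \<in> S" for C
  proof -
    obtain J where J: "frac J" "C = ideal_class J" using \<open>C \<in> S\<close> by (auto simp: S_def)
    have "\<phi> (\<phi> C) = ideal_class (I \<star> I \<star> J)" by (simp only: J(2) \<phi> setprod_assoc)
    then show ?thesis by (simp only: II principal_setprod[OF J(1)] class_scale[OF J(1)] J(2))
  qed
  have "odd (card S)" using odd unfolding class_number_eq S_def .
  then have "finite S" by (metis card.infinite even_zero)
  then obtain C where C: "C \<in> S" "\<phi> C = C"
    using even_card_involution[of S \<phi>] \<phi>_mem \<phi>_\<phi> \<open>odd (card S)\<close> by blast
  then obtain J where J: "frac J" "C = ideal_class J" by (auto simp: S_def)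
  have IJ: "frac (I \<star> J)" using frac_setprod[OF \<open>frac I\<close> J(1)] .
  have "(*) 1 ` \<O> \<star> (I \<star> J) \<in> ideal_class (I \<star> J)"
    unfolding ideal_class_def using one_L by (intro CollectI exI[of _ 1]) auto
  then have "I \<star> J \<in> ideal_class (I \<star> J)" by (simp only: principal_setprod[OF IJ]) simp
  then have "I \<star> J \<in> ideal_class J" using C(2) unfolding J(2) \<phi> by simp
  then obtain a where a: "a \<in> L" "a \<noteq> 0" "I \<star> J = (*) a ` J"
    unfolding ideal_class_def by (auto simp: principal_setprod[OF J(1)])
  have "(*) \<kappa> ` J = I \<star> (I \<star> J)" by (simp only: setprod_assoc[symmetric] II principal_setprod[OF J(1)])
  also have "\<dots> = I \<star> ((*) a ` \<O> \<star> J)" by (simp only: a(3) principal_setprod[OF J(1)])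
  also have "\<dots> = (*) a ` \<O> \<star> (I \<star> J)" by (metis setprod_assoc setprod_commute)
  also have "\<dots> = (*) a ` (I \<star> J)" by (rule principal_setprod[OF IJ])
  also have "\<dots> = (*) (a\<^sup>2) ` J"
    unfolding a(3) image_image by (rule image_cong) (simp_all add: power2_eq_square mult.assoc)
  finally have \<kappa>J: "(*) \<kappa> ` J = (*) (a\<^sup>2) ` J" .
  define e where "e = \<kappa> / a\<^sup>2"
  have \<kappa>_eq: "\<kappa> = e * a\<^sup>2" using a(2) by (simp add: e_def)
  have eL: "e \<in> L" unfolding e_def divide_inverse power2_eq_square by (intro mult_L inverse_L \<kappa>L a)
  have e0: "e \<noteq> 0" using ints(4) \<kappa>_eq by auto
  have eJ: "e * x \<in> J" if "x \<in> J" for x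
  proof -
    have "\<kappa> * x \<in> (*) (a\<^sup>2) ` J" using that \<kappa>J by blast
    then obtain y where "y \<in> J" "\<kappa> * x = a\<^sup>2 * y" by blast
    then show ?thesis using a(2) by (simp add: e_def)
  qed
  have e'J: "inverse e * x \<in> J" if "x \<in> J" for x
  proof -
    have "a\<^sup>2 * x \<in> (*) \<kappa> ` J" using that \<kappa>J by blast
    then obtain y where "y \<in> J" "a\<^sup>2 * x = \<kappa> * y" by blast
    then show ?thesis using a(2) ints(4) by (simp add: e_def divide_simps)
  qed
  obtain c where c: "c \<in> \<O>" "c \<noteq> 0" "\<And>x. x \<in> J \<Longrightarrow> c * x \<in> \<O>" using fracD(6)[OF J(1)] by blast
  obtain j where j: "j \<in> J" "j \<noteq> 0" using fracD(5)[OF J(1)] by blast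
  \<comment> \<open>If \<open>x\<close> maps \<open>J\<close> into itself, then \<open>c * j\<close>
    is a common denominator of all powers of \<open>x\<close>. The hypothesis \<open>almost\<close>
    then replaces an argument by finite generation of \<open>J\<close>.\<close>
  have integral: "x \<in> \<O>" if x: "x \<in> L" "\<And>y. y \<in> J \<Longrightarrow> x * y \<in> J" for x
  proof (rule almost)
    show "c * j \<in> \<O>" "c * j \<noteq> 0" using c j by auto
    have "x ^ n * j \<in> J" for n by (induction n) (use j x(2) in \<open>auto simp: mult.assoc\<close>)
    then show "c * j * x ^ n \<in> \<O>" for n using c(3)[of "x ^ n * j"] by (simp add: ac_simps)
  qed (rule x(1))
  have "e \<in> \<O>" "inverse e \<in> \<O>" using integral eL inverse_L eJ e'J by blast+
  then show thesis using that a(1,2) \<kappa>_eq by blast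
qed

end

section \<open>Almost integral elements\<close>

lemma rat_almost_integral:
  fixes x :: real and M :: int
  assumes x: "x \<in> \<rat>" and M: "M \<noteq> 0" "\<And>n. of_int M * x ^ n \<in> \<int>"
  shows "x \<in> \<int>"
proof -
  obtain p q :: int where q: "q > 0" "coprime p q" "x = of_int p / of_int q"
    using x by (rule Rats_cases')
  have dv: "q ^ n dvd M" for n
  proof -
    obtain k :: int where "of_int M * x ^ n = of_int k" using M(2)[of n] by (rule Ints_cases)
    then have "of_int (M * p ^ n) = (of_int (k * q ^ n) :: real)"
      using q(1) by (simp add: q(3) power_divide field_simps)
    then have "M * p ^ n = k * q ^ n" by (simp only: of_int_eq_iff)
    then have "q ^ n dvd M * p ^ n" by simp
    moreover have "coprime (q ^ n) (p ^ n)" using q(2) by (simp add: coprime_commute)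
    ultimately show ?thesis by (simp add: coprime_dvd_mult_left_iff)
  qed
  have "q = 1"
  proof (rule ccontr)
    assume "q \<noteq> 1"
    then have "2 \<le> q" using q(1) by simp
    \<comment> \<open>This exponent suffices because 2 ^ n exceeds n, while every power of
      \<open>q\<close> divides \<open>M\<close>.\<close>
    define n where "n = nat \<bar>M\<bar>"
    have "int n < 2 ^ n" by (rule of_nat_less_two_power)
    also have "(2 :: int) ^ n \<le> q ^ n" using \<open>2 \<le> q\<close> by (intro power_mono) auto
    also have "q ^ n \<le> \<bar>M\<bar>" using dvd_imp_le_int[OF M(1) dv[of n]] q(1) by simp
    finally show False by (simp add: n_def)
  qed
  then show ?thesis using q(3) by simp
qed

context elementary_abelian_field
begin

text \<open>\<open>T\<close> contains the conjugations that may move \<open>x\<close>. For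
  \<open>h\<close> in \<open>T\<close>, the sum and the product of \<open>x\<close> and
  \<open>cj h x\<close> are fixed by \<open>h\<close> as well, so by induction, with denominator
  \<open>M * M\<close>, they are integral; and \<open>x\<close> is a root of the monic quadratic
  that they define.\<close>

lemma almost_integral_rat_denominator:
  fixes M :: int
  assumes "x \<in> F" "M \<noteq> 0" "\<And>n. of_int M * x ^ n \<in> ints" "finite T" "\<And>g. g \<notin> T \<Longrightarrow> cj g x = x"
  shows "x \<in> ints"
  using assms(4,1,2,3,5)
proof (induction T arbitrary: x M rule: finite_induct)
  case empty
  have x: "x \<in> \<rat>" using fixed_rational[OF empty.prems(1)] empty.prems(4) by simp
  have "of_int M * x ^ n \<in> \<int>" for n
    using x by (intro ints_rat_int empty.prems(3)) simp
  then have "x \<in> \<int>" using rat_almost_integral[OF x empty.prems(2)] by blast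
  then show ?case by (auto elim: Ints_cases)
next
  case (insert h T)
  define x' where "x' = cj h x"
  have F: "x \<in> F" "x' \<in> F" using insert.prems(1) by (simp_all add: x'_def cj_mem)
  have x'M: "of_int M * x' ^ n \<in> ints" for n
    using ints_cj[OF insert.prems(3)[of n], of h] F
    by (simp add: cj_mult cj_power power_mem x'_def)
  have fix_x': "cj g x' = x'" if "g \<notin> insert h T" for g
    using insert.prems(4)[OF that] cj_cj[OF F(1), of g h] cj_cj[OF F(1), of h g]
    by (simp add: x'_def add.commute)
  have hx: "cj h x = x'" "cj h x' = x" using F by (simp_all add: x'_def cj_cj cj_id)
  have sym: "cj g (x + x') = x + x'" "cj g (x * x') = x * x'" if "g \<notin> T" for g
    using that insert.prems(4)[of g] fix_x'[of g] hx F
    by (cases "g = h"; simp add: cj_add cj_mult)+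
  have M2: "M * M \<noteq> 0" using insert.prems(2) by simp
  have "of_int (M * M) * (x + x') ^ n \<in> ints" for n
  proof -
    have "of_int (M * M) * (x + x') ^ n
      = (\<Sum>k\<le>n. of_nat (n choose k) * ((of_int M * x ^ k) * (of_int M * x' ^ (n - k))))"
      unfolding binomial_ring sum_distrib_left by (intro sum.cong refl) (simp add: algebra_simps)
    also have "\<dots> \<in> ints"
    proof (intro ints_sum ints_mult[OF _ ints_mult] insert.prems(3) x'M)
      show "of_nat (n choose k) \<in> ints" for k using ints_of_int[of "int (n choose k)"] by simp
    qed
    finally show ?thesis .
  qed
  then have y: "x + x' \<in> ints"
    using insert.IH[OF add_mem[OF F] M2] sym(1) by blast
  have "of_int (M * M) * (x * x') ^ n \<in> ints" for n
  proof -
    have e: "of_int (M * M) * (x * x') ^ n = (of_int M * x ^ n) * (of_int M * x' ^ n)"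
      by (simp add: power_mult_distrib algebra_simps)
    show ?thesis unfolding e by (rule ints_mult[OF insert.prems(3) x'M])
  qed
  then have z: "x * x' \<in> ints"
    using insert.IH[OF mult_mem[OF F] M2] sym(2) by blast
  have eq: "x\<^sup>2 = (x + x') * x + - (x * x')" by (simp add: power2_eq_square algebra_simps)
  have "algebraic_int (x + x')" "algebraic_int (- (x * x'))"
    using y ints_uminus[OF z] by (simp_all add: ints_def)
  then have "algebraic_int x" by (rule algebraic_int_root_monic_quadratic(1)[OF _ _ eq])
  then show ?case using F by (simp add: ints_def)
qed

text \<open>The norm of \<open>D\<close> is a rational integer and an integral multiple of
  \<open>D\<close>, so it can take over as the denominator.\<close>

lemma almost_integral:
  assumes x: "x \<in> F" and D: "D \<in> ints" "D \<noteq> 0" and dn: "\<And>n. D * x ^ n \<in> ints"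
  shows "x \<in> ints"
proof -
  have DF: "D \<in> F" using D by (simp add: ints_def)
  define E where "E = (\<Prod>g\<in>UNIV - {0}. cj g D)"
  have "nrm D = cj 0 D * E" unfolding nrm_def E_def by (rule prod.remove) auto
  then have nD: "nrm D = E * D" by (simp add: cj_id DF)
  have prod_ints: "(\<Prod>g\<in>A. cj g D) \<in> ints" for A
    by (induction A rule: infinite_finite_induct) (auto intro: ints_mult ints_cj D)
  have E: "E \<in> ints" unfolding E_def by (rule prod_ints)
  have "nrm D \<in> \<int>"
    by (intro ints_rat_int nrm_rat DF) (simp add: nrm_def prod_ints)
  then obtain M where M: "nrm D = of_int M" by (rule Ints_cases)
  have "nrm D \<noteq> 0" unfolding nrm_def using D DF by simp
  then have "M \<noteq> 0" using M by auto
  moreover have "of_int M * x ^ n \<in> ints" for n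
    using ints_mult[OF E dn[of n]] by (simp add: M[symmetric] nD mult.assoc)
  ultimately show ?thesis
    using almost_integral_rat_denominator[OF x, of M UNIV] by simp
qed

end

section \<open>Real triquadratic fields\<close>

definition subfield_pred :: "real set \<Rightarrow> bool"
  where "subfield_pred K \<longleftrightarrow> 0 \<in> K \<and> 1 \<in> K \<and> (\<forall>x\<in>K. \<forall>y\<in>K. x + y \<in> K \<and> x * y \<in> K)
    \<and> (\<forall>x\<in>K. - x \<in> K \<and> inverse x \<in> K)"

lemma subfieldD:
  assumes "subfield_pred K"
  shows "0 \<in> K" "1 \<in> K" "\<And>x y. x \<in> K \<Longrightarrow> y \<in> K \<Longrightarrow> x + y \<in> K" "\<And>x y. x \<in> K \<Longrightarrow> y \<in> K \<Longrightarrow> x * y \<in> K"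
    "\<And>x. x \<in> K \<Longrightarrow> - x \<in> K" "\<And>x. x \<in> K \<Longrightarrow> inverse x \<in> K"
    "\<And>x y. x \<in> K \<Longrightarrow> y \<in> K \<Longrightarrow> x - y \<in> K"
proof -
  show *: "0 \<in> K" "1 \<in> K" "\<And>x y. x \<in> K \<Longrightarrow> y \<in> K \<Longrightarrow> x + y \<in> K" "\<And>x y. x \<in> K \<Longrightarrow> y \<in> K \<Longrightarrow> x * y \<in> K"
    "\<And>x. x \<in> K \<Longrightarrow> - x \<in> K" "\<And>x. x \<in> K \<Longrightarrow> inverse x \<in> K"
    using assms unfolding subfield_pred_def by (elim conjE, simp)+
  show "x - y \<in> K" if "x \<in> K" "y \<in> K" for x y
    using *(3)[OF that(1) *(5)[OF that(2)]] by simp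
qed

lemma subfield_Rats: "subfield_pred \<rat>"
  by (simp add: subfield_pred_def)

definition adjoin :: "real set \<Rightarrow> real \<Rightarrow> real set"
  where "adjoin K s = {x + y * s | x y. x \<in> K \<and> y \<in> K}"

lemma adjoin_mem: "x \<in> K \<Longrightarrow> y \<in> K \<Longrightarrow> x + y * s \<in> adjoin K s"
  by (auto simp: adjoin_def)

lemma adjoinE:
  assumes "z \<in> adjoin K s"
  obtains x y where "z = x + y * s" "x \<in> K" "y \<in> K"
  using assms by (auto simp: adjoin_def)

lemma adjoin_incl:
  assumes "subfield_pred K"
  shows "K \<subseteq> adjoin K s" "s \<in> adjoin K s"
proof -
  have "x + 0 * s \<in> adjoin K s" if "x \<in> K" for x by (intro adjoin_mem that subfieldD[OF assms])
  then show "K \<subseteq> adjoin K s" by auto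
  have "0 + 1 * s \<in> adjoin K s" by (intro adjoin_mem subfieldD[OF assms])
  then show "s \<in> adjoin K s" by simp
qed

lemma subfield_adjoin:
  assumes K: "subfield_pred K" and s: "s * s \<in> K"
  shows "subfield_pred (adjoin K s)"
proof -
  note D = subfieldD[OF K]
  have inv: "inverse z \<in> adjoin K s" if "z \<in> adjoin K s" for z
  proof -
    obtain x y where z: "z = x + y * s" and xy: "x \<in> K" "y \<in> K" using \<open>z \<in> adjoin K s\<close> by (rule adjoinE)
    show ?thesis
    \<comment> \<open>\<open>s\<close> may lie in \<open>K\<close>, so the conjugate
      \<open>x - y * s\<close> can vanish although \<open>z\<close> does not; then \<open>z\<close>
      is \<open>x + x\<close>.\<close>
    proof (cases "x = y * s")
      case True
      then have "inverse z = inverse (x + x) + 0 * s" by (simp add: z)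
      also have "\<dots> \<in> adjoin K s" by (intro adjoin_mem D xy)
      finally show ?thesis .
    next
      case False
      define N where "N = x * x - (y * y) * (s * s)"
      have N: "N = z * (x - y * s)" by (simp add: N_def z algebra_simps)
      have NK: "N \<in> K" unfolding N_def by (intro D xy s)
      have "inverse z = (x - y * s) * inverse N" using False by (simp add: N)
      also have "\<dots> = x * inverse N + (- y * inverse N) * s" by (simp add: algebra_simps)
      also have "\<dots> \<in> adjoin K s" by (intro adjoin_mem D xy NK)
      finally show ?thesis .
    qed
  qed
  have add: "z + w \<in> adjoin K s" and mult: "z * w \<in> adjoin K s" if zw: "z \<in> adjoin K s" "w \<in> adjoin K s" for z w
  proof -
    obtain x y where z: "z = x + y * s" and xy: "x \<in> K" "y \<in> K" using zw(1) by (rule adjoinE)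
    obtain x' y' where w: "w = x' + y' * s" and xy': "x' \<in> K" "y' \<in> K" using zw(2) by (rule adjoinE)
    have "z + w = (x + x') + (y + y') * s" by (simp add: z w algebra_simps)
    also have "\<dots> \<in> adjoin K s" by (intro adjoin_mem D xy xy')
    finally show "z + w \<in> adjoin K s" .
    have "z * w = (x * x' + y * y' * (s * s)) + (x * y' + y * x') * s" by (simp add: z w algebra_simps)
    also have "\<dots> \<in> adjoin K s" by (intro adjoin_mem D xy xy' s)
    finally show "z * w \<in> adjoin K s" .
  qed
  have neg: "- z \<in> adjoin K s" if zw: "z \<in> adjoin K s" for z
  proof -
    obtain x y where z: "z = x + y * s" and xy: "x \<in> K" "y \<in> K" using zw(1) by (rule adjoinE)
    have "- z = - x + (- y) * s" by (simp add: z)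
    also have "\<dots> \<in> adjoin K s" by (intro adjoin_mem D xy)
    finally show ?thesis .
  qed
  have 01: "0 \<in> adjoin K s" "1 \<in> adjoin K s" using adjoin_incl(1)[OF K, of s] D(1,2) by auto
  show ?thesis unfolding subfield_pred_def by (intro conjI ballI inv add mult neg 01)
qed

text \<open>The target is kept general because embeddings have complex values before they are shown
  to be real on the field.\<close>

definition ring_map_on :: "real set \<Rightarrow> (real \<Rightarrow> 'a::real_field) \<Rightarrow> bool"
  where "ring_map_on K f \<longleftrightarrow> f 1 = 1 \<and> (\<forall>x\<in>K. \<forall>y\<in>K. f (x + y) = f x + f y \<and> f (x * y) = f x * f y)"

lemma ring_map_onD:
  assumes "ring_map_on K f"
  shows "f 1 = 1" "x \<in> K \<Longrightarrow> y \<in> K \<Longrightarrow> f (x + y) = f x + f y" "x \<in> K \<Longrightarrow> y \<in> K \<Longrightarrow> f (x * y) = f x * f y"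
  using assms by (auto simp: ring_map_on_def)

lemma ring_map_on_Rats_of_real:
  assumes K: "subfield_pred K" "\<rat> \<subseteq> K" and f: "ring_map_on K f" and q: "q \<in> \<rat>"
  shows "f q = of_real q"
proof -
  note f = ring_map_onD[OF f]
  have 0: "f 0 = 0" using f(2)[of 0 0] subfieldD(1)[OF K(1)] by simp
  have mem: "r \<in> K" if "r \<in> \<rat>" for r using K(2) that by blast
  have nat: "f (of_nat n) = of_nat n" for n
  proof (induction n)
    case (Suc n)
    then show ?case using f(2)[of 1 "of_nat n"] by (simp add: mem f(1))
  qed (simp add: 0)
  have int: "f (of_int i) = of_int i" for i
  proof (cases "i \<ge> 0")
    case True then show ?thesis using nat[of "nat i"] by simp
  next
    case False
    then have "f (of_nat (nat (- i))) = of_nat (nat (- i))" by (intro nat)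
    then have "f (- of_int i) = - of_int i" using False by simp
    then show ?thesis using f(2)[of "of_int i" "- of_int i"] 0 by (simp add: mem)
  qed
  obtain a b :: int where ab: "b > 0" "q = of_int a / of_int b" using q by (rule Rats_cases') blast
  then have qb: "q * of_int b = of_int a" by simp
  have "f (q * of_int b) = f q * f (of_int b)" by (intro f(3) mem q) simp
  then have "f q * of_int b = of_real (q * of_int b)" unfolding qb int by simp
  then have e: "f q * of_int b = of_real q * of_int b" by (simp only: of_real_mult of_real_of_int_eq)
  show ?thesis by (rule mult_right_cancel[THEN iffD1, OF _ e]) (use ab(1) in simp)
qed

lemma ring_map_on_Rats:
  fixes f :: "real \<Rightarrow> real"
  assumes "subfield_pred K" "\<rat> \<subseteq> K" "ring_map_on K f" "q \<in> \<rat>"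
  shows "f q = q"
  using ring_map_on_Rats_of_real[OF assms] by simp

lemma ring_map_on_sqrt:
  fixes f :: "real \<Rightarrow> real"
  assumes K: "subfield_pred K" "\<rat> \<subseteq> K" and f: "ring_map_on K f" and s: "s \<in> K" "s * s \<in> \<rat>"
  shows "f s = s \<or> f s = - s"
proof -
  have "f s * f s = s * s"
    using ring_map_onD(3)[OF f s(1) s(1)] ring_map_on_Rats[OF K f s(2)] by simp
  then show ?thesis by (simp add: square_eq_iff)
qed

locale three_roots =
  fixes r\<^sub>1 r\<^sub>2 r\<^sub>3 :: real
  assumes r_nz: "r\<^sub>1 \<noteq> 0" "r\<^sub>2 \<noteq> 0" "r\<^sub>3 \<noteq> 0"
    and r_sq: "r\<^sub>1 * r\<^sub>1 \<in> \<rat>" "r\<^sub>2 * r\<^sub>2 \<in> \<rat>" "r\<^sub>3 * r\<^sub>3 \<in> \<rat>"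
begin

definition "F\<^sub>1 = adjoin \<rat> r\<^sub>1"
definition "F\<^sub>2 = adjoin F\<^sub>1 r\<^sub>2"
definition "F\<^sub>3 = adjoin F\<^sub>2 r\<^sub>3"

lemma F1: "subfield_pred F\<^sub>1" "\<rat> \<subseteq> F\<^sub>1" "r\<^sub>1 \<in> F\<^sub>1"
  unfolding F\<^sub>1_def using subfield_adjoin[OF subfield_Rats r_sq(1)] adjoin_incl[OF subfield_Rats] by auto

lemma F2: "subfield_pred F\<^sub>2" "F\<^sub>1 \<subseteq> F\<^sub>2" "r\<^sub>2 \<in> F\<^sub>2"
proof -
  have "r\<^sub>2 * r\<^sub>2 \<in> F\<^sub>1" using F1(2) r_sq by blast
  then show "subfield_pred F\<^sub>2" "F\<^sub>1 \<subseteq> F\<^sub>2" "r\<^sub>2 \<in> F\<^sub>2"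
    unfolding F\<^sub>2_def using subfield_adjoin[OF F1(1)] adjoin_incl[OF F1(1)] by auto
qed

lemma F3: "subfield_pred F\<^sub>3" "F\<^sub>2 \<subseteq> F\<^sub>3" "r\<^sub>3 \<in> F\<^sub>3"
proof -
  have "r\<^sub>3 * r\<^sub>3 \<in> F\<^sub>2" using F1(2) F2(2) r_sq by blast
  then show "subfield_pred F\<^sub>3" "F\<^sub>2 \<subseteq> F\<^sub>3" "r\<^sub>3 \<in> F\<^sub>3"
    unfolding F\<^sub>3_def using subfield_adjoin[OF F2(1)] adjoin_incl[OF F2(1)] by auto
qed

lemma F3_mem: "\<rat> \<subseteq> F\<^sub>3" "r\<^sub>1 \<in> F\<^sub>3" "r\<^sub>2 \<in> F\<^sub>3" "r\<^sub>3 \<in> F\<^sub>3"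
  using F1 F2 F3 by auto

lemma F3_induct [consumes 1, case_names rat r1 r2 r3 add mult]:
  assumes "x \<in> F\<^sub>3" "\<And>q. q \<in> \<rat> \<Longrightarrow> P q" "P r\<^sub>1" "P r\<^sub>2" "P r\<^sub>3"
    and add: "\<And>x y. x \<in> F\<^sub>3 \<Longrightarrow> y \<in> F\<^sub>3 \<Longrightarrow> P x \<Longrightarrow> P y \<Longrightarrow> P (x + y)"
    and mult: "\<And>x y. x \<in> F\<^sub>3 \<Longrightarrow> y \<in> F\<^sub>3 \<Longrightarrow> P x \<Longrightarrow> P y \<Longrightarrow> P (x * y)"
  shows "P x"
proof -
  have step: "P z" if z: "z \<in> adjoin K s" and K: "\<And>x. x \<in> K \<Longrightarrow> P x" "K \<subseteq> F\<^sub>3" and s: "P s" "s \<in> F\<^sub>3" for z K s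
  proof -
    obtain x y where xy: "z = x + y * s" "x \<in> K" "y \<in> K" using z by (rule adjoinE)
    have "x \<in> F\<^sub>3" "y \<in> F\<^sub>3" using xy K(2) by auto
    moreover from this have "y * s \<in> F\<^sub>3" using subfieldD(4)[OF F3(1)] s(2) by blast
    ultimately show ?thesis unfolding xy(1) using K(1) xy s by (intro add mult) auto
  qed
  have 1: "P x" if "x \<in> F\<^sub>1" for x
    by (rule step[OF that[unfolded F\<^sub>1_def] assms(2) F3_mem(1) assms(3) F3_mem(2)])
  have 2: "P x" if "x \<in> F\<^sub>2" for x
    by (rule step[OF that[unfolded F\<^sub>2_def] 1 subset_trans[OF F2(2) F3(2)] assms(4) F3_mem(3)])
  show ?thesis
    by (rule step[OF assms(1)[unfolded F\<^sub>3_def] 2 F3(2) assms(5) F3_mem(4)])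
qed

lemma ring_map_on_eq:
  fixes f g :: "real \<Rightarrow> real"
  assumes "ring_map_on F\<^sub>3 f" "ring_map_on F\<^sub>3 g" "f r\<^sub>1 = g r\<^sub>1" "f r\<^sub>2 = g r\<^sub>2" "f r\<^sub>3 = g r\<^sub>3" "x \<in> F\<^sub>3"
  shows "f x = g x"
  using assms(6)
proof (induction rule: F3_induct)
  case (rat q)
  then show ?case using ring_map_on_Rats[OF F3(1) F3_mem(1) assms(1) rat] ring_map_on_Rats[OF F3(1) F3_mem(1) assms(2) rat]
    by simp
next
  case (add x y) then show ?case using ring_map_onD(2)[OF assms(1)] ring_map_onD(2)[OF assms(2)] by simp
next
  case (mult x y) then show ?case using ring_map_onD(3)[OF assms(1)] ring_map_onD(3)[OF assms(2)] by simp
qed (use assms in auto)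

lemma ring_map_on_mem:
  fixes f :: "real \<Rightarrow> real"
  assumes f: "ring_map_on F\<^sub>3 f" and "x \<in> F\<^sub>3"
  shows "f x \<in> F\<^sub>3"
proof -
  have r: "f s \<in> F\<^sub>3" if "s \<in> F\<^sub>3" "s * s \<in> \<rat>" for s
    using ring_map_on_sqrt[OF F3(1) F3_mem(1) f that] subfieldD(5)[OF F3(1)] that(1) by auto
  show ?thesis using assms(2)
  proof (induction rule: F3_induct)
    case (rat q)
    then show ?case using ring_map_on_Rats[OF F3(1) F3_mem(1) f rat] F3_mem(1) by auto
  next
    case (add x y) then show ?case using ring_map_onD(2)[OF f] subfieldD(3)[OF F3(1)] by simp
  next
    case (mult x y) then show ?case using ring_map_onD(3)[OF f] subfieldD(4)[OF F3(1)] by simp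
  qed (use r F3_mem r_sq in auto)
qed

definition sgn_bit :: "bit \<Rightarrow> real"
  where "sgn_bit b = (if b = 0 then 1 else - 1)"

lemma sgn_bit_simps [simp]: "sgn_bit 0 = 1" "sgn_bit 1 = - 1" "sgn_bit b * sgn_bit b = 1"
  by (simp_all add: sgn_bit_def)

lemma sgn_bit_add: "sgn_bit (a + b) = sgn_bit a * sgn_bit b"
  using bit_exhaust[of a] bit_exhaust[of b] by (auto simp: sgn_bit_def)

lemma elementary_abelian_field_sign_patterns:
  assumes f: "\<And>g. ring_map_on F\<^sub>3 (f g)"
    and signs: "\<And>a b c. f (a, b, c) r\<^sub>1 = sgn_bit a * r\<^sub>1" "\<And>a b c. f (a, b, c) r\<^sub>2 = sgn_bit b * r\<^sub>2"
      "\<And>a b c. f (a, b, c) r\<^sub>3 = sgn_bit c * r\<^sub>3"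
  shows "elementary_abelian_field F\<^sub>3 f"
proof
  show "0 \<in> F\<^sub>3" "1 \<in> F\<^sub>3" using subfieldD[OF F3(1)] by blast+
  show "x + y \<in> F\<^sub>3" if "x \<in> F\<^sub>3" "y \<in> F\<^sub>3" for x y
    using that by (rule subfieldD(3)[OF F3(1)])
  show "x * y \<in> F\<^sub>3" if "x \<in> F\<^sub>3" "y \<in> F\<^sub>3" for x y
    using that by (rule subfieldD(4)[OF F3(1)])
  show "- x \<in> F\<^sub>3" if "x \<in> F\<^sub>3" for x using that by (rule subfieldD(5)[OF F3(1)])
  show "inverse x \<in> F\<^sub>3" if "x \<in> F\<^sub>3" for x using that by (rule subfieldD(6)[OF F3(1)])
  show mem: "f g x \<in> F\<^sub>3" if "x \<in> F\<^sub>3" for g x using ring_map_on_mem[OF f that] .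
  show "f g (x + y) = f g x + f g y" if "x \<in> F\<^sub>3" "y \<in> F\<^sub>3" for g x y
    using that by (rule ring_map_onD(2)[OF f])
  show "f g (x * y) = f g x * f g y" if "x \<in> F\<^sub>3" "y \<in> F\<^sub>3" for g x y
    using that by (rule ring_map_onD(3)[OF f])
  have s_mult: "f g (sgn_bit b * s) = sgn_bit b * f g s" if "s \<in> F\<^sub>3" for g b s
  proof -
    have "f g (sgn_bit b) = sgn_bit b"
      by (rule ring_map_on_Rats[OF F3(1) F3_mem(1) f]) (simp add: sgn_bit_def)
    moreover have "sgn_bit b \<in> F\<^sub>3" using F3_mem(1) by (auto simp: sgn_bit_def)
    ultimately show ?thesis using ring_map_onD(3)[OF f _ that] by simp
  qed
  show "f g (f h x) = f (g + h) x" if x: "x \<in> F\<^sub>3" for g h x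
  proof -
    obtain a b c where g: "g = (a, b, c)" by (rule prod_cases3)
    obtain a' b' c' where h: "h = (a', b', c')" by (rule prod_cases3)
    have rm: "ring_map_on F\<^sub>3 (\<lambda>x. f g (f h x))"
      unfolding ring_map_on_def
    proof (intro conjI ballI)
      show "f g (f h 1) = 1" by (simp only: ring_map_onD(1)[OF f])
      fix x y assume xy: "x \<in> F\<^sub>3" "y \<in> F\<^sub>3"
      show "f g (f h (x + y)) = f g (f h x) + f g (f h y)"
        by (simp only: ring_map_onD(2)[OF f xy] ring_map_onD(2)[OF f mem[OF xy(1)] mem[OF xy(2)]])
      show "f g (f h (x * y)) = f g (f h x) * f g (f h y)"
        by (simp only: ring_map_onD(3)[OF f xy] ring_map_onD(3)[OF f mem[OF xy(1)] mem[OF xy(2)]])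
    qed
    show ?thesis
      by (rule ring_map_on_eq[OF rm f _ _ _ x])
        (simp_all add: g h signs s_mult F3_mem sgn_bit_add mult.assoc del: add_bit_eq_xor)
  qed
  show "f 0 x = x" if x: "x \<in> F\<^sub>3" for x
  proof -
    have "ring_map_on F\<^sub>3 (\<lambda>x. x)" by (simp add: ring_map_on_def)
    from ring_map_on_eq[OF f this _ _ _ x, of 0] show ?thesis
      by (simp add: zero_prod_def signs)
  qed
  show "x \<in> \<rat>" if x: "x \<in> F\<^sub>3" "\<And>g. f g x = x" for x
  proof -
    \<comment> \<open>A fixed element loses \<open>r\<^sub>3\<close>, \<open>r\<^sub>2\<close> and
      \<open>r\<^sub>1\<close> in turn: a conjugation that negates one root and fixes the field
      below it forces the coefficient of that root to contribute nothing.\<close>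
    have step: "x \<in> K" if "x \<in> adjoin K s" "K \<subseteq> F\<^sub>3" "s \<in> F\<^sub>3" "f g s = - s" "\<And>y. y \<in> K \<Longrightarrow> f g y = y" for K s g
    proof -
      obtain y z where yz: "x = y + z * s" "y \<in> K" "z \<in> K" using \<open>x \<in> adjoin K s\<close> by (rule adjoinE)
      have F: "y \<in> F\<^sub>3" "z \<in> F\<^sub>3" using yz \<open>K \<subseteq> F\<^sub>3\<close> by auto
      have "f g x = f g y + f g (z * s)"
        unfolding yz(1) by (intro ring_map_onD(2)[OF f] F subfieldD(4)[OF F3(1)] \<open>s \<in> F\<^sub>3\<close>)
      also have "f g (z * s) = f g z * f g s" by (intro ring_map_onD(3)[OF f] F \<open>s \<in> F\<^sub>3\<close>)
      finally have "f g x = y - z * s" using \<open>f g s = - s\<close> \<open>\<And>y. y \<in> K \<Longrightarrow> f g y = y\<close> yz by simp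
      then have "z * s = 0" using x(2)[of g] yz(1) by simp
      then have "x = y" unfolding yz(1) by (simp only: add_0_right)
      then show ?thesis using yz(2) by simp
    qed
    have rat: "f g y = y" if "y \<in> \<rat>" for g y using ring_map_on_Rats[OF F3(1) F3_mem(1) f that] .
    have fix1: "f (0, b, c) y = y" if "y \<in> F\<^sub>1" for b c y
    proof -
      obtain p q where y: "y = p + q * r\<^sub>1" "p \<in> \<rat>" "q \<in> \<rat>" 
        using \<open>y \<in> F\<^sub>1\<close> unfolding F\<^sub>1_def by (rule adjoinE)
      then have "p \<in> F\<^sub>3" "q \<in> F\<^sub>3" using F3_mem by auto
      then show ?thesis
        using y rat F3_mem by (simp add: ring_map_onD[OF f] subfieldD(4)[OF F3(1)] signs)
    qed
    have fix2: "f (0, 0, c) y = y" if "y \<in> F\<^sub>2" for c y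
    proof -
      obtain p q where y: "y = p + q * r\<^sub>2" "p \<in> F\<^sub>1" "q \<in> F\<^sub>1" 
        using \<open>y \<in> F\<^sub>2\<close> unfolding F\<^sub>2_def by (rule adjoinE)
      then have "p \<in> F\<^sub>3" "q \<in> F\<^sub>3" using F2 F3 by auto
      then show ?thesis
        using y fix1 F3_mem by (simp add: ring_map_onD[OF f] subfieldD(4)[OF F3(1)] signs)
    qed
    have "x \<in> F\<^sub>2"
      by (rule step[of F\<^sub>2 r\<^sub>3 "(0, 0, 1)"]) (use x F3 fix2 signs in \<open>auto simp: F\<^sub>3_def[symmetric]\<close>)
    then have "x \<in> F\<^sub>1"
      by (intro step[of F\<^sub>1 r\<^sub>2 "(0, 1, 0)"]) (use F2 F3 fix1 signs in \<open>auto simp: F\<^sub>2_def[symmetric]\<close>)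
    then show "x \<in> \<rat>"
      by (intro step[of \<rat> r\<^sub>1 "(1, 0, 0)"]) (use F3_mem rat signs in \<open>auto simp: F\<^sub>1_def[symmetric]\<close>)
  qed
qed

end

section \<open>The generated complex field and its embeddings\<close>

lemma complex_ring_inverse:
  "\<ominus>\<^bsub>\<C>\<^esub> x = - x" "x \<noteq> 0 \<Longrightarrow> inv\<^bsub>\<C>\<^esub> x = inverse x"
proof -
  interpret R: field \<C> by (rule field_from_type_algebra)
  show "\<ominus>\<^bsub>\<C>\<^esub> x = - x" by (rule R.minus_equality) simp_all
  show "inv\<^bsub>\<C>\<^esub> x = inverse x" if "x \<noteq> 0"
    by (rule R.inv_unique'[symmetric]) (use that in simp_all)
qed

lemma rat_adjoin_closed:
  "q \<in> \<rat> \<Longrightarrow> q \<in> rat_adjoin S" "s \<in> S \<Longrightarrow> s \<in> rat_adjoin S"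
  "x \<in> rat_adjoin S \<Longrightarrow> y \<in> rat_adjoin S \<Longrightarrow> x + y \<in> rat_adjoin S"
  "x \<in> rat_adjoin S \<Longrightarrow> y \<in> rat_adjoin S \<Longrightarrow> x * y \<in> rat_adjoin S"
  "x \<in> rat_adjoin S \<Longrightarrow> - x \<in> rat_adjoin S"
  "x \<in> rat_adjoin S \<Longrightarrow> inverse x \<in> rat_adjoin S"
proof -
  show rat: "q \<in> rat_adjoin S" if "q \<in> \<rat>" for q
    using that unfolding rat_adjoin_def by (intro generate_field.incl) simp
  show "s \<in> S \<Longrightarrow> s \<in> rat_adjoin S"
    unfolding rat_adjoin_def by (intro generate_field.incl) simp
  show "x + y \<in> rat_adjoin S" if "x \<in> rat_adjoin S" "y \<in> rat_adjoin S"
    using generate_field.eng_add[OF that[unfolded rat_adjoin_def]] by (simp add: rat_adjoin_def)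
  show "x * y \<in> rat_adjoin S" if "x \<in> rat_adjoin S" "y \<in> rat_adjoin S"
    using generate_field.eng_mult[OF that[unfolded rat_adjoin_def]] by (simp add: rat_adjoin_def)
  show "- x \<in> rat_adjoin S" if "x \<in> rat_adjoin S"
    using generate_field.a_inv[OF that[unfolded rat_adjoin_def]]
    by (simp add: rat_adjoin_def complex_ring_inverse)
  show "inverse x \<in> rat_adjoin S" if "x \<in> rat_adjoin S"
  proof (cases "x = 0")
    case True then show ?thesis using rat[of 0] by simp
  next
    case False then show ?thesis
      using generate_field.m_inv[OF that[unfolded rat_adjoin_def]]
      by (simp add: rat_adjoin_def complex_ring_inverse)
  qed
qed

lemma number_field_rat_adjoin: "number_field (rat_adjoin S)"
  by standard (simp_all add: rat_adjoin_closed)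

context three_roots
begin

definition L :: "complex set"
  where "L = rat_adjoin {of_real r\<^sub>1, of_real r\<^sub>2, of_real r\<^sub>3}"

lemma of_real_mem_L: "x \<in> F\<^sub>3 \<Longrightarrow> of_real x \<in> L"
proof (induction rule: F3_induct)
  case (rat q)
  then have "complex_of_real q \<in> \<rat>" by (auto elim!: Rats_cases')
  then show ?case unfolding L_def by (rule rat_adjoin_closed)
next
  case (add x y) then show ?case by (simp add: L_def rat_adjoin_closed)
next
  case (mult x y) then show ?case by (simp add: L_def rat_adjoin_closed)
qed (simp_all add: L_def rat_adjoin_closed)

lemma L_eq: "L = of_real ` F\<^sub>3"
proof (intro equalityI subsetI)
  note D = subfieldD[OF F3(1)]
  fix z assume "z \<in> L"
  then show "z \<in> of_real ` F\<^sub>3"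
    unfolding L_def rat_adjoin_def
  proof (induction rule: generate_field.induct)
    case one then show ?case using D(2) by (intro image_eqI[of _ _ 1]) simp_all
  next
    case (incl h)
    then show ?case
    proof
      assume "h \<in> \<rat>"
      then obtain a b :: int where "h = of_int a / of_int b" by (rule Rats_cases') blast
      then have "h = of_real (of_int a / of_int b)" by simp
      moreover have "of_int a / of_int b \<in> F\<^sub>3" using F3_mem(1) by auto
      ultimately show ?thesis by (rule image_eqI)
    qed (use F3_mem in auto)
  next
    case (a_inv h) then show ?case using D(5) by (auto simp: complex_ring_inverse simp flip: of_real_minus)
  next
    case (m_inv h) then show ?case using D(6) by (auto simp: complex_ring_inverse simp flip: of_real_inverse)
  next
    case (eng_add x y) then show ?case using D(3) by (auto simp flip: of_real_add)
  next
    case (eng_mult x y) then show ?case using D(4) by (auto simp flip: of_real_mult)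
  qed
qed (use of_real_mem_L in blast)

definition restr :: "(complex \<Rightarrow> complex) \<Rightarrow> real \<Rightarrow> real"
  where "restr \<sigma> x = Re (\<sigma> (of_real x))"

lemma embeddingsD:
  assumes "\<sigma> \<in> embeddings L"
  shows "\<sigma> 1 = 1" "x \<in> L \<Longrightarrow> y \<in> L \<Longrightarrow> \<sigma> (x + y) = \<sigma> x + \<sigma> y"
    "x \<in> L \<Longrightarrow> y \<in> L \<Longrightarrow> \<sigma> (x * y) = \<sigma> x * \<sigma> y" "\<sigma> \<in> extensional L"
  using assms by (simp_all add: embeddings_def Ring.ring_hom_def)

lemma embedding_rat:
  assumes \<sigma>: "\<sigma> \<in> embeddings L" and q: "q \<in> \<rat>"
  shows "\<sigma> (of_real q) = of_real q"
proof -
  have "ring_map_on F\<^sub>3 (\<lambda>x. \<sigma> (of_real x))"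
    using embeddingsD(1-3)[OF \<sigma>] of_real_mem_L by (simp add: ring_map_on_def)
  from ring_map_on_Rats_of_real[OF F3(1) F3_mem(1) this q] show ?thesis .
qed

lemma embedding_sqrt:
  assumes \<sigma>: "\<sigma> \<in> embeddings L" and s: "s \<in> F\<^sub>3" "s * s \<in> \<rat>"
  shows "\<sigma> (of_real s) = of_real s \<or> \<sigma> (of_real s) = - of_real s"
proof -
  have "\<sigma> (of_real s) * \<sigma> (of_real s) = of_real s * of_real s"
    using embeddingsD(3)[OF \<sigma> of_real_mem_L[OF s(1)] of_real_mem_L[OF s(1)]] embedding_rat[OF \<sigma> s(2)]
    by simp
  then show ?thesis by (simp add: square_eq_iff)
qed

text \<open>The three roots are sent to plus or minus themselves, and being real is inherited by
  sums and products. Embeddings can thus be studied as the real maps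
  \<open>restr \<sigma>\<close>.\<close>

lemma embedding_real:
  assumes \<sigma>: "\<sigma> \<in> embeddings L" and x: "x \<in> F\<^sub>3"
  shows "\<sigma> (of_real x) = of_real (restr \<sigma> x)"
proof -
  have "\<sigma> (of_real x) \<in> \<real>"
    using x
  proof (induction rule: F3_induct)
    case (rat q) then show ?case using embedding_rat[OF \<sigma> rat] by simp
  next
    case (add x y) then show ?case using embeddingsD(2)[OF \<sigma>] of_real_mem_L by simp
  next
    case (mult x y) then show ?case using embeddingsD(3)[OF \<sigma>] of_real_mem_L by simp
  qed (use embedding_sqrt[OF \<sigma>] F3_mem r_sq in \<open>metis Reals_minus Reals_of_real\<close>)+
  then show ?thesis by (simp add: restr_def)
qed

lemma ring_map_restr:
  assumes \<sigma>: "\<sigma> \<in> embeddings L"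
  shows "ring_map_on F\<^sub>3 (restr \<sigma>)"
  unfolding ring_map_on_def
proof (intro conjI ballI)
  show "restr \<sigma> 1 = 1" using embeddingsD(1)[OF \<sigma>] by (simp add: restr_def)
  fix x y assume xy: "x \<in> F\<^sub>3" "y \<in> F\<^sub>3"
  have "complex_of_real (restr \<sigma> (x + y)) = of_real (restr \<sigma> x + restr \<sigma> y)"
    using embeddingsD(2)[OF \<sigma> of_real_mem_L[OF xy(1)] of_real_mem_L[OF xy(2)]]
      embedding_real[OF \<sigma>] xy subfieldD(3)[OF F3(1) xy] by (simp flip: of_real_add)
  then show "restr \<sigma> (x + y) = restr \<sigma> x + restr \<sigma> y" by (simp only: of_real_eq_iff)
  have "complex_of_real (restr \<sigma> (x * y)) = of_real (restr \<sigma> x * restr \<sigma> y)"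
    using embeddingsD(3)[OF \<sigma> of_real_mem_L[OF xy(1)] of_real_mem_L[OF xy(2)]]
      embedding_real[OF \<sigma>] xy subfieldD(4)[OF F3(1) xy] by (simp flip: of_real_mult)
  then show "restr \<sigma> (x * y) = restr \<sigma> x * restr \<sigma> y" by (simp only: of_real_eq_iff)
qed

definition sign_pattern :: "(complex \<Rightarrow> complex) \<Rightarrow> bit3"
  where "sign_pattern \<sigma> = (of_bool (restr \<sigma> r\<^sub>1 \<noteq> r\<^sub>1), of_bool (restr \<sigma> r\<^sub>2 \<noteq> r\<^sub>2), of_bool (restr \<sigma> r\<^sub>3 \<noteq> r\<^sub>3))"

lemma restr_roots:
  assumes \<sigma>: "\<sigma> \<in> embeddings L" and g: "sign_pattern \<sigma> = (a, b, c)"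
  shows "restr \<sigma> r\<^sub>1 = sgn_bit a * r\<^sub>1" "restr \<sigma> r\<^sub>2 = sgn_bit b * r\<^sub>2" "restr \<sigma> r\<^sub>3 = sgn_bit c * r\<^sub>3"
proof -
  have "restr \<sigma> s = sgn_bit (of_bool (restr \<sigma> s \<noteq> s)) * s" if "s \<in> F\<^sub>3" "s * s \<in> \<rat>" for s
    using ring_map_on_sqrt[OF F3(1) F3_mem(1) ring_map_restr[OF \<sigma>] that] by auto
  then show "restr \<sigma> r\<^sub>1 = sgn_bit a * r\<^sub>1" "restr \<sigma> r\<^sub>2 = sgn_bit b * r\<^sub>2" "restr \<sigma> r\<^sub>3 = sgn_bit c * r\<^sub>3"
    using g F3_mem r_sq unfolding sign_pattern_def by blast+
qed

lemma inj_on_sign_pattern: "inj_on sign_pattern (embeddings L)"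
proof (rule inj_onI)
  fix \<sigma> \<tau> assume \<sigma>: "\<sigma> \<in> embeddings L" and \<tau>: "\<tau> \<in> embeddings L" and eq: "sign_pattern \<sigma> = sign_pattern \<tau>"
  obtain a b c where g: "sign_pattern \<sigma> = (a, b, c)" by (rule prod_cases3)
  note r = restr_roots[OF \<sigma> g] restr_roots[OF \<tau> g[unfolded eq]]
  show "\<sigma> = \<tau>"
  proof (rule extensionalityI[OF embeddingsD(4)[OF \<sigma>] embeddingsD(4)[OF \<tau>]])
    fix z assume "z \<in> L"
    then obtain x where x: "z = of_real x" "x \<in> F\<^sub>3" using L_eq by blast
    have "restr \<sigma> x = restr \<tau> x"
      by (rule ring_map_on_eq[OF ring_map_restr[OF \<sigma>] ring_map_restr[OF \<tau>] _ _ _ x(2)]) (simp_all add: r)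
    then show "\<sigma> z = \<tau> z" using embedding_real[OF \<sigma> x(2)] embedding_real[OF \<tau> x(2)] x(1) by simp
  qed
qed

text \<open>An embedding is determined by three signs, and the automorphisms already supply eight
  embeddings, so every pattern of signs occurs. The Galois group enters through its order.\<close>

lemma bij_betw_sign_pattern:
  assumes "galois_group L \<cong> integer_mod_group 2 \<times>\<times> integer_mod_group 2 \<times>\<times> integer_mod_group 2"
  shows "bij_betw sign_pattern (embeddings L) UNIV"
proof -
  let ?Z = "integer_mod_group 2 \<times>\<times> integer_mod_group 2 \<times>\<times> integer_mod_group 2"
  have "card (carrier (galois_group L)) = card (carrier ?Z)"
    using assms unfolding is_iso_def iso_def by (auto dest: bij_betw_same_card)
  also have "\<dots> = 8" by (simp add: carrier_integer_mod_group card_cartesian_product)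
  finally have card_gal: "card (carrier (galois_group L)) = 8" .
  have sub: "carrier (galois_group L) \<subseteq> embeddings L"
    by (auto simp: galois_group_def embeddings_def ring_iso_def Ring.ring_hom_def)
  have "card (UNIV :: bit3 set) = 8" using sum_UNIV_bit3[of "\<lambda>_. 1 :: nat"] by simp
  have fin: "finite (embeddings L)"
    using inj_on_sign_pattern by (rule inj_on_finite[of _ _ UNIV]) auto
  have "card (sign_pattern ` embeddings L) = card (embeddings L)"
    using inj_on_sign_pattern by (rule card_image)
  also have "\<dots> \<ge> 8" using card_mono[OF fin sub] card_gal by simp
  finally have "sign_pattern ` embeddings L = UNIV"
    using \<open>card UNIV = 8\<close> card_seteq[of "UNIV :: bit3 set" "sign_pattern ` embeddings L"] by simp
  then show ?thesis using inj_on_sign_pattern by (simp add: bij_betw_def)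
qed

end

section \<open>Definite elements with square ideal\<close>

lemma algebraic_int_sqrt_of_int: "algebraic_int (sqrt (of_int k))"
  by (intro algebraic_int_sqrt int_imp_algebraic_int) simp

lemma sqrt_of_int_mult_self: "k > 0 \<Longrightarrow> sqrt (of_int k) * sqrt (of_int k) = (of_int k :: real)"
  by simp

context elementary_abelian_field
begin

lemma ints_sqrt: "sqrt (of_int k) \<in> F \<Longrightarrow> sqrt (of_int k) \<in> ints"
  by (simp add: ints_def algebraic_int_sqrt_of_int)

lemma cj_square_rat:
  assumes "s \<in> F" "s * s \<in> \<rat>"
  shows "cj g s = s \<or> cj g s = - s"
proof -
  have "cj g s * cj g s = s * s" using cj_mult[OF assms(1,1), of g] cj_rat[OF assms(2), of g] by simp
  then show ?thesis by (simp add: square_eq_iff)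
qed

lemma cj_sqrt:
  assumes "sqrt (of_int k) \<in> F" "k > 0"
  shows "cj g (sqrt (of_int k)) = sqrt (of_int k) \<or> cj g (sqrt (of_int k)) = - sqrt (of_int k)"
  using assms by (intro cj_square_rat) simp_all

lemma cj_eq_add:
  assumes "s \<in> F" "s \<noteq> 0" "\<And>g. cj g s = s \<or> cj g s = - s"
  shows "cj (g + h) s = s \<longleftrightarrow> (cj g s = s \<longleftrightarrow> cj h s = s)"
  using assms(3)[of g] assms(3)[of h] assms(1,2) cj_cj[OF assms(1), of g h]
  by (auto simp: cj_uminus)

text \<open>\<open>w\<close> is the norm of \<open>u\<close> to the field generated by
  \<open>s\<close>, a product over the stabiliser of \<open>s\<close>. A conjugation that moves
  \<open>s\<close> carries the stabiliser to its other coset, and both cosets together give the full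
  norm.\<close>

lemma relative_norm_unit:
  assumes s: "s \<in> F" "s \<noteq> 0" "\<And>g. cj g s = s \<or> cj g s = - s" and u: "u \<in> unit_grp"
  obtains w where "w \<in> unit_grp" "\<And>g. cj g s = s \<Longrightarrow> cj g w = w"
    "\<And>g. cj g s \<noteq> s \<Longrightarrow> cj g w * w = nrm u"
proof
  define w where "w = (\<Prod>g | cj g s = s. cj g u)"
  have uF: "u \<in> F" using u by (rule unit_grpD)
  have cw: "cj h w = (\<Prod>g | cj g s = s. cj (h + g) u)" for h
    unfolding w_def by (subst cj_prod) (simp_all add: cj_mem cj_cj uF)
  show "w \<in> unit_grp" unfolding w_def by (intro unit_grp_prod unit_grp_cj u)
  show "cj h w = w" if h: "cj h s = s" for h
    unfolding cw unfolding w_def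
    by (rule prod.reindex_bij_witness[of _ "\<lambda>g. h + g" "\<lambda>g. h + g"])
      (use h in \<open>simp_all add: cj_eq_add[OF s]\<close>)
  show "cj h w * w = nrm u" if h: "cj h s \<noteq> s" for h
  proof -
    have "cj h w = (\<Prod>g | cj g s \<noteq> s. cj g u)"
      unfolding cw
      by (rule prod.reindex_bij_witness[of _ "\<lambda>g. h + g" "\<lambda>g. h + g"])
        (use h in \<open>simp_all add: cj_eq_add[OF s]\<close>)
    then have "cj h w * w = (\<Prod>g\<in>{g. cj g s \<noteq> s} \<union> {g. cj g s = s}. cj g u)"
      unfolding w_def by (subst prod.union_disjoint) auto
    also have "{g. cj g s \<noteq> s} \<union> {g. cj g s = s} = UNIV" by auto
    finally show ?thesis by (simp add: nrm_def)
  qed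
qed

end

context odd_class_field
begin

text \<open>For k = p l with \<open>p\<close> and \<open>l\<close> coprime, the ideal (p, sqrt k)
  has square (p^2, p sqrt k, p l) = (p), and \<open>p\<close> is positive in every
  conjugate.\<close>

lemma sqrt_prime_mem:
  fixes k p :: int
  assumes k: "k > 0" "sqrt (of_int k) \<in> F" and p: "prime p" "p dvd k" "\<not> p\<^sup>2 dvd k"
  shows "sqrt (of_int p) \<in> F"
proof -
  obtain l where l: "k = p * l" using p(2) by blast
  have "\<not> p dvd l" using p(3) by (auto simp: l power2_eq_square)
  then have "coprime p l" using p(1) by (simp add: prime_imp_coprime)
  then obtain i j where ij: "i * p + j * l = 1" using bezout_int[of p l] by auto
  have p0: "p > 0" using p(1) by (simp add: prime_gt_0_int)
  have eq: "of_int p * of_int i + sqrt (of_int k) * 0 + of_int l * of_int j = (1 :: real)"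
    using arg_cong[OF ij, of "of_int :: int \<Rightarrow> real"] by (simp add: mult.commute)
  have pos: "cj g (1 * of_int p) * (1 * of_int p) > 0" for g using p0 by simp
  have kI: "sqrt (of_int k) \<in> ints" using k(2) by (rule ints_sqrt)
  have kk: "sqrt (of_int k) * sqrt (of_int k) = of_int p * of_int l"
    using sqrt_of_int_mult_self[OF k(1)] by (simp only: l of_int_mult)
  have "of_int p \<noteq> (0 :: real)" using p0 by simp
  then obtain y where y: "y \<in> F" "\<bar>1 * of_int p\<bar> = y\<^sup>2"
    by (rule definite_square[OF ints_of_int kI ints_of_int _ ints_of_int kI ints_of_int ints_of_int
          ints_0 ints_of_int refl refl kk eq unit_grp_1 pos])
  then have "sqrt (of_int p) = \<bar>y\<bar>" using p0 by (simp add: real_sqrt_unique)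
  then show ?thesis using y(1) uminus_mem[OF y(1)] by (cases "y \<ge> 0") auto
qed

text \<open>Prime factors are stripped off: p^2 contributes a rational factor, and a prime dividing
  \<open>k\<close> exactly once has its root in \<open>F\<close> by \<open>sqrt_prime_mem\<close>.
  Hence primes suffice to detect a conjugation that moves some square root.\<close>

lemma fixed_sqrt:
  fixes k :: int
  assumes fixed: "\<And>p :: int. prime p \<Longrightarrow> sqrt (of_int p) \<in> F \<Longrightarrow> cj g (sqrt (of_int p)) = sqrt (of_int p)"
    and k: "k > 0" "sqrt (of_int k) \<in> F"
  shows "cj g (sqrt (of_int k)) = sqrt (of_int k)"
  using k
proof (induction "nat k" arbitrary: k rule: less_induct)
  case less
  show ?case
  proof (cases "k = 1")
    case False
    then obtain p where p: "prime p" "p dvd k" using prime_factor_int[of k] less.prems by auto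
    have p1: "p > 1" using p(1) by (simp add: prime_gt_1_int)
    show ?thesis
    proof (cases "p\<^sup>2 dvd k")
      case True
      then obtain l where l: "k = p\<^sup>2 * l" by blast
      have l0: "l > 0" using less.prems l p1 by (simp add: zero_less_mult_iff)
      have s: "sqrt (of_int k) = of_int p * sqrt (of_int l)"
        using p1 by (simp add: l real_sqrt_mult real_sqrt_abs)
      have "1 * l < p\<^sup>2 * l" using l0 p1 by (intro mult_strict_right_mono) (simp_all add: power2_eq_square less_1_mult)
      then have "l < k" using l by simp
      then have "nat l < nat k" using l0 by (simp add: nat_less_eq_zless)
      moreover have "sqrt (of_int l) \<in> F"
        using divide_mem[OF less.prems(2) of_int_mem[of p]] s p1 by simp
      ultimately have "cj g (sqrt (of_int l)) = sqrt (of_int l)" using less.hyps l0 by blast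
      then show ?thesis using s cj_mult[OF of_int_mem \<open>sqrt (of_int l) \<in> F\<close>] by simp
    next
      case False
      have sp: "sqrt (of_int p) \<in> F" using sqrt_prime_mem[OF less.prems p False] .
      obtain l where l: "k = p * l" using p(2) by blast
      have l0: "l > 0" using less.prems l p1 by (simp add: zero_less_mult_iff)
      have s: "sqrt (of_int k) = sqrt (of_int p) * sqrt (of_int l)" by (simp add: l real_sqrt_mult)
      have "1 * l < p * l" using l0 p1 by (intro mult_strict_right_mono) simp_all
      then have "l < k" using l by simp
      then have "nat l < nat k" using l0 by (simp add: nat_less_eq_zless)
      moreover have "sqrt (of_int l) \<in> F"
        using divide_mem[OF less.prems(2) sp] s p1 by simp
      ultimately have "cj g (sqrt (of_int l)) = sqrt (of_int l)" using less.hyps l0 by blast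
      then show ?thesis using s cj_mult[OF sp \<open>sqrt (of_int l) \<in> F\<close>] fixed[OF p(1) sp] by simp
    qed
  qed simp
qed

text \<open>By \<alpha> \<alpha>' = \<beta>^2 the square of (\<alpha>, \<beta>) is \<alpha>
  (\<alpha>, \<beta>, \<alpha>') = (\<alpha>), and \<open>act\<close> lets the sign changes of
  \<open>w\<close> and \<alpha> cancel, so \<open>w * \<alpha>\<close> is up to sign a square y^2 in
  \<open>F\<close>. This contradicts the commutation of \<open>b\<close> and \<open>c\<close> at
  \<open>y\<close>.\<close>

lemma no_definite_conjugate_pair:
  assumes ints: "\<alpha> \<in> ints" "\<alpha>' \<in> ints" "\<beta> \<in> ints" "\<beta> \<noteq> 0" "s\<^sub>1 \<in> ints" "s\<^sub>2 \<in> ints" "s\<^sub>3 \<in> ints"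
    and eqs: "\<alpha> * \<alpha>' = \<beta> * \<beta>" "\<alpha> * s\<^sub>1 + \<beta> * s\<^sub>2 + \<alpha>' * s\<^sub>3 = 1"
    and w: "w \<in> unit_grp"
    and act: "\<And>g. cj g w = w \<and> (cj g \<alpha> = \<alpha> \<or> cj g \<alpha> = \<alpha>') \<or>
      cj g w * w = - 1 \<and> (cj g \<alpha> = - \<alpha> \<or> cj g \<alpha> = - \<alpha>')"
    and b: "cj b \<alpha> = \<alpha>'" "cj b w = w"
    and c: "cj c \<alpha> = \<alpha>" "cj c w = w" "cj c \<beta> = - \<beta>"
  shows False
proof -
  have F: "\<alpha> \<in> F" "\<beta> \<in> F" "w \<in> F" using ints w unit_grpD by (auto simp: ints_def)
  have nz: "\<alpha> \<noteq> 0" "w \<noteq> 0" using eqs(1) ints(4) w unit_grpD by auto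
  have pos: "\<alpha> * \<alpha>' > 0" "\<alpha> * \<alpha> > 0" "w * w > 0"
    using ints(4) nz unfolding eqs(1) by (auto simp: zero_less_mult_iff not_less)
  have definite: "cj g (w * \<alpha>) * (w * \<alpha>) > 0" for g
  proof -
    have e: "cj g (w * \<alpha>) * (w * \<alpha>) = (cj g w * w) * (cj g \<alpha> * \<alpha>)" using F by (simp add: cj_mult)
    consider "cj g w * w = w * w" "cj g \<alpha> * \<alpha> = \<alpha> * \<alpha>" | "cj g w * w = w * w" "cj g \<alpha> * \<alpha> = \<alpha> * \<alpha>'"
      | "cj g w * w = - 1" "cj g \<alpha> * \<alpha> = - (\<alpha> * \<alpha>)" | "cj g w * w = - 1" "cj g \<alpha> * \<alpha> = - (\<alpha> * \<alpha>')"
      using act[of g] by (auto simp: mult.commute)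
    then show ?thesis unfolding e
      by cases (simp_all only: mult_minus_left mult_minus_right minus_minus mult_1_left pos mult_pos_pos)
  qed
  obtain y where y: "y \<in> F" "\<bar>w * \<alpha>\<bar> = y\<^sup>2"
    by (rule definite_square[OF ints(1,3,1) nz(1) ints(1,3,2,5,6,7) refl refl _ eqs(2) w definite])
      (simp add: eqs(1))
  obtain e where e: "e = 1 \<or> e = - 1" "y\<^sup>2 = e * (w * \<alpha>)" "e \<in> F" "\<And>g. cj g e = e"
  proof (cases "w * \<alpha> \<ge> 0")
    case True then show ?thesis using that[of 1] y(2) by simp
  next
    case False then show ?thesis using that[of "- 1"] y(2) by (simp add: uminus_mem cj_uminus)
  qed
  have cj_sq: "(cj g y)\<^sup>2 = e * (cj g w * cj g \<alpha>)" for g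
    using arg_cong[OF e(2), of "cj g"] e(3,4) F y(1) by (simp add: cj_power cj_mult mult_mem)
  have "(cj c y)\<^sup>2 = y\<^sup>2" unfolding cj_sq e(2) c ..
  then obtain f where f: "f = 1 \<or> f = - 1" "cj c y = f * y" "f \<in> F" "\<And>g. cj g f = f"
  proof (cases "cj c y = y")
    case True then show ?thesis using that[of 1] by simp
  next
    case False
    then have "cj c y = - y" using \<open>(cj c y)\<^sup>2 = y\<^sup>2\<close> by (simp add: power2_eq_iff)
    then show ?thesis using that[of "- 1"] by (simp add: uminus_mem cj_uminus)
  qed
  \<comment> \<open>Since \<open>b\<close> and \<open>c\<close> commute and \<open>c\<close> sends
    \<open>y\<close> to plus or minus \<open>y\<close>, it fixes \<open>z\<close>; but
    \<open>z\<close> is plus or minus \<open>w * \<beta>\<close>, which \<open>c\<close>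
    negates.\<close>
  define z where "z = y * cj b y"
  have bF: "cj b y \<in> F" using y(1) by (rule cj_mem)
  have "cj c (cj b y) = cj b (cj c y)" using y(1) by (simp add: cj_cj add.commute)
  also have "\<dots> = f * cj b y" using f y(1) by (simp add: cj_mult)
  finally have "cj c z = (f * f) * z" unfolding z_def using f(2) y(1) bF by (simp add: cj_mult)
  then have cz: "cj c z = z" using f(1) by auto
  have "z\<^sup>2 = y\<^sup>2 * (cj b y)\<^sup>2" by (simp add: z_def power_mult_distrib)
  also have "\<dots> = (e * e) * (w * w) * (\<alpha> * \<alpha>')" unfolding cj_sq e(2) b by (simp add: algebra_simps)
  also have "\<dots> = (w * \<beta>)\<^sup>2" using e(1) unfolding eqs(1) by (auto simp: power2_eq_square)
  finally have z_sq: "z\<^sup>2 = (w * \<beta>)\<^sup>2" .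
  then have "z = w * \<beta> \<or> z = - (w * \<beta>)" by (simp add: power2_eq_iff)
  moreover have "cj c (w * \<beta>) = - (w * \<beta>)" using F c by (simp add: cj_mult)
  ultimately have "cj c z = - z" using F by (auto simp: cj_uminus mult_mem)
  with cz have "z = 0" by simp
  with z_sq show False using nz ints(4) by simp
qed

text \<open>\<open>no_definite_conjugate_pair\<close> is applied to \<alpha> = (x sqrt a + y sqrt b)
  / k, \<alpha>' = (x sqrt a - y sqrt b) / k and \<beta> = z sqrt c / k, with k = 2 in the second
  parity case and k = 1 otherwise. \<open>g\<^sub>b\<close> exchanges \<alpha> and \<alpha>',
  \<open>g\<^sub>c\<close> fixes \<alpha> and negates \<beta>, and \<open>w\<close> compensates a
  change of sign of sqrt a.\<close>

lemma no_ternary_zero: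
  fixes a b c x y z :: int
  assumes pos: "a > 0" "b > 0" "c > 0"
    and F: "sqrt (of_int a) \<in> F" "sqrt (of_int b) \<in> F" "sqrt (of_int c) \<in> F"
    and w: "w \<in> unit_grp"
    and act: "\<And>g. cj g (sqrt (of_int a)) = sqrt (of_int a) \<and> cj g w = w \<or>
      cj g (sqrt (of_int a)) = - sqrt (of_int a) \<and> cj g w * w = - 1"
    and g\<^sub>b: "cj g\<^sub>b (sqrt (of_int a)) = sqrt (of_int a)" "cj g\<^sub>b (sqrt (of_int b)) = - sqrt (of_int b)" "cj g\<^sub>b w = w"
    and g\<^sub>c: "cj g\<^sub>c (sqrt (of_int a)) = sqrt (of_int a)" "cj g\<^sub>c (sqrt (of_int b)) = sqrt (of_int b)"
      "cj g\<^sub>c (sqrt (of_int c)) = - sqrt (of_int c)" "cj g\<^sub>c w = w"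
    and eq: "z \<noteq> 0" "a * x\<^sup>2 = b * y\<^sup>2 + c * z\<^sup>2" "coprime (a * x) (b * y)"
      "odd (c * z) \<or> (even z \<and> odd (a * x) \<and> odd (b * y))"
  shows False
proof -
  define ra rb rc where "ra = sqrt (of_int a)" and "rb = sqrt (of_int b)" and "rc = sqrt (of_int c)"
  note defs = ra_def[symmetric] rb_def[symmetric] rc_def[symmetric]
  have sq: "ra * ra = of_int a" "rb * rb = of_int b" "rc * rc = of_int c"
    using pos by (simp_all add: ra_def rb_def rc_def)
  have rI: "ra \<in> ints" "rb \<in> ints" "rc \<in> ints" using F by (simp_all add: ra_def rb_def rc_def ints_sqrt)
  note rF = F[unfolded defs]
  have cb: "cj g rb = rb \<or> cj g rb = - rb" for g using cj_sqrt[OF F(2) pos(2)] unfolding defs .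
  note act = act[unfolded defs] and gb = g\<^sub>b[unfolded defs] and gc = g\<^sub>c[unfolded defs]
  have rc0: "rc \<noteq> 0" using pos by (simp add: rc_def)
  obtain i j where ij: "i * (a * x) + j * (b * y) = 1"
    using eq(3) bezout_int[of "a * x" "b * y"] by auto
  have req: "of_int a * (of_int x)\<^sup>2 = of_int b * (of_int y)\<^sup>2 + of_int c * (of_int z :: real)\<^sup>2"
    using arg_cong[OF eq(2), of "of_int :: int \<Rightarrow> real"] by simp
  have rij: "of_int i * (of_int a * of_int x) + of_int j * (of_int b * of_int y) = (1 :: real)"
    using arg_cong[OF ij, of "of_int :: int \<Rightarrow> real"] by simp
  define A B where "A = ra * of_int x" and "B = rb * of_int y"
  have AB: "A \<in> ints" "B \<in> ints" unfolding A_def B_def by (intro ints_mult rI ints_of_int)+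
  then have ABF: "A \<in> F" "B \<in> F" by (simp_all add: ints_def)
  have cA: "cj g A = cj g ra * of_int x" and cB: "cj g B = cj g rb * of_int y" for g
    unfolding A_def B_def using rF by (simp_all add: cj_mult)
  have raA: "ra * A = of_int a * of_int x" "rb * B = of_int b * of_int y"
    by (simp_all add: A_def B_def sq mult.assoc[symmetric])
  have A2: "A * A = of_int a * (of_int x)\<^sup>2" "B * B = of_int b * (of_int y)\<^sup>2"
    using sq by (simp_all add: A_def B_def power2_eq_square algebra_simps)
  define C where "C = rc * of_int z"
  have CI: "C \<in> ints" unfolding C_def by (intro ints_mult rI ints_of_int)
  then have CF: "C \<in> F" by (simp add: ints_def)
  have C2: "C * C = of_int c * (of_int z)\<^sup>2" "rc * C = of_int c * of_int z"
    using sq(3) by (simp_all add: C_def power2_eq_square algebra_simps)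
  have ABC: "(A + B) * (A - B) = C * C"
  proof -
    have "(A + B) * (A - B) = A * A - B * B" by (simp add: algebra_simps)
    then show ?thesis unfolding A2 C2 req by simp
  qed
  have "\<exists>k :: int. (k = 1 \<or> k = 2) \<and> (A + B) / k \<in> ints \<and> (A - B) / k \<in> ints \<and> C / k \<in> ints \<and>
    (\<exists>s\<^sub>1\<in>ints. \<exists>s\<^sub>2\<in>ints. \<exists>s\<^sub>3\<in>ints. (A + B) / k * s\<^sub>1 + C / k * s\<^sub>2 + (A - B) / k * s\<^sub>3 = 1)"
  proof (cases "even z \<and> odd (a * x) \<and> odd (b * y)")
    case True
    then obtain z' where z: "z = 2 * z'" by blast
    have "C / 2 = rc * of_int z'" by (simp add: C_def z)
    then have C2I: "C / 2 \<in> ints" using ints_mult[OF rI(3) ints_of_int] by simp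
    have aF: "(A + B) / 2 \<in> F" using divide_mem[OF add_mem[OF ABF] of_int_mem[of 2]] by simp
    \<comment> \<open>Halving is harmless: (A + B) / 2 is a root of X^2 - A X + (C / 2)^2, whose
      last coefficient is integral because \<open>z\<close> is even.\<close>
    have quad: "((A + B) / 2)\<^sup>2 = A * ((A + B) / 2) + - (C / 2 * (C / 2))"
      using ABC by (simp add: power2_eq_square field_simps)
    have "algebraic_int A" "algebraic_int (- (C / 2 * (C / 2)))"
      using AB(1) ints_uminus[OF ints_mult[OF C2I C2I]] by (simp_all add: ints_def)
    then have "algebraic_int ((A + B) / 2)" by (rule algebraic_int_root_monic_quadratic(1)[OF _ _ quad])
    then have aI: "(A + B) / 2 \<in> ints" using aF by (simp add: ints_def)
    have e: "(A - B) / 2 = A - (A + B) / 2" by (simp add: field_simps)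
    have a'I: "(A - B) / 2 \<in> ints" unfolding e by (rule ints_diff[OF AB(1) aI])
    have "(A + B) / 2 * (of_int i * ra + of_int j * rb) + C / 2 * 0 + (A - B) / 2 * (of_int i * ra - of_int j * rb)
      = of_int i * (ra * A) + of_int j * (rb * B)" by (simp add: field_simps)
    also have "\<dots> = 1" unfolding raA rij ..
    finally show ?thesis
      using C2I aI a'I
      by (intro exI[of _ 2] conjI bexI[of _ "of_int i * ra + of_int j * rb"] bexI[of _ 0]
          bexI[of _ "of_int i * ra - of_int j * rb"] ints_add ints_diff ints_mult rI ints_of_int) simp_all
  next
    case False
    then have "odd (c * z)" using eq(4) by blast
    then obtain k where k: "c * z = 2 * k + 1" by (rule oddE)
    have rk: "of_int c * of_int z = 2 * of_int k + (1 :: real)"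
      using arg_cong[OF k, of "of_int :: int \<Rightarrow> real"] by simp
    \<comment> \<open>Without halving, the Bezout combination of A + B and A - B yields 2; the odd
      number \<open>c * z\<close>, which is \<open>rc * C\<close>, turns this into 1.\<close>
    have "(A + B) * (of_int (- k) * (of_int i * ra + of_int j * rb)) + C * rc
        + (A - B) * (of_int (- k) * (of_int i * ra - of_int j * rb))
      = rc * C - 2 * of_int k * (of_int i * (ra * A) + of_int j * (rb * B))"
      by (simp add: algebra_simps)
    also have "\<dots> = 1" unfolding C2 raA rij rk by simp
    finally show ?thesis
      using AB CI rI(3)
      by (intro exI[of _ 1] conjI bexI[of _ "of_int (- k) * (of_int i * ra + of_int j * rb)"] bexI[of _ rc]
          bexI[of _ "of_int (- k) * (of_int i * ra - of_int j * rb)"] ints_add ints_diff ints_mult rI ints_of_int)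
        (simp_all add: ints_add ints_diff)
  qed
  then obtain k :: int and s\<^sub>1 s\<^sub>2 s\<^sub>3 where k: "k = 1 \<or> k = 2"
    and I: "(A + B) / k \<in> ints" "(A - B) / k \<in> ints" "C / k \<in> ints" "s\<^sub>1 \<in> ints" "s\<^sub>2 \<in> ints" "s\<^sub>3 \<in> ints"
    and comb: "(A + B) / k * s\<^sub>1 + C / k * s\<^sub>2 + (A - B) / k * s\<^sub>3 = 1" by blast
  have prod: "(A + B) / k * ((A - B) / k) = C / k * (C / k)" by (simp add: ABC)
  have cj_k: "cj g (D / of_int k) = cj g D / of_int k" if "D \<in> F" for g D
    using cj_divide[OF that of_int_mem] by simp
  have cj_a: "cj g ((A + B) / k) = (cj g A + cj g B) / k" for g
    using cj_k[OF add_mem[OF ABF]] ABF by (simp add: cj_add)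
  have cj_C: "cj g\<^sub>c C = - C" unfolding C_def using rF by (simp add: cj_mult gc)
  show False
  proof (rule no_definite_conjugate_pair[OF I(1-3) _ I(4-6) prod comb w])
    show "C / k \<noteq> 0" using rc0 eq(1) k by (auto simp: C_def)
    show "cj g w = w \<and> (cj g ((A + B) / k) = (A + B) / k \<or> cj g ((A + B) / k) = (A - B) / k) \<or>
      cj g w * w = - 1 \<and> (cj g ((A + B) / k) = - ((A + B) / k) \<or> cj g ((A + B) / k) = - ((A - B) / k))" for g
      using act[of g] cb[of g] unfolding cj_a cA cB unfolding A_def B_def minus_divide_left
      by (elim disjE conjE) simp_all
    show "cj g\<^sub>b ((A + B) / k) = (A - B) / k" unfolding cj_a cA cB gb by (simp add: A_def B_def)
    show "cj g\<^sub>b w = w" by (rule gb(3))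
    show "cj g\<^sub>c ((A + B) / k) = (A + B) / k" unfolding cj_a cA cB gc by (simp add: A_def B_def)
    show "cj g\<^sub>c w = w" by (rule gc(4))
    show "cj g\<^sub>c (C / k) = - (C / k)" using cj_k[OF CF] cj_C by simp
  qed
qed

end

section \<open>Quadratic residues\<close>

lemma odd_prime_gt_2: "prime (p :: int) \<Longrightarrow> p \<noteq> 2 \<Longrightarrow> p > 2"
  using prime_gt_1_int[of p] by simp

lemma prime_nat_of_int: "prime (p :: int) \<Longrightarrow> prime (nat p)"
  using prime_int_nat_transfer[of p] by blast

lemma euler_criterion_int:
  fixes p a :: int
  assumes p: "prime p" "p > 2" and a: "\<not> p dvd a"
  shows "[a ^ (nat ((p - 1) div 2)) = (if QuadRes p a then 1 else - 1)] (mod p)"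
proof -
  have np: "prime (nat p)" "2 < nat p" using prime_nat_of_int[OF p(1)] p(2) by auto
  have e: "(nat p - 1) div 2 = nat ((p - 1) div 2)"
  proof -
    have "nat ((p - 1) div 2) = nat (p - 1) div nat 2" using p(2) by (intro nat_div_distrib) simp
    also have "nat (p - 1) = nat p - nat 1" using p(2) by (intro nat_diff_distrib) simp_all
    finally show ?thesis by simp
  qed
  have "[Legendre a p = a ^ (nat ((p - 1) div 2))] (mod p)"
    using euler_criterion[OF np, of a] p(2) unfolding e by simp
  moreover have "Legendre a p = (if QuadRes p a then 1 else - 1)"
    using a by (simp add: Legendre_def cong_0_iff)
  ultimately show ?thesis by (simp only: cong_sym)
qed

lemma quadres_iff:
  fixes p a :: int
  assumes p: "prime p" "p > 2" and a: "\<not> p dvd a"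
  shows "QuadRes p a \<longleftrightarrow> [a ^ (nat ((p - 1) div 2)) = 1] (mod p)"
proof -
  have "\<not> [- 1 = 1] (mod p)"
    using p(2) zdvd_imp_le[of p 2] by (auto simp: cong_iff_dvd_diff)
  then show ?thesis
    using euler_criterion_int[OF assms] cong_trans[OF cong_sym] by (cases "QuadRes p a") auto
qed

lemma quadres_minus_one:
  fixes p :: int
  assumes "prime p" "p mod 4 = 1"
  obtains i where "p dvd i\<^sup>2 + 1"
proof -
  have "p > 2" using odd_prime_gt_2[OF assms(1)] assms(2) by force
  moreover have "even (nat ((p - 1) div 2))" using assms(2) \<open>p > 2\<close> by (simp add: even_nat_iff) presburger
  moreover have "\<not> p dvd - 1" using prime_gt_1_int[OF assms(1)] by simp
  ultimately have "QuadRes p (- 1)" using quadres_iff[OF assms(1), of "- 1"] by simp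
  then show thesis using that by (auto simp: QuadRes_def cong_iff_dvd_diff)
qed

text \<open>The product of two nonresidues is a residue, hence so is the quotient b / a, and -b / a
  too because -1 is a square modulo \<open>p\<close>. For p = 2, t = s = 1 works.\<close>

lemma quadratic_nonresidue_ratio:
  fixes p a b :: int
  assumes p: "prime p" "p = 2 \<or> p mod 4 = 1" and ab: "\<not> p dvd a" "\<not> p dvd b"
    and nr: "p \<noteq> 2 \<Longrightarrow> \<not> QuadRes p a" "p \<noteq> 2 \<Longrightarrow> \<not> QuadRes p b"
  shows "\<exists>t. p dvd a * t\<^sup>2 - b" "\<exists>s. p dvd a * s\<^sup>2 + b"
proof -
  have "(\<exists>t. p dvd a * t\<^sup>2 - b) \<and> (\<exists>s. p dvd a * s\<^sup>2 + b)"
  proof (cases "p = 2")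
    case True
    then have "p dvd a * 1\<^sup>2 - b" "p dvd a * 1\<^sup>2 + b" using ab by auto
    then show ?thesis by blast
  next
    case False
    then have p2: "p > 2" using odd_prime_gt_2 p(1) by blast
    define h where "h = nat ((p - 1) div 2)"
    have neg: "[x ^ h = - 1] (mod p)" if "\<not> p dvd x" "\<not> QuadRes p x" for x
      using euler_criterion_int[OF p(1) p2 that(1)] that(2) by (simp add: h_def)
    have "[(a * b) ^ h = (- 1) * (- 1)] (mod p)"
      unfolding power_mult_distrib using neg[OF ab(1) nr(1)[OF False]] neg[OF ab(2) nr(2)[OF False]]
      by (rule cong_mult)
    moreover have "\<not> p dvd a * b" using ab p(1) by (simp add: prime_dvd_mult_iff)
    ultimately have "QuadRes p (a * b)" using quadres_iff[OF p(1) p2] by (simp add: h_def)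
    then obtain y where y: "p dvd y\<^sup>2 - a * b" by (auto simp: QuadRes_def cong_iff_dvd_diff)
    have "coprime a p" using prime_imp_coprime[OF p(1) ab(1)] by (simp add: coprime_commute)
    then obtain a' where a': "[a * a' = 1] (mod p)" using cong_solve_coprime_int by blast
    obtain i where i: "p dvd i\<^sup>2 + 1" using quadres_minus_one[OF p(1)] p(2) False by blast
    obtain k where k: "a * a' = 1 + p * k" using a' by (metis cong_iff_lin mult.commute cong_sym)
    obtain l where l: "y\<^sup>2 = a * b + p * l" using y by (metis add.commute diff_add_cancel dvdE)
    have "a * (a' * y)\<^sup>2 - b = (a * a') * a' * y\<^sup>2 - b" by (simp add: power2_eq_square)
    also have "\<dots> = (1 + p * k) * a' * (a * b + p * l) - b" unfolding k l ..
    also have "\<dots> = (a * a') * b + p * (k * a' * (a * b + p * l) + a' * l) - b" by (simp add: algebra_simps)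
    also have "\<dots> = p * (k * b + (k * a' * (a * b + p * l) + a' * l))" unfolding k by (simp add: algebra_simps)
    finally have 1: "p dvd a * (a' * y)\<^sup>2 - b" by simp
    have "a * (i * (a' * y))\<^sup>2 + b = (a * (a' * y)\<^sup>2) * (i\<^sup>2 + 1) - (a * (a' * y)\<^sup>2 - b)"
      by (simp add: power_mult_distrib algebra_simps)
    also have "p dvd \<dots>" by (intro dvd_diff dvd_mult i 1)
    finally show ?thesis using 1 by blast
  qed
  then show "\<exists>t. p dvd a * t\<^sup>2 - b" "\<exists>s. p dvd a * s\<^sup>2 + b" by blast+
qed

lemma quadres_symmetric:
  fixes p q :: int
  assumes p: "prime p" "p > 2" and q: "prime q" "q > 2" and "p \<noteq> q" and mod4: "p mod 4 = 1"
  shows "QuadRes p q \<longleftrightarrow> QuadRes q p"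
proof -
  have np: "prime (nat p)" "prime (nat q)" using prime_nat_of_int p(1) q(1) by blast+
  have "even ((p - 1) div 2)" using mod4 by presburger
  then have "even (nat ((p - 1) div 2 * ((q - 1) div 2)))" using p(2) q(2) by (simp add: even_nat_iff)
  then have "Legendre p q * Legendre q p = 1"
    using Quadratic_Reciprocity_int[OF np(1) p(2) np(2) q(2) \<open>p \<noteq> q\<close>] by simp
  moreover have "\<not> [p = 0] (mod q)" "\<not> [q = 0] (mod p)"
    using primes_dvd_imp_eq[OF p(1) q(1)] primes_dvd_imp_eq[OF q(1) p(1)] \<open>p \<noteq> q\<close> by (auto simp: cong_0_iff)
  ultimately show ?thesis by (simp add: Legendre_def split: if_splits)
qed

text \<open>For primes congruent to \<open>1\<close> modulo \<open>4\<close> both conditions are equivalent; for \<open>p = 2\<close> the first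
  one is void.\<close>

definition linked :: "int \<Rightarrow> int \<Rightarrow> bool"
  where "linked p q \<longleftrightarrow> QuadRes p q \<and> QuadRes q p"

lemma linked_commute: "linked p q \<longleftrightarrow> linked q p"
  by (auto simp: linked_def)

lemma quadres_2: "QuadRes 2 a"
proof -
  have "even (a\<^sup>2 - a)" by simp
  then show ?thesis by (auto simp: QuadRes_def cong_iff_dvd_diff)
qed

lemma not_linked_nonresidue:
  assumes "prime p" "p = 2 \<or> p mod 4 = 1" "prime q" "q = 2 \<or> q mod 4 = 1" "p \<noteq> q" "\<not> linked p q" "p \<noteq> 2"
  shows "\<not> QuadRes p q"
proof (cases "q = 2")
  case True
  then show ?thesis using assms(6) quadres_2[of p] by (simp add: linked_def)
next
  case False
  then show ?thesis
    using assms quadres_symmetric[of p q] odd_prime_gt_2 by (auto simp: linked_def)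
qed

text \<open>Both 4 and -4 are squares modulo \<open>p\<close>. If \<open>p\<close> were 3 modulo 4,
  the exponent in Euler's criterion would be odd and the two powers would be negatives of each
  other, so \<open>p\<close> would divide 2.\<close>

lemma prime_mod4_of_sum_square:
  fixes p x y :: int
  assumes p: "prime p" and eq: "p * y\<^sup>2 = x\<^sup>2 + 4"
  shows "p = 2 \<or> p mod 4 = 1"
proof (rule ccontr)
  assume c: "\<not> ?thesis"
  have p2: "p > 2" using c p odd_prime_gt_2 by blast
  have "odd p" using p p2 by (simp add: prime_odd_int)
  then have m3: "p mod 4 = 3" using c by presburger
  have nd: "\<not> p dvd 4"
  proof
    assume "p dvd 4"
    then have "p dvd 2 * 2" by simp
    then have "p dvd 2" using prime_dvd_multD[OF p] by blast
    then show False using p2 zdvd_imp_le[of p 2] by simp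
  qed
  have "\<not> p dvd 2" using p2 zdvd_imp_le[of p 2] by auto
  have "[x\<^sup>2 = - 4] (mod p)" using arg_cong[OF eq, of "\<lambda>z. p dvd z"] by (simp add: cong_iff_dvd_diff)
  then have Q: "QuadRes p (- 4)" by (auto simp: QuadRes_def)
  have Q4: "QuadRes p 4" unfolding QuadRes_def by (intro exI[of _ 2]) simp
  define h where "h = nat ((p - 1) div 2)"
  have "odd h" using m3 p2 by (simp add: h_def even_nat_iff) presburger
  have "[(- 4) ^ h = 1] (mod p)" using quadres_iff[OF p p2, of "- 4"] Q nd by (simp add: h_def)
  moreover have "[4 ^ h = 1] (mod p)" using quadres_iff[OF p p2 nd] Q4 by (simp add: h_def)
  moreover have "(- 4) ^ h = - (4 ^ h :: int)" using \<open>odd h\<close> by simp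
  ultimately have "p dvd - (4 ^ h) - 1" "p dvd 4 ^ h - 1" by (simp_all add: cong_iff_dvd_diff)
  then have "p dvd (- (4 ^ h) - 1) + (4 ^ h - 1)" by (rule dvd_add)
  then show False using \<open>\<not> p dvd 2\<close> by simp
qed

section \<open>Primes whose square roots lie in the field\<close>

lemma prime_mult_nonsquare:
  fixes p m k :: int
  assumes "prime p" "\<not> p dvd m"
  shows "k\<^sup>2 \<noteq> p * m"
proof
  assume eq: "k\<^sup>2 = p * m"
  then have "p dvd k\<^sup>2" by simp
  then have "p dvd k" using prime_dvd_power[OF assms(1)] by blast
  then obtain l where "k = p * l" by blast
  then have "p * (p * l\<^sup>2) = p * m" using eq by (simp add: power2_eq_square algebra_simps)
  then have "p * l\<^sup>2 = m" using assms(1) by auto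
  then show False using assms(2) by auto
qed

lemma distinct_primes_not_dvd:
  fixes p q :: int
  assumes "prime p" "prime q" "p \<noteq> q"
  shows "\<not> p dvd q"
  using primes_dvd_imp_eq[OF assms(1,2)] assms(3) by blast

context odd_class_field
begin

text \<open>Let w be the norm of \<open>u\<close> to Q(sqrt p) and w' its conjugate, so w w' = -1.
  Then x = w + w' and y = (w - w') sqrt p are rational integers with y^2 = (x^2 + 4) p, so
  \<open>p\<close> divides y and x^2 + 4 has the form p z^2.\<close>

lemma prime_mod4:
  fixes p :: int
  assumes p: "prime p" "sqrt (of_int p) \<in> F" and t: "cj t (sqrt (of_int p)) = - sqrt (of_int p)"
  shows "p = 2 \<or> p mod 4 = 1"
proof -
  define s where "s = sqrt (of_int p)"
  have p0: "p > 0" using prime_gt_0_int[OF p(1)] .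
  have s: "s \<in> F" "s \<noteq> 0" "\<And>g. cj g s = s \<or> cj g s = - s"
    unfolding s_def using p p0 cj_sqrt[OF p(2) p0] by auto
  have ss: "s * s = of_int p" using p0 by (simp add: s_def)
  obtain w where w: "w \<in> unit_grp" "\<And>g. cj g s = s \<Longrightarrow> cj g w = w"
    "\<And>g. cj g s \<noteq> s \<Longrightarrow> cj g w * w = nrm u"
    using relative_norm_unit[OF s u_unit] by blast
  have wF: "w \<in> F" "w \<noteq> 0" using w(1) unit_grpD by auto
  define w' where "w' = cj t w"
  have w'F: "w' \<in> F" unfolding w'_def using wF by (simp add: cj_mem)
  have "cj t s \<noteq> s" using t s(2) by (simp add: s_def)
  then have ww': "w' * w = - 1" using w(3)[of t] by (simp add: w'_def nrm_u)
  have act: "cj g w = w \<and> cj g w' = w'" if "cj g s = s" for g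
  proof -
    have "cj g w' = cj t (cj g w)" using wF by (simp add: w'_def cj_cj add.commute)
    then show ?thesis using w(2)[OF that] by (simp add: w'_def)
  qed
  have act': "cj g w = w' \<and> cj g w' = w" if "cj g s \<noteq> s" for g
  proof -
    have "cj g w * w = w' * w" using w(3)[OF that] ww' by (simp add: nrm_u)
    then have 1: "cj g w = w'" using wF(2) by simp
    have "cj g w' * cj g w = - 1"
      using arg_cong[OF ww', of "cj g"] wF w'F by (simp add: cj_mult cj_uminus)
    then have "w' * cj g w' = w' * w" using ww' 1 by (simp add: mult.commute)
    moreover have "w' \<noteq> 0" using ww' by auto
    ultimately show ?thesis using 1 by simp
  qed
  have wI: "w \<in> ints" "w' \<in> ints" using w(1) unit_grpD(3) by (auto simp: w'_def ints_cj)
  have sI: "s \<in> ints" using p(2) unfolding s_def by (rule ints_sqrt)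
  have "cj g (w + w') = w + w'" for g
    using act[of g] act'[of g] wF w'F by (cases "cj g s = s") (simp_all add: cj_add)
  then have "w + w' \<in> \<int>"
    by (intro ints_rat_int fixed_rational ints_add wI add_mem wF w'F)
  then obtain x where x: "w + w' = of_int x" by (rule Ints_cases)
  have "cj g ((w - w') * s) = (w - w') * s" for g
  proof -
    have "cj g ((w - w') * s) = (cj g w - cj g w') * cj g s"
      using cj_mult[OF diff_mem[OF wF(1) w'F] s(1)] cj_diff[OF wF(1) w'F] by simp
    then show ?thesis
      using act[of g] act'[of g] s(3)[of g] by (cases "cj g s = s") (auto simp: algebra_simps)
  qed
  then have "(w - w') * s \<in> \<int>"
    by (intro ints_rat_int fixed_rational ints_mult ints_diff wI sI mult_mem diff_mem wF w'F s(1))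
  then obtain y where y: "(w - w') * s = of_int y" by (rule Ints_cases)
  have "(of_int y :: real)\<^sup>2 = ((w + w')\<^sup>2 - 4 * (w' * w)) * (s * s)"
    unfolding y[symmetric] by (simp add: power2_eq_square algebra_simps)
  also have "\<dots> = ((of_int x)\<^sup>2 + 4) * of_int p" unfolding x ww' ss by simp
  finally have "of_int (y\<^sup>2) = (of_int ((x\<^sup>2 + 4) * p) :: real)" by simp
  then have eq: "y\<^sup>2 = (x\<^sup>2 + 4) * p" by (simp only: of_int_eq_iff)
  then have "p dvd y\<^sup>2" by simp
  then have "p dvd y" using prime_dvd_power[OF p(1)] by blast
  then obtain z where "y = p * z" by blast
  then have "p * (p * z\<^sup>2) = p * (x\<^sup>2 + 4)" using eq by (simp add: power2_eq_square algebra_simps)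
  then have "p * z\<^sup>2 = x\<^sup>2 + 4" using p0 by simp
  then show ?thesis by (rule prime_mod4_of_sum_square[OF p(1)])
qed

text \<open>Being linked gives exactly the conditions for x^2 = p y^2 + q z^2. With a = 1 no
  conjugation moves sqrt a, so the compensating unit can be 1.\<close>

lemma linked_primes:
  fixes p q :: int
  assumes p: "prime p" "sqrt (of_int p) \<in> F" and q: "prime q" "sqrt (of_int q) \<in> F"
    and g: "cj g (sqrt (of_int p)) = - sqrt (of_int p)"
    and h: "cj h (sqrt (of_int q)) = - sqrt (of_int q)" "cj h (sqrt (of_int p)) = sqrt (of_int p)"
    and linked: "linked p q"
  shows False
proof -
  have pq: "p \<noteq> q" using h prime_gt_0_int[OF p(1)] by auto
  have nd: "\<not> p dvd q" "\<not> q dvd p" using distinct_primes_not_dvd p(1) q(1) pq by auto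
  have n1: "\<not> p dvd 1" "\<not> q dvd 1" using prime_gt_1_int[OF p(1)] prime_gt_1_int[OF q(1)] by auto
  obtain t w where t: "p dvd t\<^sup>2 - q" and w: "q dvd w\<^sup>2 - p"
    using linked by (auto simp: linked_def QuadRes_def cong_iff_dvd_diff)
  have m4: "p = 2 \<or> p mod 4 = 1" using prime_mod4[OF p g] .
  have cop: "coprime p q" using prime_imp_coprime[OF p(1) nd(1)] .
  obtain x y z where "z \<noteq> 0" "1 * x\<^sup>2 = p * y\<^sup>2 + q * z\<^sup>2" "coprime (1 * x) (p * y)"
    "odd (q * z) \<or> (even z \<and> odd (1 * x) \<and> odd (p * y))"
  \<comment> \<open>The condition modulo a = 1 is empty, so 0 stands in for
    \<open>s\<close>.\<close>
  proof (rule legendre_primitive[of 1 p q 0 t w])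
    show "k\<^sup>2 \<noteq> p * q" for k using prime_mult_nonsquare[OF p(1) nd(1)] .
    show "k\<^sup>2 \<noteq> 1 * q" for k using prime_mult_nonsquare[OF q(1) n1(2), of k] by simp
    show "k\<^sup>2 \<noteq> 1 * p" for k using prime_mult_nonsquare[OF p(1) n1(1), of k] by simp
    show "squarefree p" "squarefree q" using p(1) q(1) by (simp_all add: squarefree_prime)
    show "p mod 4 = 1" if "odd p" using m4 that by auto
  qed (use prime_gt_0_int[OF p(1)] prime_gt_0_int[OF q(1)] cop t w in auto)
  then show False
    by (intro no_ternary_zero[of 1 p q 1 g h z x y])
      (use p q g h prime_gt_0_int[OF p(1)] prime_gt_0_int[OF q(1)] in simp_all)
qed

text \<open>Each condition for q x^2 = p y^2 + r z^2 compares two nonresidues modulo the third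
  prime, so \<open>quadratic_nonresidue_ratio\<close> provides it. The norm of \<open>u\<close> to
  Q(sqrt q) serves as the compensating unit.\<close>

lemma unlinked_primes:
  fixes p q r :: int
  assumes p: "prime p" "sqrt (of_int p) \<in> F" and q: "prime q" "sqrt (of_int q) \<in> F"
      and r: "prime r" "sqrt (of_int r) \<in> F"
    and g\<^sub>p: "cj g\<^sub>p (sqrt (of_int p)) = - sqrt (of_int p)" "cj g\<^sub>p (sqrt (of_int q)) = sqrt (of_int q)"
    and g\<^sub>q: "cj g\<^sub>q (sqrt (of_int q)) = - sqrt (of_int q)"
    and g\<^sub>r: "cj g\<^sub>r (sqrt (of_int r)) = - sqrt (of_int r)" "cj g\<^sub>r (sqrt (of_int p)) = sqrt (of_int p)"
      "cj g\<^sub>r (sqrt (of_int q)) = sqrt (of_int q)"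
    and unlinked: "\<not> linked p q" "\<not> linked p r" "\<not> linked q r"
  shows False
proof -
  have pos: "p > 0" "q > 0" "r > 0" using prime_gt_0_int p(1) q(1) r(1) by blast+
  have ne: "p \<noteq> q" "p \<noteq> r" "q \<noteq> r" using g\<^sub>p g\<^sub>r pos by auto
  have nd: "\<not> p dvd q" "\<not> q dvd p" "\<not> p dvd r" "\<not> r dvd p" "\<not> q dvd r" "\<not> r dvd q"
    using distinct_primes_not_dvd p(1) q(1) r(1) ne by auto
  have m4: "p = 2 \<or> p mod 4 = 1" "q = 2 \<or> q mod 4 = 1" "r = 2 \<or> r mod 4 = 1"
    using prime_mod4[OF p g\<^sub>p(1)] prime_mod4[OF q g\<^sub>q] prime_mod4[OF r g\<^sub>r(1)] by blast+
  have unl: "\<not> linked q p" "\<not> linked r p" "\<not> linked r q" using unlinked linked_commute by blast+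
  have nr: "p \<noteq> 2 \<Longrightarrow> \<not> QuadRes p q" "p \<noteq> 2 \<Longrightarrow> \<not> QuadRes p r" "q \<noteq> 2 \<Longrightarrow> \<not> QuadRes q p"
    "q \<noteq> 2 \<Longrightarrow> \<not> QuadRes q r" "r \<noteq> 2 \<Longrightarrow> \<not> QuadRes r p" "r \<noteq> 2 \<Longrightarrow> \<not> QuadRes r q"
    using not_linked_nonresidue p(1) q(1) r(1) m4 ne unlinked unl by metis+
  obtain s where s: "q dvd p * s\<^sup>2 + r"
    using quadratic_nonresidue_ratio(2)[OF q(1) m4(2) nd(2,5) nr(3,4)] by blast
  obtain t where t: "p dvd q * t\<^sup>2 - r"
    using quadratic_nonresidue_ratio(1)[OF p(1) m4(1) nd(1,3) nr(1,2)] by blast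
  obtain w where w: "r dvd q * w\<^sup>2 - p"
    using quadratic_nonresidue_ratio(1)[OF r(1) m4(3) nd(6,4) nr(6,5)] by blast
  obtain x y z where xyz: "z \<noteq> 0" "q * x\<^sup>2 = p * y\<^sup>2 + r * z\<^sup>2" "coprime (q * x) (p * y)"
    "odd (r * z) \<or> (even z \<and> odd (q * x) \<and> odd (p * y))"
  proof (rule legendre_primitive[of q p r s t w])
    show "k\<^sup>2 \<noteq> p * r" for k using prime_mult_nonsquare[OF p(1) nd(3)] .
    show "k\<^sup>2 \<noteq> q * r" for k using prime_mult_nonsquare[OF q(1) nd(5)] .
    show "k\<^sup>2 \<noteq> q * p" for k using prime_mult_nonsquare[OF q(1) nd(2)] .
    show "coprime q p" "coprime q r" "coprime p r"
      using prime_imp_coprime[OF q(1) nd(2)] prime_imp_coprime[OF q(1) nd(5)] prime_imp_coprime[OF p(1) nd(3)] .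
    show "squarefree q" "squarefree p" "squarefree r" using p(1) q(1) r(1) by (simp_all add: squarefree_prime)
    show "q mod 4 = 1" if "odd q" using m4(2) that by auto
    show "p mod 4 = 1" if "odd p" using m4(1) that by auto
  qed (use pos s t w in auto)
  define v where "v = sqrt (of_int q)"
  have v: "v \<in> F" "v \<noteq> 0" "\<And>g. cj g v = v \<or> cj g v = - v"
    unfolding v_def using q pos(2) cj_sqrt[OF q(2) pos(2)] by auto
  obtain e where e: "e \<in> unit_grp" "\<And>g. cj g v = v \<Longrightarrow> cj g e = e" "\<And>g. cj g v \<noteq> v \<Longrightarrow> cj g e * e = nrm u"
    using relative_norm_unit[OF v u_unit] by blast
  have act: "cj g v = v \<and> cj g e = e \<or> cj g v = - v \<and> cj g e * e = - 1" for g
    using v(3)[of g] e(2,3)[of g] nrm_u by auto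
  show False
    by (rule no_ternary_zero[OF pos(2,1,3) q(2) p(2) r(2) e(1) act[unfolded v_def] g\<^sub>p(2,1) _ g\<^sub>r(3,2,1) _ xyz])
      (use e(2) g\<^sub>p(2) g\<^sub>r(3) in \<open>simp_all add: v_def\<close>)
qed

text \<open>Faithfulness yields three primes and a dual basis of conjugations, the i-th of which
  negates the root of the i-th prime and fixes the other two. Then either two of the primes are
  linked or no two are.\<close>

lemma no_faithful_action_on_square_roots:
  assumes faithful: "\<And>g. (\<And>k :: int. k > 0 \<Longrightarrow> sqrt (of_int k) \<in> F \<Longrightarrow> cj g (sqrt (of_int k)) = sqrt (of_int k)) \<Longrightarrow> g = 0"
  shows False
proof -
  define fixes_root where "fixes_root g p \<longleftrightarrow> cj g (sqrt (of_int p)) = sqrt (of_int p)" for g and p :: int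
  define P where "P = {p :: int. prime p \<and> sqrt (of_int p) \<in> F}"
  have flip: "\<not> fixes_root g p \<longleftrightarrow> cj g (sqrt (of_int p)) = - sqrt (of_int p)" if "p \<in> P" for g p
    using cj_sqrt[of p g] that prime_gt_0_int[of p] by (auto simp: fixes_root_def P_def)
  have add: "fixes_root (g + h) p \<longleftrightarrow> (fixes_root g p \<longleftrightarrow> fixes_root h p)" if "p \<in> P" for g h p
    unfolding fixes_root_def
    using that prime_gt_0_int[of p] cj_sqrt[of p] by (intro cj_eq_add) (auto simp: P_def)
  have moved: "\<exists>p\<in>P. \<not> fixes_root g p" if "g \<noteq> 0" for g
    using faithful[of g] fixed_sqrt[of g] that unfolding P_def fixes_root_def by blast
  \<comment> \<open>Eight conjugations but only four pairs of truth values: two conjugations agree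
    on both roots, and their sum fixes both.\<close>
  have kernel: "\<exists>g. g \<noteq> 0 \<and> fixes_root g p \<and> fixes_root g q" if pq: "p \<in> P" "q \<in> P" for p q
  proof -
    have "\<not> inj_on (\<lambda>g. (fixes_root g p, fixes_root g q)) UNIV"
    proof
      assume "inj_on (\<lambda>g. (fixes_root g p, fixes_root g q)) UNIV"
      then have "card (UNIV :: bit3 set) \<le> card (UNIV :: (bool \<times> bool) set)"
        by (rule card_inj_on_le) simp_all
      moreover have "card (UNIV :: bit3 set) = 8" using sum_UNIV_bit3[of "\<lambda>_. 1 :: nat"] by simp
      ultimately show False by (simp add: card_cartesian_product flip: UNIV_Times_UNIV)
    qed
    then obtain g h where gh: "g \<noteq> h" "fixes_root g p = fixes_root h p" "fixes_root g q = fixes_root h q"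
      unfolding inj_on_def prod.inject by blast
    then have "fixes_root (g + h) p" "fixes_root (g + h) q" using add pq by simp_all
    moreover have "g + h \<noteq> 0"
      using gh(1) bit3_minus[of h] by (metis eq_neg_iff_add_eq_0)
    ultimately show ?thesis by blast
  qed
  have "(1, 0, 0) \<noteq> (0 :: bit3)" by (simp add: zero_prod_def)
  then obtain g\<^sub>1 p\<^sub>1 where p1: "p\<^sub>1 \<in> P" "\<not> fixes_root g\<^sub>1 p\<^sub>1" using moved by blast
  obtain g\<^sub>2 where g2: "g\<^sub>2 \<noteq> 0" "fixes_root g\<^sub>2 p\<^sub>1" using kernel[OF p1(1) p1(1)] by blast
  obtain p\<^sub>2 where p2: "p\<^sub>2 \<in> P" "\<not> fixes_root g\<^sub>2 p\<^sub>2" using moved[OF g2(1)] by blast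
  obtain g\<^sub>3 where g3: "g\<^sub>3 \<noteq> 0" "fixes_root g\<^sub>3 p\<^sub>1" "fixes_root g\<^sub>3 p\<^sub>2" using kernel[OF p1(1) p2(1)] by blast
  obtain p\<^sub>3 where p3: "p\<^sub>3 \<in> P" "\<not> fixes_root g\<^sub>3 p\<^sub>3" using moved[OF g3(1)] by blast
  define t\<^sub>3 where "t\<^sub>3 = g\<^sub>3"
  \<comment> \<open>Elimination modulo 2: adding an already constructed conjugation repairs the
    action on one further root without disturbing the others.\<close>
  define t\<^sub>2 where "t\<^sub>2 = (if fixes_root g\<^sub>2 p\<^sub>3 then g\<^sub>2 else g\<^sub>2 + g\<^sub>3)"
  have t2: "fixes_root t\<^sub>2 p\<^sub>1" "\<not> fixes_root t\<^sub>2 p\<^sub>2" "fixes_root t\<^sub>2 p\<^sub>3"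
    using g2 g3 p2 p3 p1(1) by (auto simp: t\<^sub>2_def add)
  define g\<^sub>1' where "g\<^sub>1' = (if fixes_root g\<^sub>1 p\<^sub>3 then g\<^sub>1 else g\<^sub>1 + g\<^sub>3)"
  have g1': "\<not> fixes_root g\<^sub>1' p\<^sub>1" "fixes_root g\<^sub>1' p\<^sub>3"
    using p1 g3 p3 by (auto simp: g\<^sub>1'_def add)
  define t\<^sub>1 where "t\<^sub>1 = (if fixes_root g\<^sub>1' p\<^sub>2 then g\<^sub>1' else g\<^sub>1' + t\<^sub>2)"
  have t1: "\<not> fixes_root t\<^sub>1 p\<^sub>1" "fixes_root t\<^sub>1 p\<^sub>2" "fixes_root t\<^sub>1 p\<^sub>3"
    using g1' t2 p1(1) p2(1) p3(1) by (auto simp: t\<^sub>1_def add)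
  have t3: "fixes_root t\<^sub>3 p\<^sub>1" "fixes_root t\<^sub>3 p\<^sub>2" "\<not> fixes_root t\<^sub>3 p\<^sub>3"
    using g3 p3 by (simp_all add: t\<^sub>3_def)
  have P: "prime p\<^sub>1" "sqrt (of_int p\<^sub>1) \<in> F" "prime p\<^sub>2" "sqrt (of_int p\<^sub>2) \<in> F"
      "prime p\<^sub>3" "sqrt (of_int p\<^sub>3) \<in> F"
    using p1 p2 p3 by (simp_all add: P_def)
  note t1 = t1(1)[unfolded flip[OF p1(1)]] t1(2,3)[unfolded fixes_root_def]
    and t2 = t2(2)[unfolded flip[OF p2(1)]] t2(1,3)[unfolded fixes_root_def]
    and t3 = t3(3)[unfolded flip[OF p3(1)]] t3(1,2)[unfolded fixes_root_def]
  have l12: "\<not> linked p\<^sub>1 p\<^sub>2" using linked_primes[OF P(1-4) t1(1) t2(1,2)] by blast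
  have l13: "\<not> linked p\<^sub>1 p\<^sub>3" using linked_primes[OF P(1,2,5,6) t1(1) t3(1,2)] by blast
  have l23: "\<not> linked p\<^sub>2 p\<^sub>3" using linked_primes[OF P(3-6) t2(1) t3(1,3)] by blast
  show False
    by (rule unlinked_primes[OF P t1(1,2) t2(1) t3(1-3) l12 l13 l23])
qed

end

section \<open>The triquadratic field as an instance of the abstract setting\<close>

context three_roots
begin

definition conj_map :: "bit3 \<Rightarrow> real \<Rightarrow> real"
  where "conj_map g = restr (inv_into (embeddings L) sign_pattern g)"

context
  assumes galois: "galois_group L \<cong> integer_mod_group 2 \<times>\<times> integer_mod_group 2 \<times>\<times> integer_mod_group 2"
begin

lemma inv_embedding:
  "inv_into (embeddings L) sign_pattern g \<in> embeddings L"
  "sign_pattern (inv_into (embeddings L) sign_pattern g) = g"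
proof -
  have "g \<in> sign_pattern ` embeddings L"
    using bij_betw_imp_surj_on[OF bij_betw_sign_pattern[OF galois]] by simp
  then show "inv_into (embeddings L) sign_pattern g \<in> embeddings L"
    "sign_pattern (inv_into (embeddings L) sign_pattern g) = g"
    by (rule inv_into_into, rule f_inv_into_f)
qed

lemma conj_map_roots:
  "conj_map (a, b, c) r\<^sub>1 = sgn_bit a * r\<^sub>1" "conj_map (a, b, c) r\<^sub>2 = sgn_bit b * r\<^sub>2"
  "conj_map (a, b, c) r\<^sub>3 = sgn_bit c * r\<^sub>3"
  using restr_roots[OF inv_embedding[of "(a, b, c)"]] by (simp_all add: conj_map_def)

lemma elementary_abelian: "elementary_abelian_field F\<^sub>3 conj_map"
proof (rule elementary_abelian_field_sign_patterns)
  show "ring_map_on F\<^sub>3 (conj_map g)" for g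
    unfolding conj_map_def by (rule ring_map_restr[OF inv_embedding(1)])
qed (rule conj_map_roots)+

lemma conj_map_faithful:
  assumes "conj_map g r\<^sub>1 = r\<^sub>1" "conj_map g r\<^sub>2 = r\<^sub>2" "conj_map g r\<^sub>3 = r\<^sub>3"
  shows "g = 0"
proof -
  obtain a b c where g: "g = (a, b, c)" by (rule prod_cases3)
  have "d = 0" if "sgn_bit d * s = s" "s \<noteq> 0" for d s
    using that bit_exhaust[of d] by auto
  then show ?thesis
    using assms r_nz unfolding g conj_map_roots zero_prod_def by blast
qed

lemma field_norm_of_real:
  assumes "x \<in> F\<^sub>3"
  shows "field_norm L (of_real x) = of_real (elementary_abelian_field.nrm conj_map x)"
proof -
  let ?e = "inv_into (embeddings L) sign_pattern"
  have "field_norm L (of_real x) = (\<Prod>g\<in>UNIV. ?e g (of_real x))"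
    unfolding field_norm_def
    by (rule prod.reindex_bij_betw[OF bij_betw_inv_into[OF bij_betw_sign_pattern[OF galois]], symmetric])
  also have "\<dots> = (\<Prod>g\<in>UNIV. of_real (conj_map g x))"
    by (rule prod.cong[OF refl]) (simp add: embedding_real[OF inv_embedding(1) assms] conj_map_def)
  finally show ?thesis
    by (simp add: elementary_abelian_field.nrm_def[OF elementary_abelian])
qed

text \<open>Integers of the complex field are the images of \<open>E.ints\<close>, so
  \<open>odd_class_number_square\<close> transfers to the reals; its hypothesis on almost integral
  elements is supplied by \<open>E.almost_integral\<close>.\<close>

lemma odd_class_field_of_unit:
  assumes odd: "odd (class_number L)"
    and u: "u \<in> elementary_abelian_field.unit_grp F\<^sub>3" "elementary_abelian_field.nrm conj_map u = - 1"
  shows "odd_class_field F\<^sub>3 conj_map u"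
proof -
  interpret E: elementary_abelian_field F\<^sub>3 conj_map by (rule elementary_abelian)
  interpret N: number_field L unfolding L_def by (rule number_field_rat_adjoin)
  have mem: "complex_of_real x \<in> N.\<O> \<longleftrightarrow> x \<in> E.ints" for x
    unfolding N.\<O>_def E.ints_def unfolding L_eq by auto
  have almost: "z \<in> N.\<O>" if D: "D \<in> N.\<O>" "D \<noteq> 0" and z: "z \<in> L" "\<And>n. D * z ^ n \<in> N.\<O>" for D z
  proof -
    obtain x where x: "z = of_real x" "x \<in> F\<^sub>3" using z(1) L_eq by blast
    obtain d where d: "D = of_real d" using N.\<O>_closed(6)[OF D(1)] L_eq by blast
    have "d * x ^ n \<in> E.ints" for n
      using z(2)[of n] unfolding x(1) d by (simp only: mem flip: of_real_power of_real_mult)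
    moreover have "d \<in> E.ints" "d \<noteq> 0" using D unfolding d by (simp_all add: mem)
    ultimately have "x \<in> E.ints" using E.almost_integral[OF x(2)] by blast
    then show ?thesis by (simp add: x(1) mem)
  qed
  show ?thesis
  proof
    show "u \<in> E.unit_grp" "E.nrm u = - 1" by (rule u)+
    fix \<alpha> \<beta> \<kappa> t\<^sub>1 t\<^sub>2 t\<^sub>3 s\<^sub>1 s\<^sub>2 s\<^sub>3
    assume ints: "\<alpha> \<in> E.ints" "\<beta> \<in> E.ints" "\<kappa> \<in> E.ints" "\<kappa> \<noteq> 0"
        "t\<^sub>1 \<in> E.ints" "t\<^sub>2 \<in> E.ints" "t\<^sub>3 \<in> E.ints" "s\<^sub>1 \<in> E.ints" "s\<^sub>2 \<in> E.ints" "s\<^sub>3 \<in> E.ints"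
      and eqs: "\<alpha> * \<alpha> = \<kappa> * t\<^sub>1" "\<alpha> * \<beta> = \<kappa> * t\<^sub>2" "\<beta> * \<beta> = \<kappa> * t\<^sub>3"
        "t\<^sub>1 * s\<^sub>1 + t\<^sub>2 * s\<^sub>2 + t\<^sub>3 * s\<^sub>3 = 1"
    note ints' = ints(1-3,5-10)[folded mem]
    have k0: "complex_of_real \<kappa> \<noteq> 0" using ints(4) by simp
    have eqs': "complex_of_real \<alpha> * of_real \<alpha> = of_real \<kappa> * of_real t\<^sub>1"
        "complex_of_real \<alpha> * of_real \<beta> = of_real \<kappa> * of_real t\<^sub>2"
        "complex_of_real \<beta> * of_real \<beta> = of_real \<kappa> * of_real t\<^sub>3"
        "complex_of_real t\<^sub>1 * of_real s\<^sub>1 + of_real t\<^sub>2 * of_real s\<^sub>2 + of_real t\<^sub>3 * of_real s\<^sub>3 = 1"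
      by (simp_all only: eqs of_real_1 flip: of_real_mult of_real_add)
    obtain a e where ae: "a \<in> L" "a \<noteq> 0" "e \<in> N.\<O>" "inverse e \<in> N.\<O>" "complex_of_real \<kappa> = e * a\<^sup>2"
      by (rule N.odd_class_number_square[OF odd almost ints'(1-3) k0 ints'(4-9) eqs'])
    obtain x where x: "a = of_real x" "x \<in> F\<^sub>3" using ae(1) L_eq by blast
    obtain y where y: "e = of_real y" using N.\<O>_closed(6)[OF ae(3)] L_eq by blast
    have "complex_of_real \<kappa> = of_real (y * x\<^sup>2)" using ae(5) by (simp add: x(1) y)
    then have k: "\<kappa> = y * x\<^sup>2" by (simp only: of_real_eq_iff)
    have "y \<in> E.ints" "inverse y \<in> E.ints" using ae(3,4) by (simp_all add: y mem flip: of_real_inverse)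
    moreover have "y \<noteq> 0" using k ints(4) by auto
    ultimately have "y \<in> E.unit_grp" by (simp add: E.unit_grp_def E.ints_def)
    then show "\<exists>a\<in>F\<^sub>3. \<exists>e\<in>E.unit_grp. \<kappa> = e * a\<^sup>2" using x(2) k by blast
  qed
qed

end

end

theorem theorem7p8:
  fixes m n d :: int and L :: "complex set" and u :: complex
  assumes "m > 0" and "n > 0" and "d > 0"
    and "L = rat_adjoin {complex_of_real (sqrt (of_int m)), complex_of_real (sqrt (of_int n)),
                         complex_of_real (sqrt (of_int d))}"
    and "galois_group L \<cong> integer_mod_group 2 \<times>\<times> integer_mod_group 2 \<times>\<times> integer_mod_group 2"
    and "odd (class_number L)"
    and "u \<in> Units (ring_of_integers L)"
  shows "field_norm L u = 1"
proof -
  interpret R: three_roots "sqrt (of_int m)" "sqrt (of_int n)" "sqrt (of_int d)"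
    by standard (use assms(1-3) in simp_all)
  have L: "L = R.L" unfolding assms(4) R.L_def ..
  note galois = assms(5)[unfolded L] and odd = assms(6)[unfolded L]
  interpret E: elementary_abelian_field R.F\<^sub>3 R.conj_map by (rule R.elementary_abelian[OF galois])
  obtain v where uv: "u \<in> L" "algebraic_int u" "v \<in> L" "algebraic_int v" "u * v = 1"
    using assms(7) by (auto simp: Units_def ring_of_integers_def)
  obtain x where x: "u = of_real x" "x \<in> R.F\<^sub>3" using uv(1) unfolding L R.L_eq by blast
  have v: "v = inverse u" using inverse_unique[OF uv(5)] by simp
  have "x \<noteq> 0" using uv(5) x(1) by auto
  then have xU: "x \<in> E.unit_grp"
    using uv(2,4) x unfolding v by (simp add: E.unit_grp_def flip: of_real_inverse)
  have "\<bar>E.nrm x\<bar> = 1" using E.nrm_unit[OF xU] .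
  moreover have "E.nrm x \<noteq> - 1"
  proof
    assume "E.nrm x = - 1"
    then interpret O: odd_class_field R.F\<^sub>3 R.conj_map x
      by (rule R.odd_class_field_of_unit[OF galois odd xU])
    show False
    proof (rule O.no_faithful_action_on_square_roots)
      fix g
      assume fixed: "\<And>k :: int. k > 0 \<Longrightarrow> sqrt (of_int k) \<in> R.F\<^sub>3 \<Longrightarrow> R.conj_map g (sqrt (of_int k)) = sqrt (of_int k)"
      show "g = 0"
        \<comment> \<open>The roots of \<open>m\<close>, \<open>n\<close> and \<open>d\<close> are
          among the fixed square roots, and the signs on them determine \<open>g\<close>.\<close>
        by (rule R.conj_map_faithful[OF galois]) (intro fixed assms(1-3) R.F3_mem)+
    qed
  qed
  ultimately have "E.nrm x = 1" by linarith
  then show ?thesis unfolding L x(1) R.field_norm_of_real[OF galois x(2)] by simp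
qed

end
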